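(* Let $\Gamma$ be a countable infinite discrete amenable group and $f$ an element of $\mathbb Z\Gamma$ invertible in $\ell^1(\Gamma,\mathbb R)$. Then the action of $\Gamma$ on $X_f$, the Pontryagin dual of $\mathbb Z\Gamma/\mathbb Z\Gamma f$, has the specification property and the uniform separation property.
   Context: $\mathbb Z\Gamma$ is the integral group ring, a subring of the Banach algebra $\ell^1(\Gamma,\mathbb R)$ with convolution. $X_f=\widehat{\mathbb Z\Gamma/\mathbb Z\Gamma f}$ is a compact metrizable abelian group and $\Gamma$ acts on it by the continuous automorphisms dual to left multiplication on $\mathbb Z\Gamma/\mathbb Z\Gamma f$; fix a metric $\rho$ inducing the topology of $X=X_f$. Write $G=\Gamma$. $M(X)$ is the set of Borel probability measures on $X$ with the weak$^*$ topology, $E(X,G)$ the subset of ergodic $G$-invariant measures; $\mathcal N(\mu)$ is the family of weak$^*$ neighborhoods of $\mu$ in $M(X)$. A sequence $\{F_n\}$ of non-empty finite subsets of $G$ is a F{\o}lner sequence if $|sF_n\triangle F_n|/|F_n|\to 0$ for every $s\in G$; it is tempered if for some $C>0$ and all $n$, $|\bigcup_{k\le n}F_k^{-1}F_{n+1}|<C|F_{n+1}|$. $\mathcal{E}_F(x)=\frac1{|F|}\sum_{s\in F}\delta_{sx}$. $h_\mu(X,G)=\sup_\beta\lim_n\frac1{|F_n|}H_\mu(\bigvee_{s\in F_n}s^{-1}\beta)$ is the metric entropy (supremum over finite measurable partitions, any F{\o}lner sequence). Specification property: for every $\varepsilon>0$ there is a non-empty finite $F\subset G$ such that for any finite collection of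 finite subsets $F_1,\dots,F_m$ of $G$ with $FF_i\cap F_j=\emptyset$ for $1\le i\neq j\le m$, and any $x^1,\dots,x^m\in X$, there is $y\in X$ with $\rho(sx^i,sy)\le\varepsilon$ for all $s\in F_i$, $1\le i\le m$. Separated sets: for finite non-empty $F\subset G$ and $\delta,\varepsilon>0$, a set $A\subset X$ is $(\delta,F,\varepsilon)$-separated if $|\{s\in F:\rho(sx,sy)>\varepsilon\}|\ge\delta|F|$ for all $x\ne y$ in $A$. $X_{F,C}=\{x\in X:\mathcal E_F(x)\in C\}$ and $N(C;\delta,F,\varepsilon)$ is the maximal cardinality of a $(\delta,F,\varepsilon)$-separated subset of $X_{F,C}$. Uniform separation property: for every tempered F{\o}lner sequence $\{K_n\}$ and every $\eta>0$ there exist $\varepsilon^*>0$ and $\delta^*>0$ such that for every $\mu\in E(X,G)$ and every $C\in\mathcal N(\mu)$ there is $n^*_{C;\mu,\eta}\in\mathbb N$ with $N(C;\delta^*,K_n,\varepsilon^* )\ge e^{|K_n|(h_\mu(X,G)-\eta)}$ for all $n\ge n^*_{C;\mu,\eta}$. *)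

theory Defs
  imports "HOL-Probability.Probability" "HOL-Algebra.Algebra"
begin

section \<open>Amenable groups\<close>

definition folner_sequence :: "('g, 'b) monoid_scheme \<Rightarrow> (nat \<Rightarrow> 'g set) \<Rightarrow> bool" where
  "folner_sequence G F \<longleftrightarrow>
     (\<forall>n. finite (F n) \<and> F n \<noteq> {} \<and> F n \<subseteq> carrier G) \<and>
     (\<forall>s\<in>carrier G.
        (\<lambda>n. real (card (sym_diff (s <#\<^bsub>G\<^esub> F n) (F n))) / real (card (F n))) \<longlonglongrightarrow> 0)"

text \<open>For countable groups, the only ones considered here, amenability is taken to be the
  existence of a (left) F{\o}lner sequence.\<close>

definition amenable :: "('g, 'b) monoid_scheme \<Rightarrow> bool" where
  "amenable G \<longleftrightarrow> (\<exists>F. folner_sequence G F)"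

definition tempered :: "('g, 'b) monoid_scheme \<Rightarrow> (nat \<Rightarrow> 'g set) \<Rightarrow> bool" where
  "tempered G F \<longleftrightarrow>
     (\<exists>C>0. \<forall>n. real (card (\<Union>k\<le>n. set_inv\<^bsub>G\<^esub> (F k) <#>\<^bsub>G\<^esub> F (Suc n))) < C * real (card (F (Suc n))))"

section \<open>Group rings and the Pontryagin dual of \<open>\<int>\<Gamma>/\<int>\<Gamma>f\<close>\<close>

text \<open>Elements of both rings are functions on the whole type that vanish outside the carrier of
  the group.\<close>

definition group_delta :: "'g \<Rightarrow> 'g \<Rightarrow> 'r::zero_neq_one" where
  "group_delta s = (\<lambda>t. if t = s then 1 else 0)"

definition integral_group_ring :: "('g, 'b) monoid_scheme \<Rightarrow> ('g \<Rightarrow> int) ring" where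
  "integral_group_ring G =
     \<lparr>carrier = {a. finite {t. a t \<noteq> 0} \<and> (\<forall>t. t \<notin> carrier G \<longrightarrow> a t = 0)},
      monoid.mult = (\<lambda>a b s. if s \<in> carrier G
                then \<Sum>t\<in>{t \<in> carrier G. a t \<noteq> 0}. a t * b (inv\<^bsub>G\<^esub> t \<otimes>\<^bsub>G\<^esub> s) else 0),
      one = group_delta \<one>\<^bsub>G\<^esub>,
      ring.zero = (\<lambda>_. 0),
      ring.add = (\<lambda>a b s. a s + b s)\<rparr>"

definition l1_algebra :: "('g, 'b) monoid_scheme \<Rightarrow> ('g \<Rightarrow> real) ring" where
  "l1_algebra G =
     \<lparr>carrier = {a. (\<lambda>t. \<bar>a t\<bar>) summable_on carrier G \<and> (\<forall>t. t \<notin> carrier G \<longrightarrow> a t = 0)},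
      monoid.mult = (\<lambda>a b s. if s \<in> carrier G
                then \<Sum>\<^sub>\<infinity>t\<in>carrier G. a t * b (inv\<^bsub>G\<^esub> t \<otimes>\<^bsub>G\<^esub> s) else 0),
      one = group_delta \<one>\<^bsub>G\<^esub>,
      ring.zero = (\<lambda>_. 0),
      ring.add = (\<lambda>a b s. a s + b s)\<rparr>"

definition circle_group :: "complex monoid" where
  "circle_group = \<lparr>carrier = sphere 0 1, monoid.mult = (*), one = 1\<rparr>"

text \<open>The dual of a discrete abelian group. Characters are made extensional so that each is
  represented by exactly one function; on a discrete group the compact-open topology is the
  topology of pointwise convergence.\<close>

definition pontryagin_dual :: "('a, 'b) monoid_scheme \<Rightarrow> ('a \<Rightarrow> complex) topology" where
  "pontryagin_dual A =
     subtopology (product_topology (\<lambda>_. top_of_set (sphere 0 1)) (carrier A))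
       (hom A circle_group \<inter> extensional (carrier A))"

text \<open>\<open>PIdl\<close> is right multiplication of the whole ring by \<open>f\<close>, so it is the left ideal
  \<open>\<int>\<Gamma>f\<close> although the group ring need not be commutative.\<close>

definition quotient_module :: "('g, 'b) monoid_scheme \<Rightarrow> ('g \<Rightarrow> int) \<Rightarrow> ('g \<Rightarrow> int) set monoid" where
  "quotient_module G f =
     add_monoid (integral_group_ring G) Mod (PIdl\<^bsub>integral_group_ring G\<^esub> f)"

definition X_top :: "('g, 'b) monoid_scheme \<Rightarrow> ('g \<Rightarrow> int) \<Rightarrow> (('g \<Rightarrow> int) set \<Rightarrow> complex) topology" where
  "X_top G f = pontryagin_dual (quotient_module G f)"

text \<open>The dual of left multiplication, \<open>(s \<xi>)(c) = \<xi>(s\<^sup>-\<^sup>1 c)\<close>; the inverse makes it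
  a left action.\<close>

definition X_act ::
  "('g, 'b) monoid_scheme \<Rightarrow> ('g \<Rightarrow> int) \<Rightarrow> 'g \<Rightarrow> (('g \<Rightarrow> int) set \<Rightarrow> complex) \<Rightarrow> (('g \<Rightarrow> int) set \<Rightarrow> complex)"
  where
  "X_act G f s \<xi> =
     (\<lambda>c\<in>carrier (quotient_module G f).
        \<xi> (group_delta (inv\<^bsub>G\<^esub> s) <#\<^bsub>integral_group_ring G\<^esub> c))"

section \<open>Invariant measures and the weak* topology\<close>

definition borel_of :: "'x topology \<Rightarrow> 'x measure" where
  "borel_of T = sigma (topspace T) {U. openin T U}"

definition borel_prob_measures :: "'x topology \<Rightarrow> 'x measure set" where
  "borel_prob_measures T = {\<mu>. prob_space \<mu> \<and> sets \<mu> = sets (borel_of T)}"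

definition weak_star_topology :: "'x topology \<Rightarrow> 'x measure topology" where
  "weak_star_topology T =
     topology_generated_by
       {{\<nu> \<in> borel_prob_measures T. (\<integral>x. \<phi> x \<partial>\<nu>) \<in> U} |\<phi> U.
          continuous_map T euclideanreal \<phi> \<and> open U}"

definition weak_star_nhds :: "'x topology \<Rightarrow> 'x measure \<Rightarrow> 'x measure set set" where
  "weak_star_nhds T \<mu> =
     {C. C \<subseteq> borel_prob_measures T \<and> (\<exists>U. openin (weak_star_topology T) U \<and> \<mu> \<in> U \<and> U \<subseteq> C)}"

definition ergodic_measures ::
  "('g, 'b) monoid_scheme \<Rightarrow> 'x topology \<Rightarrow> ('g \<Rightarrow> 'x \<Rightarrow> 'x) \<Rightarrow> 'x measure set" where
  "ergodic_measures G T act =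
     {\<mu> \<in> borel_prob_measures T.
        (\<forall>s\<in>carrier G. \<forall>A\<in>sets \<mu>. measure \<mu> (act s -` A \<inter> space \<mu>) = measure \<mu> A) \<and>
        (\<forall>A\<in>sets \<mu>. (\<forall>s\<in>carrier G. act s -` A \<inter> space \<mu> = A) \<longrightarrow> measure \<mu> A = 0 \<or> measure \<mu> A = 1)}"

definition empirical_measure :: "'x topology \<Rightarrow> ('g \<Rightarrow> 'x \<Rightarrow> 'x) \<Rightarrow> 'g set \<Rightarrow> 'x \<Rightarrow> 'x measure" where
  "empirical_measure T act F x =
     measure_of (topspace T) (sets (borel_of T))
       (\<lambda>A. (\<Sum>s\<in>F. emeasure (return (borel_of T) (act s x)) A) / of_nat (card F))"

section \<open>Metric entropy\<close>

text \<open>Here \<open>ln 0 = 0\<close> gives the convention \<open>0 log 0 = 0\<close>.\<close>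

definition partition_entropy :: "'x measure \<Rightarrow> 'x set set \<Rightarrow> real" where
  "partition_entropy \<mu> \<beta> = - (\<Sum>B\<in>\<beta>. measure \<mu> B * ln (measure \<mu> B))"

definition partition_join :: "'x set \<Rightarrow> ('g \<Rightarrow> 'x \<Rightarrow> 'x) \<Rightarrow> 'g set \<Rightarrow> 'x set set \<Rightarrow> 'x set set" where
  "partition_join S act F \<beta> = common_refinement ((\<lambda>s. (\<lambda>B. act s -` B \<inter> S) ` \<beta>) ` F)"

text \<open>For invariant \<open>\<mu>\<close> the limit exists and is the same along every F{\o}lner sequence
  (Ornstein--Weiss).\<close>

definition entropy_wrt ::
  "('g, 'b) monoid_scheme \<Rightarrow> ('g \<Rightarrow> 'x \<Rightarrow> 'x) \<Rightarrow> 'x measure \<Rightarrow> 'x set set \<Rightarrow> real" where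
  "entropy_wrt G act \<mu> \<beta> =
     (THE h. \<forall>F. folner_sequence G F \<longrightarrow>
        (\<lambda>n. partition_entropy \<mu> (partition_join (space \<mu>) act (F n) \<beta>) / real (card (F n))) \<longlonglongrightarrow> h)"

definition metric_entropy ::
  "('g, 'b) monoid_scheme \<Rightarrow> ('g \<Rightarrow> 'x \<Rightarrow> 'x) \<Rightarrow> 'x measure \<Rightarrow> ereal" where
  "metric_entropy G act \<mu> =
     (SUP \<beta>\<in>{\<beta>. finite \<beta> \<and> partition_on (space \<mu>) \<beta> \<and> \<beta> \<subseteq> sets \<mu>}. ereal (entropy_wrt G act \<mu> \<beta>))"

section \<open>Specification and uniform separation\<close>

definition specification_property ::
  "('g, 'b) monoid_scheme \<Rightarrow> 'x set \<Rightarrow> ('x \<Rightarrow> 'x \<Rightarrow> real) \<Rightarrow> ('g \<Rightarrow> 'x \<Rightarrow> 'x) \<Rightarrow> bool" where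
  "specification_property G S \<rho> act \<longleftrightarrow>
     (\<forall>\<epsilon>>0. \<exists>F. finite F \<and> F \<noteq> {} \<and> F \<subseteq> carrier G \<and>
        (\<forall>(m::nat) E x.
           (\<forall>i\<in>{1..m}. finite (E i) \<and> E i \<subseteq> carrier G \<and> x i \<in> S) \<and>
           (\<forall>i\<in>{1..m}. \<forall>j\<in>{1..m}. i \<noteq> j \<longrightarrow> (F <#>\<^bsub>G\<^esub> E i) \<inter> E j = {}) \<longrightarrow>
           (\<exists>y\<in>S. \<forall>i\<in>{1..m}. \<forall>s\<in>E i. \<rho> (act s (x i)) (act s y) \<le> \<epsilon>)))"

definition separated ::
  "('x \<Rightarrow> 'x \<Rightarrow> real) \<Rightarrow> ('g \<Rightarrow> 'x \<Rightarrow> 'x) \<Rightarrow> real \<Rightarrow> 'g set \<Rightarrow> real \<Rightarrow> 'x set \<Rightarrow> bool" where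
  "separated \<rho> act \<delta> F \<epsilon> A \<longleftrightarrow>
     (\<forall>x\<in>A. \<forall>y\<in>A. x \<noteq> y \<longrightarrow>
        real (card {s \<in> F. \<rho> (act s x) (act s y) > \<epsilon>}) \<ge> \<delta> * real (card F))"

text \<open>The supremum over finite separated sets is the maximal cardinality of a separated set,
  and is \<open>\<infinity>\<close> if there is an infinite one.\<close>

definition max_separated ::
  "'x topology \<Rightarrow> ('x \<Rightarrow> 'x \<Rightarrow> real) \<Rightarrow> ('g \<Rightarrow> 'x \<Rightarrow> 'x) \<Rightarrow> 'x measure set \<Rightarrow>
     real \<Rightarrow> 'g set \<Rightarrow> real \<Rightarrow> enat" where
  "max_separated T \<rho> act C \<delta> F \<epsilon> =
     (SUP A\<in>{A. finite A \<and> A \<subseteq> {x \<in> topspace T. empirical_measure T act F x \<in> C} \<and>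
               separated \<rho> act \<delta> F \<epsilon> A}. enat (card A))"

definition exp_ereal :: "ereal \<Rightarrow> ereal" where
  "exp_ereal x = (case x of ereal r \<Rightarrow> ereal (exp r) | PInfty \<Rightarrow> \<infinity> | MInfty \<Rightarrow> 0)"

definition uniform_separation_property ::
  "('g, 'b) monoid_scheme \<Rightarrow> 'x topology \<Rightarrow> ('x \<Rightarrow> 'x \<Rightarrow> real) \<Rightarrow> ('g \<Rightarrow> 'x \<Rightarrow> 'x) \<Rightarrow> bool" where
  "uniform_separation_property G T \<rho> act \<longleftrightarrow>
     (\<forall>K. folner_sequence G K \<and> tempered G K \<longrightarrow>
       (\<forall>\<eta>>0. \<exists>\<epsilon>>0. \<exists>\<delta>>0.
          \<forall>\<mu>\<in>ergodic_measures G T act. \<forall>C\<in>weak_star_nhds T \<mu>. \<exists>n0. \<forall>n\<ge>n0.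
            ereal_of_enat (max_separated T \<rho> act C \<delta> (K n) \<epsilon>) \<ge>
              exp_ereal (ereal (real (card (K n))) * (metric_entropy G act \<mu> - ereal \<eta>))))"

end

theory Submission
  imports Defs
begin

text \<open>The dual \<open>X\<close> of \<open>\<int>\<Gamma>/\<int>\<Gamma>f\<close> consists of the functions \<open>y : \<Gamma> \<rightarrow> \<real>/\<int>\<close> (the angles of a character at the
  classes of group elements) whose convolution with \<open>f\<close> vanishes modulo \<open>\<int>\<close>. Let \<open>g\<close> be the inverse of
  \<open>f\<close> in the \<open>\<ell>\<^sup>1\<close> algebra. Lifting \<open>y\<close> to a real function with values in \<open>[-1/2, 1/2]\<close>, the
  convolution with \<open>f\<close> is a bounded integer function \<open>z\<close>, and \<open>y\<close> is recovered from \<open>z\<close> by convolution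
  with \<open>g\<close> (\<open>conv_mult\<close>). Conversely every bounded integer function \<open>z\<close> gives a point of \<open>X\<close> in this
  way (\<open>char_of_function\<close>). Both halves of the theorem rest on this.

  Specification (\<open>has_specification\<close>): the integer functions of the given points are restricted to
  disjoint finite enlargements of the inverses of the given finite subsets of \<open>\<Gamma>\<close> and added; the
  resulting point of \<open>X\<close> follows all the given points because \<open>g\<close> has small tails.

  Expansiveness (\<open>chars_expansive\<close>): if two points are uniformly close, the integer function of their
  difference has absolute value less than \<open>1\<close>, so it is zero and the points agree. By compactness
  closeness on a finite window of \<open>\<Gamma>\<close> already forces two points to be as near as desired
  (\<open>expansive_finite_window\<close>).

  Uniform separation holds for every expansive action of an infinite countable amenable group on a
  compact metric space (\<open>uniform_separation\<close>). Let \<open>\<mu>\<close> be ergodic, \<open>\<beta>\<close> a finite partition and \<open>F\<close> a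
  F{\o}lner set. The mean ergodic theorem, proved by minimising the \<open>L\<^sup>2\<close> norm over averages of translates (\<open>averages_small\<close>), shows
  that for all but a small set of points the empirical measure along \<open>F\<close> lies in the given
  neighbourhood of \<open>\<mu>\<close> (\<open>empirical_measures_converge\<close>). Among those points choose a separated set \<open>A\<close> of
  maximal size; every one of them is then close to a point of \<open>A\<close> at all but few times. By
  expansiveness, and after shrinking the cells of \<open>\<beta>\<close> to disjoint closed sets, the \<open>\<beta>\<close>-name along
  \<open>F\<close> is determined by the point of \<open>A\<close> together with data at few times, whose number of values grows
  exponentially in \<open>card F\<close> with small rate (\<open>card_names_le\<close>, \<open>card_sparse_maps_le\<close>). On the other hand
  the entropy of the name along \<open>F\<close> is at least \<open>h\<^sub>\<mu>(\<beta>) card F\<close>, because for strongly subadditive right invariant set functions the limit along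
  F{\o}lner sequences is an infimum (\<open>ornstein_weiss_limit\<close>). Comparing the two bounds gives the
  required number of separated points. The scale and the proportion in the separation condition
  depend only on the action and on \<open>\<eta>\<close>, not on \<open>\<mu>\<close> or \<open>\<beta>\<close>.\<close>

(* "<#" stands for left cosets only. *)
no_notation subset_mset (infix \<open><#\<close> 50)

section \<open>Entropy of finite-valued maps\<close>

text \<open>The partition of \<open>S\<close> into the non-empty level sets of \<open>u\<close>.\<close>

definition fibers :: "'x set \<Rightarrow> ('x \<Rightarrow> 'v) \<Rightarrow> 'x set set" where
  "fibers S u = (\<lambda>x. {y \<in> S. u y = u x}) ` S"

text \<open>The entropy of a map is that of its partition into level sets. It depends only on which points
  have equal values (\<open>ent_cong\<close>), so tuples can be regrouped freely.\<close>

definition ent :: "'x measure \<Rightarrow> ('x \<Rightarrow> 'v) \<Rightarrow> real" where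
  "ent \<mu> u = partition_entropy \<mu> (fibers (space \<mu>) u)"

text \<open>The entropy function \<open>- p ln p\<close>, with value \<open>0\<close> at \<open>0\<close>.\<close>

definition nlog :: "real \<Rightarrow> real" where
  "nlog p = - (p * ln p)"

lemma ent_cong:
  assumes "\<And>x y. x \<in> space \<mu> \<Longrightarrow> y \<in> space \<mu> \<Longrightarrow> u x = u y \<longleftrightarrow> u' x = u' y"
  shows "ent \<mu> u = ent \<mu> u'"
proof -
  have "fibers (space \<mu>) u = fibers (space \<mu>) u'"
    unfolding fibers_def by (intro image_cong refl Collect_cong) (auto simp: assms)
  thus ?thesis by (simp add: ent_def)
qed

lemma ent_eq_sum:
  assumes V: "finite V" "u ` space \<mu> \<subseteq> V"
  shows "ent \<mu> u = (\<Sum>v\<in>V. nlog (measure \<mu> {x \<in> space \<mu>. u x = v}))"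
proof -
  let ?g = "\<lambda>v. {x \<in> space \<mu>. u x = v}"
  have fib: "fibers (space \<mu>) u = ?g ` (u ` space \<mu>)"
    unfolding fibers_def by (auto simp: image_image)
  have inj: "inj_on ?g (u ` space \<mu>)" by (rule inj_onI) blast
  have "(\<Sum>v\<in>V. nlog (measure \<mu> (?g v))) = (\<Sum>v\<in>u ` space \<mu>. nlog (measure \<mu> (?g v)))"
  proof (rule sum.mono_neutral_right[OF V], safe)
    fix v assume "v \<notin> u ` space \<mu>"
    hence e: "?g v = {}" by blast
    show "nlog (measure \<mu> (?g v)) = 0" unfolding e by (simp add: nlog_def)
  qed
  also have "\<dots> = (\<Sum>B\<in>fibers (space \<mu>) u. nlog (measure \<mu> B))"
    unfolding fib by (simp add: sum.reindex[OF inj])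
  finally show ?thesis
    by (simp add: ent_def partition_entropy_def nlog_def sum_negf)
qed

lemma nlog_submodular_term:
  fixes p pt py pz :: real
  assumes "0 \<le> p" "p \<le> pt" "p \<le> py" "pt \<le> pz" "py \<le> pz"
  shows "p - pt * py / pz \<le> p * ln p + p * ln pz - p * ln pt - p * ln py"
proof (cases "p = 0")
  case True
  thus ?thesis using assms by auto
next
  case False
  hence pos: "0 < p" "0 < pt" "0 < py" "0 < pz" using assms by auto
  have "ln (pt * py / (p * pz)) \<le> pt * py / (p * pz) - 1"
    using pos by (intro ln_le_minus_one) auto
  hence "p * ln (pt * py / (p * pz)) \<le> p * (pt * py / (p * pz) - 1)"
    using pos by (intro mult_left_mono) auto
  also have "\<dots> = pt * py / pz - p" using pos by (simp add: field_simps)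
  finally show ?thesis using pos by (simp add: ln_div ln_mult algebra_simps)
qed

text \<open>Non-negativity of conditional mutual information: for weights \<open>p\<close> on a triple product, the
  difference of the two sides is the sum of \<open>p ln (p p\<^sub>c / (p\<^sub>a\<^sub>c p\<^sub>b\<^sub>c))\<close>, which is bounded below termwise by
  \<open>ln x \<le> x - 1\<close>; the bounds add up to \<open>0\<close>.\<close>

lemma nlog_submodular:
  fixes p :: "'a \<Rightarrow> 'b \<Rightarrow> 'c \<Rightarrow> real"
  assumes fin: "finite A" "finite B" "finite C"
    and nn: "\<And>a b c. 0 \<le> p a b c"
  shows "(\<Sum>a\<in>A. \<Sum>b\<in>B. \<Sum>c\<in>C. nlog (p a b c)) + (\<Sum>c\<in>C. nlog (\<Sum>a\<in>A. \<Sum>b\<in>B. p a b c))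
    \<le> (\<Sum>a\<in>A. \<Sum>c\<in>C. nlog (\<Sum>b\<in>B. p a b c)) + (\<Sum>b\<in>B. \<Sum>c\<in>C. nlog (\<Sum>a\<in>A. p a b c))"
proof -
  define pt where "pt = (\<lambda>a c. \<Sum>b\<in>B. p a b c)"
  define py where "py = (\<lambda>b c. \<Sum>a\<in>A. p a b c)"
  define pz where "pz = (\<lambda>c. \<Sum>a\<in>A. \<Sum>b\<in>B. p a b c)"
  have pz2: "pz c = (\<Sum>b\<in>B. py b c)" for c unfolding pz_def py_def by (rule sum.swap)
  have pz1: "pz c = (\<Sum>a\<in>A. pt a c)" for c unfolding pz_def pt_def ..
  have ptd: "(\<Sum>b\<in>B. p a b c) = pt a c" for a c by (simp add: pt_def)
  have pyd: "(\<Sum>a\<in>A. p a b c) = py b c" for b c by (simp add: py_def)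
  have ptnn: "0 \<le> pt a c" for a c unfolding pt_def by (intro sum_nonneg nn)
  have pynn: "0 \<le> py b c" for b c unfolding py_def by (intro sum_nonneg nn)
  have "(\<Sum>a\<in>A. \<Sum>b\<in>B. \<Sum>c\<in>C. p a b c - pt a c * py b c / pz c)
      \<le> (\<Sum>a\<in>A. \<Sum>b\<in>B. \<Sum>c\<in>C. p a b c * ln (p a b c) + p a b c * ln (pz c)
           - p a b c * ln (pt a c) - p a b c * ln (py b c))"
  proof (intro sum_mono nlog_submodular_term)
    fix a b c assume "a \<in> A" "b \<in> B" "c \<in> C"
    show "p a b c \<le> pt a c" unfolding pt_def
      by (rule member_le_sum[of b B "\<lambda>b. p a b c"]) (use fin nn \<open>b \<in> B\<close> in auto)
    show "p a b c \<le> py b c" unfolding py_def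
      by (rule member_le_sum[of a A "\<lambda>a. p a b c"]) (use fin nn \<open>a \<in> A\<close> in auto)
    show "pt a c \<le> pz c" unfolding pz1
      by (rule member_le_sum[of a A "\<lambda>a. pt a c"]) (use fin ptnn \<open>a \<in> A\<close> in auto)
    show "py b c \<le> pz c" unfolding pz2
      by (rule member_le_sum[of b B "\<lambda>b. py b c"]) (use fin pynn \<open>b \<in> B\<close> in auto)
  qed (rule nn)
  moreover have "(\<Sum>a\<in>A. \<Sum>b\<in>B. \<Sum>c\<in>C. p a b c - pt a c * py b c / pz c) = 0"
  proof -
    have "(\<Sum>a\<in>A. \<Sum>b\<in>B. pt a c * py b c / pz c) = pz c" for c
    proof -
      have "(\<Sum>a\<in>A. \<Sum>b\<in>B. pt a c * py b c / pz c) = pz c * pz c / pz c"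
        by (subst pz1, subst pz2) (simp add: sum_product sum_divide_distrib)
      thus ?thesis by simp
    qed
    moreover have "(\<Sum>a\<in>A. \<Sum>b\<in>B. \<Sum>c\<in>C. q a b c) = (\<Sum>c\<in>C. \<Sum>a\<in>A. \<Sum>b\<in>B. q a b c)"
      for q :: "'a \<Rightarrow> 'b \<Rightarrow> 'c \<Rightarrow> real"
      by (subst (2) sum.swap, subst sum.swap) (rule refl)
    ultimately show ?thesis
      by (simp add: sum_subtractf) (simp add: pz_def)
  qed
  moreover have "(\<Sum>a\<in>A. \<Sum>b\<in>B. \<Sum>c\<in>C. p a b c * ln (pz c)) = (\<Sum>c\<in>C. pz c * ln (pz c))"
    unfolding pz_def sum_distrib_right
    by (subst (2) sum.swap, subst sum.swap) (rule refl)
  moreover have "(\<Sum>a\<in>A. \<Sum>b\<in>B. \<Sum>c\<in>C. p a b c * ln (pt a c)) = (\<Sum>a\<in>A. \<Sum>c\<in>C. pt a c * ln (pt a c))"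
    unfolding pt_def sum_distrib_right by (subst (2) sum.swap) (rule refl)
  moreover have "(\<Sum>a\<in>A. \<Sum>b\<in>B. \<Sum>c\<in>C. p a b c * ln (py b c)) = (\<Sum>b\<in>B. \<Sum>c\<in>C. py b c * ln (py b c))"
    unfolding py_def sum_distrib_right
    by (subst sum.swap, subst (2) sum.swap) (rule refl)
  ultimately show ?thesis
    unfolding nlog_def ptd pyd pz1[symmetric]
    by (simp add: sum_subtractf sum.distrib sum_negf)
qed

lemma (in finite_measure) measure_sum_fibers:
  assumes "finite V" "Y ` space M \<subseteq> V" "A \<subseteq> space M"
    and "\<And>v. {x \<in> A. Y x = v} \<in> sets M"
  shows "(\<Sum>v\<in>V. measure M {x \<in> A. Y x = v}) = measure M A"
proof -
  have "A = (\<Union>v\<in>V. {x \<in> A. Y x = v})" using assms by auto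
  also have "measure M \<dots> = (\<Sum>v\<in>V. measure M {x \<in> A. Y x = v})"
    by (rule finite_measure_finite_Union) (use assms in \<open>auto simp: disjoint_family_on_def\<close>)
  finally show ?thesis by simp
qed

lemma (in finite_measure) ent_submodular:
  assumes fin: "finite (T ` space M)" "finite (Y ` space M)" "finite (Z ` space M)"
    and T: "\<And>v. {x \<in> space M. T x = v} \<in> sets M"
    and Y: "\<And>v. {x \<in> space M. Y x = v} \<in> sets M"
    and Z: "\<And>v. {x \<in> space M. Z x = v} \<in> sets M"
  shows "ent M (\<lambda>x. (T x, Y x, Z x)) + ent M Z \<le> ent M (\<lambda>x. (T x, Z x)) + ent M (\<lambda>x. (Y x, Z x))"
proof -
  let ?A = "T ` space M" and ?B = "Y ` space M" and ?C = "Z ` space M"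
  define p where "p = (\<lambda>a b c. measure M {x \<in> space M. T x = a \<and> Y x = b \<and> Z x = c})"
  have meas: "{x \<in> space M. T x = a \<and> Y x = b \<and> Z x = c} \<in> sets M"
     "{x \<in> space M. T x = a \<and> Z x = c} \<in> sets M"
     "{x \<in> space M. Y x = b \<and> Z x = c} \<in> sets M" for a b c
    using sets.Int[OF T[of a] Z[of c]] sets.Int[OF Y[of b] Z[of c]]
      sets.Int[OF T[of a] sets.Int[OF Y[of b] Z[of c]]]
    by (simp_all add: Int_def conj_ac cong: conj_cong)
  have 1: "(\<Sum>b\<in>?B. p a b c) = measure M {x \<in> space M. T x = a \<and> Z x = c}" for a c
    unfolding p_def
    by (subst measure_sum_fibers[OF fin(2) subset_refl, of "{x \<in> space M. T x = a \<and> Z x = c}", symmetric])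
       (use meas in \<open>auto intro!: sum.cong arg_cong[where f="measure M"] simp: conj_ac\<close>)
  have 2: "(\<Sum>a\<in>?A. p a b c) = measure M {x \<in> space M. Y x = b \<and> Z x = c}" for b c
    unfolding p_def
    by (subst measure_sum_fibers[OF fin(1) subset_refl, of "{x \<in> space M. Y x = b \<and> Z x = c}", symmetric])
       (use meas in \<open>auto intro!: sum.cong arg_cong[where f="measure M"] simp: conj_ac\<close>)
  have 3: "(\<Sum>a\<in>?A. \<Sum>b\<in>?B. p a b c) = measure M {x \<in> space M. Z x = c}" for c
    unfolding 1
    by (subst measure_sum_fibers[OF fin(1) subset_refl, of "{x \<in> space M. Z x = c}", symmetric])
       (use meas in \<open>auto intro!: sum.cong arg_cong[where f="measure M"] simp: conj_ac\<close>)
  have "ent M (\<lambda>x. (T x, Y x, Z x)) = (\<Sum>(a,b,c)\<in>?A\<times>?B\<times>?C. nlog (p a b c))"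
    unfolding p_def by (subst ent_eq_sum[of "?A\<times>?B\<times>?C"]) (use fin in \<open>auto intro!: sum.cong\<close>)
  also have "\<dots> = (\<Sum>a\<in>?A. \<Sum>b\<in>?B. \<Sum>c\<in>?C. nlog (p a b c))"
    by (simp add: sum.cartesian_product)
  finally have e1: "ent M (\<lambda>x. (T x, Y x, Z x)) = \<dots>" .
  have "ent M (\<lambda>x. (T x, Z x)) = (\<Sum>(a,c)\<in>?A\<times>?C. nlog (\<Sum>b\<in>?B. p a b c))"
    unfolding 1 by (subst ent_eq_sum[of "?A\<times>?C"]) (use fin in \<open>auto intro!: sum.cong\<close>)
  hence e2: "ent M (\<lambda>x. (T x, Z x)) = (\<Sum>a\<in>?A. \<Sum>c\<in>?C. nlog (\<Sum>b\<in>?B. p a b c))"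
    by (simp add: sum.cartesian_product)
  have "ent M (\<lambda>x. (Y x, Z x)) = (\<Sum>(b,c)\<in>?B\<times>?C. nlog (\<Sum>a\<in>?A. p a b c))"
    unfolding 2 by (subst ent_eq_sum[of "?B\<times>?C"]) (use fin in \<open>auto intro!: sum.cong\<close>)
  hence e3: "ent M (\<lambda>x. (Y x, Z x)) = (\<Sum>b\<in>?B. \<Sum>c\<in>?C. nlog (\<Sum>a\<in>?A. p a b c))"
    by (simp add: sum.cartesian_product)
  have e4: "ent M Z = (\<Sum>c\<in>?C. nlog (\<Sum>a\<in>?A. \<Sum>b\<in>?B. p a b c))"
    unfolding 3 by (subst ent_eq_sum[of ?C]) (use fin in auto)
  show ?thesis unfolding e1 e2 e3 e4
    by (rule nlog_submodular[OF fin]) (simp add: p_def)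
qed

text \<open>The weights need not add up to \<open>1\<close>; the summand \<open>1\<close> absorbs the defect.\<close>

lemma sum_nlog_le:
  fixes p :: "'a \<Rightarrow> real"
  assumes "finite I" "\<And>i. i \<in> I \<Longrightarrow> 0 \<le> p i"
  shows "(\<Sum>i\<in>I. nlog (p i)) \<le> (\<Sum>i\<in>I. p i) * ln (real (card I)) + 1"
proof (cases "I = {}")
  case False
  let ?k = "real (card I)"
  have k: "0 < ?k" using False assms(1) by (simp add: card_gt_0_iff)
  have "nlog (p i) \<le> p i * ln ?k + 1 / ?k - p i" if "i \<in> I" for i
  proof (cases "p i = 0")
    case False
    hence p: "0 < p i" using assms(2)[OF that] by simp
    have "ln (1 / (p i * ?k)) \<le> 1 / (p i * ?k) - 1"
      using p k by (intro ln_le_minus_one) auto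
    hence "p i * ln (1 / (p i * ?k)) \<le> p i * (1 / (p i * ?k) - 1)"
      using p by (intro mult_left_mono) auto
    also have "\<dots> = 1 / ?k - p i" using p k by (simp add: field_simps)
    finally show ?thesis using p k by (simp add: nlog_def ln_div ln_mult algebra_simps)
  qed (simp add: nlog_def)
  hence "(\<Sum>i\<in>I. nlog (p i)) \<le> (\<Sum>i\<in>I. p i * ln ?k + 1 / ?k - p i)" by (rule sum_mono)
  also have "\<dots> = (\<Sum>i\<in>I. p i) * ln ?k + 1 - (\<Sum>i\<in>I. p i)"
    using k by (simp add: sum.distrib sum_subtractf sum_distrib_right)
  also have "\<dots> \<le> (\<Sum>i\<in>I. p i) * ln ?k + 1" using assms by (simp add: sum_nonneg)
  finally show ?thesis .
qed simp

section \<open>Strongly subadditive set functions along F{\o}lner sequences\<close>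

text \<open>Shearer's inequality. When the set is enlarged from \<open>F\<close> to \<open>insert t F\<close>, submodularity makes the
  increment of \<open>h\<close> on each \<open>A g\<close> that contains \<open>t\<close> at least as large as on the whole set.\<close>

lemma shearer_inequality:
  fixes h :: "'g set \<Rightarrow> real"
  assumes fin: "finite F" "F \<subseteq> U"
    and empty: "h {} = 0"
    and submod: "\<And>A F t. finite F \<Longrightarrow> A \<subseteq> F \<Longrightarrow> t \<in> U - F \<Longrightarrow> insert t F \<subseteq> U \<Longrightarrow>
        h (insert t F) + h A \<le> h (insert t A) + h F"
    and T: "finite T" "\<And>t. t \<in> F \<Longrightarrow> card {g \<in> T. t \<in> A g} = k"
  shows "real k * h F \<le> (\<Sum>g\<in>T. h (A g \<inter> F))"
  using fin T(2)
proof (induction F rule: finite_induct)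
  case empty
  thus ?case using \<open>h {} = 0\<close> by simp
next
  case (insert t F)
  let ?d = "h (insert t F) - h F"
  have "(\<Sum>g\<in>T. h (A g \<inter> F)) + (\<Sum>g\<in>{g \<in> T. t \<in> A g}. ?d) = (\<Sum>g\<in>T. h (A g \<inter> F) + (if t \<in> A g then ?d else 0))"
    unfolding sum.inter_filter[OF T(1)] sum.distrib ..
  also have "\<dots> \<le> (\<Sum>g\<in>T. h (A g \<inter> insert t F))"
  proof (intro sum_mono)
    fix g assume "g \<in> T"
    have "h (insert t F) + h (A g \<inter> F) \<le> h (insert t (A g \<inter> F)) + h F"
      using insert by (intro submod) auto
    thus "h (A g \<inter> F) + (if t \<in> A g then ?d else 0) \<le> h (A g \<inter> insert t F)"
      by (auto simp: Int_insert_right)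
  qed
  finally have "(\<Sum>g\<in>T. h (A g \<inter> F)) + real k * ?d \<le> (\<Sum>g\<in>T. h (A g \<inter> insert t F))"
    using insert.prems(2)[of t] by simp
  moreover have "real k * h F \<le> (\<Sum>g\<in>T. h (A g \<inter> F))" using insert by auto
  ultimately show ?case by (simp add: algebra_simps)
qed

context group
begin

lemma card_l_coset_diff:
  assumes "finite F" "F \<subseteq> carrier G" "w \<in> carrier G"
  shows "card {s \<in> F. w \<otimes> s \<notin> F} \<le> card (sym_diff (w <# F) F)"
    and "card ((w <# F) - F) \<le> card (sym_diff (w <# F) F)" and "finite (w <# F)"
proof -
  have eq: "w <# F = (\<lambda>s. w \<otimes> s) ` F" by (auto simp: l_coset_def)
  show f: "finite (w <# F)" using assms eq by simp
  show "card ((w <# F) - F) \<le> card (sym_diff (w <# F) F)"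
    by (rule card_mono) (use f assms in auto)
  have "card {s \<in> F. w \<otimes> s \<notin> F} \<le> card ((w <# F) - F)"
    by (rule card_inj_on_le[of "\<lambda>s. w \<otimes> s"])
      (use f assms in \<open>auto simp: eq subset_iff intro!: inj_onI\<close>)
  also note \<open>card ((w <# F) - F) \<le> _\<close>
  finally show "card {s \<in> F. w \<otimes> s \<notin> F} \<le> card (sym_diff (w <# F) F)" .
qed

lemma folner_sum_tendsto:
  assumes "folner_sequence G F" "W \<subseteq> carrier G"
  shows "(\<lambda>n. \<Sum>w\<in>W. real (card (sym_diff (w <# F n) (F n))) / real (card (F n))) \<longlonglongrightarrow> 0"
  by (rule tendsto_null_sum) (use assms in \<open>auto simp: folner_sequence_def\<close>)

text \<open>Almost all of a F{\o}lner set belongs to its \<open>W\<close>-interior.\<close>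

lemma folner_interior:
  assumes F: "folner_sequence G F" and W: "finite W" "W \<subseteq> carrier G"
  shows "(\<lambda>n. real (card {s \<in> F n. \<exists>w\<in>W. w \<otimes> s \<notin> F n}) / real (card (F n))) \<longlonglongrightarrow> 0"
proof (rule tendsto_sandwich[OF always_eventually always_eventually tendsto_const folner_sum_tendsto[OF F W(2)]])
  show "\<forall>n. 0 \<le> real (card {s \<in> F n. \<exists>w\<in>W. w \<otimes> s \<notin> F n}) / real (card (F n))" by simp
  show "\<forall>n. real (card {s \<in> F n. \<exists>w\<in>W. w \<otimes> s \<notin> F n}) / real (card (F n))
    \<le> (\<Sum>w\<in>W. real (card (sym_diff (w <# F n) (F n))) / real (card (F n)))"
  proof
    fix n
    have Fn: "finite (F n)" "F n \<subseteq> carrier G" using F by (auto simp: folner_sequence_def)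
    have "{s \<in> F n. \<exists>w\<in>W. w \<otimes> s \<notin> F n} = (\<Union>w\<in>W. {s \<in> F n. w \<otimes> s \<notin> F n})" by auto
    hence "card {s \<in> F n. \<exists>w\<in>W. w \<otimes> s \<notin> F n} \<le> (\<Sum>w\<in>W. card {s \<in> F n. w \<otimes> s \<notin> F n})"
      using card_UN_le[OF W(1)] by simp
    also have "\<dots> \<le> (\<Sum>w\<in>W. card (sym_diff (w <# F n) (F n)))"
      by (intro sum_mono card_l_coset_diff Fn) (use W in auto)
    finally have "real (card {s \<in> F n. \<exists>w\<in>W. w \<otimes> s \<notin> F n}) \<le> (\<Sum>w\<in>W. real (card (sym_diff (w <# F n) (F n))))"
      by (simp only: of_nat_sum[symmetric] of_nat_le_iff)
    thus "real (card {s \<in> F n. \<exists>w\<in>W. w \<otimes> s \<notin> F n}) / real (card (F n))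
      \<le> (\<Sum>w\<in>W. real (card (sym_diff (w <# F n) (F n))) / real (card (F n)))"
      unfolding sum_divide_distrib[symmetric] by (rule divide_right_mono) simp
  qed
qed

text \<open>In an infinite group a F{\o}lner set with non-empty \<open>W\<close>-interior has at least \<open>card W\<close>
  elements.\<close>

lemma folner_card_at_top:
  assumes F: "folner_sequence G F" and inf: "infinite (carrier G)"
  shows "filterlim (\<lambda>n. real (card (F n))) at_top sequentially"
proof (rule filterlim_at_top[THEN iffD2], rule allI)
  fix Z :: real
  obtain W where W: "W \<subseteq> carrier G" "finite W" "card W = nat \<lceil>Z\<rceil>"
    using infinite_arbitrarily_large[OF inf] by metis
  have "eventually (\<lambda>n. real (card {s \<in> F n. \<exists>w\<in>W. w \<otimes> s \<notin> F n}) / real (card (F n)) < 1) sequentially"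
    by (rule order_tendstoD(2)[OF folner_interior[OF F W(2,1)]]) simp
  thus "eventually (\<lambda>n. Z \<le> real (card (F n))) sequentially"
  proof eventually_elim
    case (elim n)
    have Fn: "finite (F n)" "F n \<noteq> {}" "F n \<subseteq> carrier G" using F by (auto simp: folner_sequence_def)
    have "card {s \<in> F n. \<exists>w\<in>W. w \<otimes> s \<notin> F n} < card (F n)" using elim Fn
      by (simp add: divide_less_eq card_gt_0_iff)
    hence "{s \<in> F n. \<exists>w\<in>W. w \<otimes> s \<notin> F n} \<noteq> F n" by auto
    then obtain s where s: "s \<in> F n" "\<forall>w\<in>W. w \<otimes> s \<in> F n" by blast
    have "card W \<le> card (F n)"
      by (rule card_inj_on_le[of "\<lambda>w. w \<otimes> s"]) (use s Fn W in \<open>auto simp: subset_iff intro!: inj_onI\<close>)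
    thus ?case using W(3) by linarith
  qed
qed

text \<open>The Ornstein--Weiss limit. Every element of \<open>F\<close> lies in \<open>K g\<close> for exactly \<open>card K\<close> elements \<open>g\<close> of
  the group, so Shearer's inequality bounds \<open>h F\<close> by \<open>h K / card K\<close> times the number of \<open>g\<close> for which \<open>K g\<close>
  meets \<open>F\<close>.\<close>

lemma ornstein_weiss_limit:
  fixes h :: "'a set \<Rightarrow> real"
  assumes empty: "h {} = 0"
    and submod: "\<And>A F t. finite F \<Longrightarrow> A \<subseteq> F \<Longrightarrow> t \<in> carrier G - F \<Longrightarrow> insert t F \<subseteq> carrier G \<Longrightarrow>
        h (insert t F) + h A \<le> h (insert t A) + h F"
    and mono: "\<And>A F. finite F \<Longrightarrow> A \<subseteq> F \<Longrightarrow> F \<subseteq> carrier G \<Longrightarrow> h A \<le> h F"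
    and inv: "\<And>F g. finite F \<Longrightarrow> F \<subseteq> carrier G \<Longrightarrow> g \<in> carrier G \<Longrightarrow> h ((\<lambda>s. s \<otimes> g) ` F) = h F"
  defines "L \<equiv> Inf {h K / real (card K) |K. finite K \<and> K \<noteq> {} \<and> K \<subseteq> carrier G}"
  shows "folner_sequence G F \<Longrightarrow> (\<lambda>n. h (F n) / real (card (F n))) \<longlonglongrightarrow> L"
    and "finite K \<Longrightarrow> K \<noteq> {} \<Longrightarrow> K \<subseteq> carrier G \<Longrightarrow> L \<le> h K / real (card K)"
proof -
  let ?S = "{h K / real (card K) |K. finite K \<and> K \<noteq> {} \<and> K \<subseteq> carrier G}"
  have nn: "0 \<le> h F" if "finite F" "F \<subseteq> carrier G" for F
    using mono[of F "{}"] that empty by simp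
  have bdd: "bdd_below ?S" by (rule bdd_belowI[of _ 0]) (use nn in auto)
  have ne: "?S \<noteq> {}" by (auto intro!: exI[of _ "{\<one>}"])
  show low: "L \<le> h K / real (card K)" if "finite K" "K \<noteq> {}" "K \<subseteq> carrier G" for K
    unfolding L_def by (rule cInf_lower[OF _ bdd]) (use that in blast)
  show "(\<lambda>n. h (F n) / real (card (F n))) \<longlonglongrightarrow> L" if F: "folner_sequence G F"
  proof (rule LIMSEQ_I)
    fix r :: real assume r: "0 < r"
    have "Inf ?S < L + r / 2" using r by (simp add: L_def)
    then obtain K where K: "finite K" "K \<noteq> {}" "K \<subseteq> carrier G" and Kr: "h K / real (card K) < L + r / 2"
      using cInf_lessD[OF ne] by blast
    define q where "q = h K / real (card K)"
    have q0: "0 \<le> q" unfolding q_def using nn K by simp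
    define W where "W = (\<lambda>k. inv k) ` K"
    have W: "finite W" "W \<subseteq> carrier G" using K by (auto simp: W_def)
    define E where "E = (\<lambda>n. \<Sum>w\<in>W. real (card (sym_diff (w <# F n) (F n))) / real (card (F n)))"
    have up: "h (F n) / real (card (F n)) \<le> q * (1 + E n)" for n
    proof -
      have Fn: "finite (F n)" "F n \<noteq> {}" "F n \<subseteq> carrier G" using F by (auto simp: folner_sequence_def)
      define T where "T = (\<Union>w\<in>W. w <# F n)"
      have Tfin: "finite T" unfolding T_def using W Fn card_l_coset_diff(3) by blast
      have Tsub: "T \<subseteq> carrier G" unfolding T_def using W Fn by (auto simp: l_coset_def)
      have Tcard: "real (card T) \<le> real (card (F n)) * (1 + E n)"
      proof -
        have "T \<subseteq> F n \<union> (\<Union>w\<in>W. (w <# F n) - F n)" unfolding T_def by auto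
        hence "card T \<le> card (F n \<union> (\<Union>w\<in>W. (w <# F n) - F n))"
          by (rule card_mono[rotated]) (use Fn W card_l_coset_diff(3) in blast)
        also have "\<dots> \<le> card (F n) + card (\<Union>w\<in>W. (w <# F n) - F n)" by (rule card_Un_le)
        also have "card (\<Union>w\<in>W. (w <# F n) - F n) \<le> (\<Sum>w\<in>W. card ((w <# F n) - F n))"
          by (rule card_UN_le[OF W(1)])
        also have "\<dots> \<le> (\<Sum>w\<in>W. card (sym_diff (w <# F n) (F n)))"
          by (intro sum_mono card_l_coset_diff Fn) (use W in auto)
        finally have "real (card T) \<le> real (card (F n)) + (\<Sum>w\<in>W. real (card (sym_diff (w <# F n) (F n))))"
          by (simp only: of_nat_sum[symmetric] of_nat_add[symmetric] of_nat_le_iff)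
        also have "\<dots> = real (card (F n)) * (1 + E n)"
          using Fn by (simp add: E_def sum_divide_distrib[symmetric] distrib_left)
        finally show ?thesis .
      qed
      \<comment> \<open>\<open>T\<close> is the set of all \<open>g\<close> for which \<open>K g\<close> meets \<open>F n\<close>.\<close>
      have "real (card K) * h (F n) \<le> (\<Sum>g\<in>T. h ((\<lambda>k. k \<otimes> g) ` K \<inter> F n))"
      proof (rule shearer_inequality[OF Fn(1) Fn(3) empty submod Tfin])
        fix t assume t: "t \<in> F n"
        hence tG: "t \<in> carrier G" using Fn by auto
        have "{g \<in> T. t \<in> (\<lambda>k. k \<otimes> g) ` K} = (\<lambda>k. inv k \<otimes> t) ` K"
        proof (intro equalityI subsetI)
          fix g assume "g \<in> {g \<in> T. t \<in> (\<lambda>k. k \<otimes> g) ` K}"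
          then obtain k where k: "k \<in> K" "t = k \<otimes> g" and g: "g \<in> T" by blast
          have "k \<in> carrier G" "g \<in> carrier G" using k g K(3) Tsub by auto
          hence "g = inv k \<otimes> t" unfolding k(2) by (subst m_assoc[symmetric]) auto
          thus "g \<in> (\<lambda>k. inv k \<otimes> t) ` K" using k(1) by blast
        next
          fix g assume "g \<in> (\<lambda>k. inv k \<otimes> t) ` K"
          then obtain k where k: "k \<in> K" "g = inv k \<otimes> t" by blast
          have "g \<in> T" unfolding T_def W_def l_coset_def using k t by auto
          have "k \<in> carrier G" using k K(3) by auto
          hence "t = k \<otimes> g" unfolding k(2) using tG by (subst m_assoc[symmetric]) auto
          thus "g \<in> {g \<in> T. t \<in> (\<lambda>k. k \<otimes> g) ` K}" using k(1) \<open>g \<in> T\<close> by blast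
        qed
        moreover have "inj_on (\<lambda>k. inv k \<otimes> t) K"
          by (rule inj_onI) (use K tG in \<open>auto simp: subset_iff\<close>)
        ultimately show "card {g \<in> T. t \<in> (\<lambda>k. k \<otimes> g) ` K} = card K"
          by (simp add: card_image)
      qed
      also have "\<dots> \<le> (\<Sum>g\<in>T. h K)"
      proof (rule sum_mono)
        fix g assume "g \<in> T"
        hence g: "g \<in> carrier G" using Tsub by auto
        have "h ((\<lambda>k. k \<otimes> g) ` K \<inter> F n) \<le> h ((\<lambda>k. k \<otimes> g) ` K)"
          by (rule mono) (use K g in auto)
        also have "\<dots> = h K" by (rule inv[OF K(1,3) g])
        finally show "h ((\<lambda>k. k \<otimes> g) ` K \<inter> F n) \<le> h K" .
      qed
      also have "\<dots> = real (card T) * h K" by simp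
      also have "\<dots> \<le> real (card (F n)) * (1 + E n) * h K"
        by (rule mult_right_mono[OF Tcard nn]) (use K in auto)
      finally show ?thesis using K Fn unfolding q_def
        by (simp add: field_simps card_gt_0_iff)
    qed
    have "(\<lambda>n. q * (1 + E n)) \<longlonglongrightarrow> q * (1 + 0)"
      unfolding E_def by (intro tendsto_intros folner_sum_tendsto F W)
    moreover have "q * (1 + 0) < L + r" using Kr r by (simp add: q_def)
    ultimately have "eventually (\<lambda>n. q * (1 + E n) < L + r) sequentially" by (rule order_tendstoD)
    then obtain N where N: "\<And>n. n \<ge> N \<Longrightarrow> q * (1 + E n) < L + r"
      by (auto simp: eventually_sequentially)
    show "\<exists>no. \<forall>n\<ge>no. norm (h (F n) / real (card (F n)) - L) < r"
    proof (intro exI allI impI)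
      fix n assume "n \<ge> N"
      have "L \<le> h (F n) / real (card (F n))" by (rule low) (use F in \<open>auto simp: folner_sequence_def\<close>)
      thus "norm (h (F n) / real (card (F n)) - L) < r" using up[of n] N[OF \<open>n \<ge> N\<close>] by simp
    qed
  qed
qed

end

section \<open>The mean ergodic theorem\<close>

text \<open>A measure preserving action of a countable group on a probability space.\<close>

locale pmp_action = group G + prob_space M
  for G :: "('g, 'b) monoid_scheme" (structure) and M :: "'x measure" +
  fixes act :: "'g \<Rightarrow> 'x \<Rightarrow> 'x"
  assumes countable_group: "countable (carrier G)"
    and act_measurable: "s \<in> carrier G \<Longrightarrow> act s \<in> measurable M M"
    and act_one: "x \<in> space M \<Longrightarrow> act \<one> x = x"
    and act_mult: "x \<in> space M \<Longrightarrow> s \<in> carrier G \<Longrightarrow> t \<in> carrier G \<Longrightarrow> act (s \<otimes> t) x = act s (act t x)"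
    and act_invariant: "s \<in> carrier G \<Longrightarrow> A \<in> sets M \<Longrightarrow> measure M (act s -` A \<inter> space M) = measure M A"
begin

lemma act_space: "s \<in> carrier G \<Longrightarrow> x \<in> space M \<Longrightarrow> act s x \<in> space M"
  using act_measurable by (rule measurable_space)

lemma act_inv_cancel:
  assumes "s \<in> carrier G" "x \<in> space M"
  shows "act s (act (inv s) x) = x" and "act (inv s) (act s x) = x"
  using assms by (simp_all add: act_mult[symmetric] act_one)

lemma distr_act: "s \<in> carrier G \<Longrightarrow> distr M M (act s) = M"
  by (rule measure_eqI) (simp_all add: emeasure_distr act_measurable act_invariant emeasure_eq_measure)

lemma measurable_comp_act:
  "s \<in> carrier G \<Longrightarrow> u \<in> measurable M N \<Longrightarrow> (\<lambda>x. u (act s x)) \<in> measurable M N"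
  by (rule measurable_compose[OF act_measurable])

lemma integral_act:
  fixes u :: "'x \<Rightarrow> real"
  assumes "s \<in> carrier G" "u \<in> borel_measurable M"
  shows "(\<integral>x. u (act s x) \<partial>M) = (\<integral>x. u x \<partial>M)"
  using integral_distr[OF act_measurable[OF assms(1)] assms(2)] distr_act[OF assms(1)] by simp

text \<open>The average of \<open>u\<close> over the part \<open>F\<close> of the orbit.\<close>

definition avg :: "'g set \<Rightarrow> ('x \<Rightarrow> real) \<Rightarrow> 'x \<Rightarrow> real" where
  "avg F u x = (\<Sum>s\<in>F. u (act s x)) / real (card F)"

text \<open>The dyadic convex combinations of translates of \<open>\<phi>\<close>: enough of the convex hull to run the
  minimal-norm argument.\<close>

inductive averages :: "('x \<Rightarrow> real) \<Rightarrow> ('x \<Rightarrow> real) \<Rightarrow> bool" for \<phi> where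
  base: "averages \<phi> \<phi>"
| translate: "averages \<phi> u \<Longrightarrow> s \<in> carrier G \<Longrightarrow> averages \<phi> (\<lambda>x. u (act s x))"
| midpoint: "averages \<phi> u \<Longrightarrow> averages \<phi> v \<Longrightarrow> averages \<phi> (\<lambda>x. (u x + v x) / 2)"

lemma integrable_bounded:
  fixes u :: "'x \<Rightarrow> real"
  assumes "u \<in> borel_measurable M" "\<And>x. x \<in> space M \<Longrightarrow> \<bar>u x\<bar> \<le> B"
  shows "integrable M u"
  by (rule integrable_const_bound[where B=B]) (use assms in auto)

lemma integrable_bounded_sq:
  fixes u :: "'x \<Rightarrow> real"
  assumes [measurable]: "u \<in> borel_measurable M" and "\<And>x. x \<in> space M \<Longrightarrow> \<bar>u x\<bar> \<le> B"
  shows "integrable M (\<lambda>x. (u x)\<^sup>2)"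
proof (rule integrable_bounded[where B="B\<^sup>2"])
  fix x assume "x \<in> space M"
  hence "\<bar>u x\<bar>\<^sup>2 \<le> B\<^sup>2" using assms(2) by (intro power_mono) auto
  thus "\<bar>(u x)\<^sup>2\<bar> \<le> B\<^sup>2" by simp
qed simp

lemma averages_basic:
  assumes "averages \<phi> u" "\<phi> \<in> borel_measurable M" "\<And>x. x \<in> space M \<Longrightarrow> \<bar>\<phi> x\<bar> \<le> B"
  shows "u \<in> borel_measurable M \<and> (\<forall>x\<in>space M. \<bar>u x\<bar> \<le> B) \<and> (\<integral>x. u x \<partial>M) = (\<integral>x. \<phi> x \<partial>M)"
  using assms(1)
proof induction
  case base
  thus ?case using assms by auto
next
  case (translate u s)
  thus ?case by (auto intro: measurable_comp_act act_space simp: integral_act)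
next
  case (midpoint u v)
  hence [measurable]: "u \<in> borel_measurable M" "v \<in> borel_measurable M" by auto
  have "integrable M u" "integrable M v" using midpoint by (auto intro: integrable_bounded)
  hence "(\<integral>x. (u x + v x) / 2 \<partial>M) = (\<integral>x. \<phi> x \<partial>M)" using midpoint by simp
  moreover have "\<bar>(u x + v x) / 2\<bar> \<le> B" if "x \<in> space M" for x
  proof -
    have "\<bar>u x\<bar> \<le> B" "\<bar>v x\<bar> \<le> B" using midpoint that by auto
    thus ?thesis by (simp add: abs_le_iff)
  qed
  ultimately show ?case by simp
qed

lemma avg_translate:
  assumes F: "finite F" "F \<subseteq> carrier G" and u: "u \<in> carrier G" and x: "x \<in> space M"
    and B: "\<And>x. x \<in> space M \<Longrightarrow> \<bar>v x\<bar> \<le> B"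
  shows "\<bar>avg F v x - avg F (\<lambda>x. v (act u x)) x\<bar> \<le> B * (real (card (sym_diff (u <# F) F)) / real (card F))"
proof -
  have eq: "u <# F = (\<lambda>s. u \<otimes> s) ` F" by (auto simp: l_coset_def)
  have fin: "finite (u <# F)" and sub: "u <# F \<subseteq> carrier G" using F u eq by auto
  define D where "D = u <# F"
  have eqD: "D = (\<lambda>s. u \<otimes> s) ` F" and finD: "finite D" and subD: "D \<subseteq> carrier G"
    using eq fin sub by (auto simp: D_def)
  let ?w = "\<lambda>s. v (act s x)"
  have w: "\<bar>?w s\<bar> \<le> B" if "s \<in> carrier G" for s using B act_space that x by auto
  have "(\<Sum>s\<in>F. v (act u (act s x))) = (\<Sum>s\<in>F. ?w (u \<otimes> s))"
    by (rule sum.cong) (use F u x act_mult in auto)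
  also have "\<dots> = sum ?w D" unfolding eqD
    by (subst sum.reindex) (use F u in \<open>auto intro!: inj_onI simp: subset_iff\<close>)
  finally have "avg F v x - avg F (\<lambda>x. v (act u x)) x = (sum ?w F - sum ?w D) / real (card F)"
    by (simp add: avg_def diff_divide_distrib)
  moreover have "sum ?w F - sum ?w D = sum ?w (F - D) - sum ?w (D - F)"
    using sum.Int_Diff[OF F(1), of ?w "D"] sum.Int_Diff[OF finD, of ?w F] by (simp add: Int_commute)
  moreover have "\<bar>sum ?w (F - D) - sum ?w (D - F)\<bar> \<le> B * real (card (sym_diff D F))"
  proof -
    have "\<bar>sum ?w (F - D) - sum ?w (D - F)\<bar>
        \<le> (\<Sum>s\<in>F - D. \<bar>?w s\<bar>) + (\<Sum>s\<in>D - F. \<bar>?w s\<bar>)"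
      using sum_abs[of ?w "F - D"] sum_abs[of ?w "D - F"] by linarith
    also have "\<dots> = (\<Sum>s\<in>sym_diff D F. \<bar>?w s\<bar>)"
      by (subst sum.union_disjoint) (use finD F in auto)
    also have "\<dots> \<le> (\<Sum>s\<in>sym_diff D F. B)" by (intro sum_mono w) (use subD F in auto)
    finally show ?thesis by (simp add: mult.commute)
  qed
  ultimately show ?thesis unfolding D_def[symmetric] by (simp add: divide_right_mono)
qed

text \<open>Passing from \<open>\<phi>\<close> to an average of its translates does not change the F{\o}lner averages in the limit.\<close>

lemma avg_averages:
  assumes F: "folner_sequence G F"
    and \<phi>: "\<phi> \<in> borel_measurable M" "\<And>x. x \<in> space M \<Longrightarrow> \<bar>\<phi> x\<bar> \<le> B"
    and "averages \<phi> u" "0 < e"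
  shows "eventually (\<lambda>n. \<forall>x\<in>space M. \<bar>avg (F n) \<phi> x - avg (F n) u x\<bar> \<le> e) sequentially"
  using assms(4,5)
proof (induction arbitrary: e)
  case base
  thus ?case by simp
next
  case (translate u s)
  have uB: "\<And>x. x \<in> space M \<Longrightarrow> \<bar>u x\<bar> \<le> B" using averages_basic[OF translate.hyps(1) \<phi>] by auto
  have "(\<lambda>n. B * (real (card (sym_diff (s <# F n) (F n))) / real (card (F n)))) \<longlonglongrightarrow> B * 0"
    using F translate.hyps by (intro tendsto_intros) (auto simp: folner_sequence_def)
  hence "eventually (\<lambda>n. B * (real (card (sym_diff (s <# F n) (F n))) / real (card (F n))) < e / 2) sequentially"
    by (rule order_tendstoD) (use translate.prems in auto)
  moreover have "eventually (\<lambda>n. \<forall>x\<in>space M. \<bar>avg (F n) \<phi> x - avg (F n) u x\<bar> \<le> e / 2) sequentially"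
    by (rule translate.IH) (use translate.prems in auto)
  ultimately show ?case
  proof eventually_elim
    case (elim n)
    show ?case
    proof
      fix x assume x: "x \<in> space M"
      have "finite (F n)" "F n \<subseteq> carrier G" using F by (auto simp: folner_sequence_def)
      from avg_translate[OF this translate.hyps(2) x, of u B, OF uB]
      have "\<bar>avg (F n) u x - avg (F n) (\<lambda>x. u (act s x)) x\<bar> \<le> e / 2" using elim(1) by linarith
      thus "\<bar>avg (F n) \<phi> x - avg (F n) (\<lambda>x. u (act s x)) x\<bar> \<le> e" using elim(2)[rule_format, OF x] by linarith
    qed
  qed
next
  case (midpoint u v)
  from midpoint.IH(1)[OF midpoint.prems] midpoint.IH(2)[OF midpoint.prems] show ?case
  proof eventually_elim
    case (elim n)
    show ?case
    proof
      fix x assume "x \<in> space M"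
      hence "\<bar>avg (F n) \<phi> x - avg (F n) u x\<bar> \<le> e" "\<bar>avg (F n) \<phi> x - avg (F n) v x\<bar> \<le> e"
        using elim by auto
      moreover have "avg (F n) (\<lambda>x. (u x + v x) / 2) x = (avg (F n) u x + avg (F n) v x) / 2"
        by (simp add: avg_def sum.distrib sum_divide_distrib[symmetric] add_divide_distrib)
      ultimately show "\<bar>avg (F n) \<phi> x - avg (F n) (\<lambda>x. (u x + v x) / 2) x\<bar> \<le> e" by (simp add: abs_le_iff field_simps)
    qed
  qed
qed

lemma AE_summable_of_fast_L2:
  fixes d :: "nat \<Rightarrow> 'x \<Rightarrow> real"
  assumes [measurable]: "\<And>k. d k \<in> borel_measurable M"
    and int: "\<And>k. integrable M (\<lambda>x. (d k x)\<^sup>2)"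
    and bound: "\<And>k. (\<integral>x. (d k x)\<^sup>2 \<partial>M) \<le> 4 * (1/16) ^ k"
  shows "AE x in M. summable (\<lambda>k. \<bar>d k x\<bar>)"
proof -
  define A where "A = (\<lambda>k. {x \<in> space M. (d k x)\<^sup>2 \<ge> (1/4) ^ k})"
  have Am[measurable]: "A k \<in> sets M" for k unfolding A_def by measurable
  have Ab: "measure M (A k) \<le> 4 * (1/4) ^ k" for k
  proof -
    have "measure M (A k) \<le> (\<integral>x. (d k x)\<^sup>2 \<partial>M) / (1/4) ^ k" unfolding A_def
      by (rule integral_Markov_inequality_measure[where A="space M"]) (use int in auto)
    also have "\<dots> \<le> 4 * (1/16) ^ k / (1/4) ^ k" by (intro divide_right_mono bound) simp
    also have "(1/16::real) ^ k = (1/4) ^ k * (1/4) ^ k" by (simp flip: power_mult_distrib)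
    also have "4 * ((1/4) ^ k * (1/4) ^ k) / (1/4) ^ k = 4 * (1/4 :: real) ^ k" by simp
    finally show ?thesis .
  qed
  have "summable (\<lambda>k. measure M (A k))"
    by (rule summable_comparison_test[OF _ summable_mult[OF summable_geometric]])
       (use Ab in \<open>auto intro!: exI[of _ 0]\<close>)
  hence "AE x in M. eventually (\<lambda>k. x \<in> space M - A k) sequentially"
    by (intro borel_cantelli_AE1) (auto simp: emeasure_eq_measure)
  thus ?thesis
  proof eventually_elim
    case (elim x)
    then obtain N where N: "\<And>k. k \<ge> N \<Longrightarrow> x \<in> space M - A k" by (auto simp: eventually_sequentially)
    show ?case
    proof (rule summable_comparison_test[OF _ summable_geometric[of "1/2"]])
      show "\<exists>N. \<forall>k\<ge>N. norm \<bar>d k x\<bar> \<le> (1/2) ^ k"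
      proof (intro exI allI impI)
        fix k assume "N \<le> k"
        hence "(d k x)\<^sup>2 \<le> (1/4) ^ k" using N[of k] by (auto simp: A_def)
        also have "(1/4::real) ^ k = ((1/2) ^ k)\<^sup>2" by (simp add: power2_eq_square flip: power_mult_distrib)
        finally have "\<bar>d k x\<bar> \<le> \<bar>(1/2) ^ k\<bar>" by (simp only: abs_le_square_iff)
        thus "norm \<bar>d k x\<bar> \<le> (1/2) ^ k" by simp
      qed
    qed simp
  qed
qed

text \<open>Some averages of a mean zero function are small in \<open>L\<^sup>2\<close>. A sequence of averages whose norms approach
  the infimum fast is Cauchy by the parallelogram law, and for the same reason its difference from any
  of its translates tends to zero. It therefore converges almost everywhere to a function that is
  invariant up to null sets and vanishes by ergodicity; so the infimum is zero.\<close>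

lemma averages_small:
  assumes ergodic: "\<And>A. A \<in> sets M \<Longrightarrow> (\<And>s. s \<in> carrier G \<Longrightarrow> act s -` A \<inter> space M = A) \<Longrightarrow>
        measure M A = 0 \<or> measure M A = 1"
    and \<phi>: "\<phi> \<in> borel_measurable M" "\<And>x. x \<in> space M \<Longrightarrow> \<bar>\<phi> x\<bar> \<le> B"
    and mean: "(\<integral>x. \<phi> x \<partial>M) = 0" and e: "0 < (e::real)"
  shows "\<exists>u. averages \<phi> u \<and> (\<integral>x. (u x)\<^sup>2 \<partial>M) < e"
proof -
  define q where "q = (\<lambda>u :: 'x \<Rightarrow> real. \<integral>x. (u x)\<^sup>2 \<partial>M)"
  define m where "m = Inf (q ` Collect (averages \<phi>))"
  have bdd: "bdd_below (q ` Collect (averages \<phi>))"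
    by (rule bdd_belowI[of _ 0]) (auto simp: q_def)
  have ne: "q ` Collect (averages \<phi>) \<noteq> {}" using averages.base by auto
  have low: "m \<le> q u" if "averages \<phi> u" for u
    unfolding m_def by (rule cInf_lower[OF _ bdd]) (use that in auto)
  have "\<exists>u. averages \<phi> u \<and> q u < m + (1/16) ^ k" for k
  proof -
    have "Inf (q ` Collect (averages \<phi>)) < m + (1/16) ^ k" by (simp add: m_def)
    thus ?thesis using cInf_lessD[OF ne] by blast
  qed
  then obtain \<psi> where \<psi>: "\<And>k. averages \<phi> (\<psi> k)" "\<And>k. q (\<psi> k) < m + (1/16) ^ k" by metis
  have bas: "u \<in> borel_measurable M" "x \<in> space M \<Longrightarrow> \<bar>u x\<bar> \<le> B" "(\<integral>x. u x \<partial>M) = 0"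
     if "averages \<phi> u" for u x
    using averages_basic[OF that \<phi>] mean by auto
  have [measurable]: "\<psi> k \<in> borel_measurable M" for k using bas \<psi> by auto
  have diff: "(\<integral>x. (u x - v x)\<^sup>2 \<partial>M) \<le> 2 * q u + 2 * q v - 4 * m"
    and diffi: "integrable M (\<lambda>x. (u x - v x)\<^sup>2)"
    if u: "averages \<phi> u" and v: "averages \<phi> v" for u v
  proof -
    have [measurable]: "u \<in> borel_measurable M" "v \<in> borel_measurable M" using bas u v by auto
    have w: "averages \<phi> (\<lambda>x. (u x + v x) / 2)" using u v by (rule averages.midpoint)
    have i: "integrable M (\<lambda>x. (u x)\<^sup>2)" "integrable M (\<lambda>x. (v x)\<^sup>2)" "integrable M (\<lambda>x. ((u x + v x) / 2)\<^sup>2)"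
      using bas u v w by (auto intro!: integrable_bounded_sq)
    have eq: "(u x - v x)\<^sup>2 = 2 * (u x)\<^sup>2 + 2 * (v x)\<^sup>2 - 4 * ((u x + v x) / 2)\<^sup>2" for x
      by (simp add: power2_eq_square field_simps)
    show "integrable M (\<lambda>x. (u x - v x)\<^sup>2)" unfolding eq using i by simp
    have "(\<integral>x. (u x - v x)\<^sup>2 \<partial>M) = 2 * q u + 2 * q v - 4 * q (\<lambda>x. (u x + v x) / 2)"
      unfolding eq q_def using i by simp
    thus "(\<integral>x. (u x - v x)\<^sup>2 \<partial>M) \<le> 2 * q u + 2 * q v - 4 * m" using low[OF w] by simp
  qed
  have "AE x in M. summable (\<lambda>k. \<bar>\<psi> (Suc k) x - \<psi> k x\<bar>)"
  proof (rule AE_summable_of_fast_L2)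
    fix k
    show "integrable M (\<lambda>x. (\<psi> (Suc k) x - \<psi> k x)\<^sup>2)" by (intro diffi \<psi>)
    have "(1/16) ^ Suc k \<le> ((1/16) ^ k :: real)" by simp
    thus "(\<integral>x. (\<psi> (Suc k) x - \<psi> k x)\<^sup>2 \<partial>M) \<le> 4 * (1/16) ^ k"
      using diff[OF \<psi>(1) \<psi>(1), of "Suc k" k] \<psi>(2)[of k] \<psi>(2)[of "Suc k"] by linarith
  qed simp
  hence conv: "AE x in M. convergent (\<lambda>k. \<psi> k x)"
  proof eventually_elim
    case (elim x)
    hence "summable (\<lambda>k. \<psi> (Suc k) x - \<psi> k x)" by (rule summable_rabs_cancel)
    hence "convergent (\<lambda>n. \<Sum>k<n. \<psi> (Suc k) x - \<psi> k x)" by (simp add: summable_iff_convergent)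
    moreover have "(\<lambda>n. \<Sum>k<n. \<psi> (Suc k) x - \<psi> k x) = (\<lambda>n. \<psi> n x - \<psi> 0 x)"
      by (rule ext) (rule sum_lessThan_telescope[of "\<lambda>k. \<psi> k x"])
    ultimately have "convergent (\<lambda>n. \<psi> n x - \<psi> 0 x)" by (simp only:)
    thus ?case by (simp add: convergent_diff_const_right_iff)
  qed
  have shift: "AE x in M. \<forall>s\<in>carrier G. (\<lambda>k. \<psi> k (act s x) - \<psi> k x) \<longlonglongrightarrow> 0"
  proof (rule AE_ball_countable'[OF _ countable_group])
    fix s assume s: "s \<in> carrier G"
    have tr: "averages \<phi> (\<lambda>x. \<psi> k (act s x))" for k by (rule averages.translate[OF \<psi>(1) s])
    have "AE x in M. summable (\<lambda>k. \<bar>\<psi> k (act s x) - \<psi> k x\<bar>)"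
    proof (rule AE_summable_of_fast_L2)
      fix k
      show "(\<lambda>x. \<psi> k (act s x) - \<psi> k x) \<in> borel_measurable M"
        by (intro borel_measurable_diff measurable_comp_act[OF s]) simp_all
      show "integrable M (\<lambda>x. (\<psi> k (act s x) - \<psi> k x)\<^sup>2)" by (intro diffi \<psi> tr)
      have "q (\<lambda>x. \<psi> k (act s x)) = q (\<psi> k)" unfolding q_def
        by (rule integral_act[OF s]) simp
      thus "(\<integral>x. (\<psi> k (act s x) - \<psi> k x)\<^sup>2 \<partial>M) \<le> 4 * (1/16) ^ k"
        using diff[OF tr \<psi>(1), of k k] \<psi>(2)[of k] by linarith
    qed
    thus "AE x in M. (\<lambda>k. \<psi> k (act s x) - \<psi> k x) \<longlonglongrightarrow> 0"
    proof eventually_elim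
      case (elim x)
      from summable_LIMSEQ_zero[OF elim] show ?case by (simp only: tendsto_rabs_zero_iff)
    qed
  qed
  define l where "l = (\<lambda>x. lim (\<lambda>k. \<psi> k x))"
  have [measurable]: "l \<in> borel_measurable M" unfolding l_def by measurable
  have lim: "AE x in M. (\<lambda>k. \<psi> k x) \<longlonglongrightarrow> l x"
    using conv by eventually_elim (simp add: l_def convergent_LIMSEQ_iff)
  have \<psi>B: "AE x in M. norm (\<psi> k x) \<le> B" for k by (rule AE_I2) (use bas \<psi> in auto)
  have lB: "AE x in M. norm (l x) \<le> B"
    using lim AE_space
  proof eventually_elim
    case (elim x)
    have "(\<lambda>k. norm (\<psi> k x)) \<longlonglongrightarrow> norm (l x)" by (intro tendsto_norm elim)
    thus ?case by (rule LIMSEQ_le_const2) (use bas \<psi> elim in auto)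
  qed
  have li: "integrable M l" by (rule integrable_const_bound[OF lB]) simp
  have "(\<lambda>k. \<integral>x. \<psi> k x \<partial>M) \<longlonglongrightarrow> (\<integral>x. l x \<partial>M)"
    by (rule integral_dominated_convergence[where w="\<lambda>_. B"]) (use lim \<psi>B in auto)
  hence l0: "(\<integral>x. l x \<partial>M) = 0" using bas \<psi> by (simp add: LIMSEQ_const_iff)
  \<comment> \<open>The set \<open>A\<close> of points whose whole orbit has lower limit at least \<open>c\<close> is strictly invariant, so
    ergodicity applies to it as it stands. Full measure would contradict the zero mean of \<open>l\<close>.\<close>
  have up: "AE x in M. l x \<le> c" if c: "0 < c" for c
  proof -
    define A where "A = {x \<in> space M. \<forall>s\<in>carrier G. \<exists>N. \<forall>n\<ge>N. \<psi> n (act s x) \<ge> c}"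
    have Am: "A \<in> sets M" unfolding A_def
    proof (rule sets.sets_Collect_countable_All'[OF _ countable_group])
      fix s assume "s \<in> carrier G"
      hence [measurable]: "(\<lambda>x. \<psi> n (act s x)) \<in> borel_measurable M" for n
        by (rule measurable_comp_act) simp
      show "{x \<in> space M. \<exists>N. \<forall>n\<ge>N. \<psi> n (act s x) \<ge> c} \<in> sets M" by measurable
    qed
    have Ainv: "act t -` A \<inter> space M = A" if t: "t \<in> carrier G" for t
    proof (intro equalityI subsetI)
      fix x assume "x \<in> act t -` A \<inter> space M"
      hence x: "x \<in> space M" and *: "\<And>s. s \<in> carrier G \<Longrightarrow> \<exists>N. \<forall>n\<ge>N. \<psi> n (act s (act t x)) \<ge> c"
        by (auto simp: A_def)
      have "\<exists>N. \<forall>n\<ge>N. \<psi> n (act s x) \<ge> c" if s: "s \<in> carrier G" for s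
      proof -
        have "act s x = act (s \<otimes> inv t) (act t x)"
          using s t x by (simp add: act_mult act_space act_inv_cancel)
        thus ?thesis using *[of "s \<otimes> inv t"] s t by auto
      qed
      thus "x \<in> A" using x by (auto simp: A_def)
    next
      fix x assume "x \<in> A"
      hence x: "x \<in> space M" and *: "\<And>s. s \<in> carrier G \<Longrightarrow> \<exists>N. \<forall>n\<ge>N. \<psi> n (act s x) \<ge> c"
        by (auto simp: A_def)
      have "\<exists>N. \<forall>n\<ge>N. \<psi> n (act s (act t x)) \<ge> c" if s: "s \<in> carrier G" for s
        using *[of "s \<otimes> t"] s t x by (simp add: act_mult)
      thus "x \<in> act t -` A \<inter> space M" using x t act_space by (auto simp: A_def)
    qed
    have "measure M A \<noteq> 1"
    proof
      assume "measure M A = 1"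
      hence "AE x in M. x \<in> A" using Am by (simp add: prob_eq_1)
      hence "AE x in M. c \<le> l x" using lim AE_space
      proof eventually_elim
        case (elim x)
        have "\<exists>N. \<forall>n\<ge>N. c \<le> \<psi> n (act \<one> x)" using elim(1) unfolding A_def by blast
        hence "\<exists>N. \<forall>n\<ge>N. c \<le> \<psi> n x" by (simp add: act_one[OF elim(3)])
        thus ?case by (rule LIMSEQ_le_const[OF elim(2)])
      qed
      hence "c \<le> (\<integral>x. l x \<partial>M)" by (rule integral_ge_const[OF li])
      thus False using l0 c by simp
    qed
    hence "measure M A = 0" using ergodic[OF Am Ainv] by blast
    hence "AE x in M. x \<notin> A" using Am by (simp add: prob_eq_0)
    thus ?thesis using lim shift AE_space
    proof eventually_elim
      case (elim x)
      show ?case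
      proof (rule ccontr)
        assume "\<not> l x \<le> c"
        have "\<exists>N. \<forall>n\<ge>N. \<psi> n (act s x) \<ge> c" if "s \<in> carrier G" for s
        proof -
          have "(\<lambda>k. (\<psi> k (act s x) - \<psi> k x) + \<psi> k x) \<longlonglongrightarrow> 0 + l x"
            by (intro tendsto_add elim) (use elim that in auto)
          hence "eventually (\<lambda>k. c < \<psi> k (act s x)) sequentially"
            using order_tendstoD(1)[of "\<lambda>k. \<psi> k (act s x)" "l x"] \<open>\<not> l x \<le> c\<close> by simp
          thus ?thesis unfolding eventually_sequentially by (meson less_imp_le)
        qed
        hence "x \<in> A" using elim by (auto simp: A_def)
        thus False using elim by simp
      qed
    qed
  qed
  have "AE x in M. \<forall>j::nat. l x \<le> 1 / real (Suc j)"
    unfolding AE_all_countable by (intro allI up) simp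
  hence lneg: "AE x in M. l x \<le> 0"
  proof eventually_elim
    case (elim x)
    show ?case
    proof (rule ccontr)
      assume "\<not> l x \<le> 0"
      then obtain j where "1 / real (Suc j) < l x"
        using reals_Archimedean[of "l x"] by (auto simp: inverse_eq_divide)
      thus False using elim by (meson leD)
    qed
  qed
  have "(\<integral>x. - l x \<partial>M) = 0 \<longleftrightarrow> (AE x in M. - l x = 0)"
    by (rule integral_nonneg_eq_0_iff_AE) (use li lneg in auto)
  hence lz: "AE x in M. l x = 0" using l0 by simp
  have "(\<lambda>k. q (\<psi> k)) \<longlonglongrightarrow> (\<integral>x. 0 \<partial>M)" unfolding q_def
  proof (rule integral_dominated_convergence[where w="\<lambda>_. B\<^sup>2"])
    show "AE x in M. (\<lambda>k. (\<psi> k x)\<^sup>2) \<longlonglongrightarrow> 0" using lim lz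
    proof eventually_elim
      case (elim x)
      thus ?case using tendsto_power[OF elim(1), of 2] by simp
    qed
    show "AE x in M. norm ((\<psi> k x)\<^sup>2) \<le> B\<^sup>2" for k using \<psi>B[of k]
      by eventually_elim (simp add: abs_le_square_iff[symmetric])
  qed simp_all
  hence "(\<lambda>k. q (\<psi> k)) \<longlonglongrightarrow> 0" by simp
  hence "eventually (\<lambda>k. q (\<psi> k) < e) sequentially" by (rule order_tendstoD) (rule e)
  then obtain k where "q (\<psi> k) < e" by (auto simp: eventually_sequentially)
  thus ?thesis using \<psi>(1) unfolding q_def by blast
qed

lemma avg_sq_le:
  assumes F: "finite F" "F \<noteq> {}" "F \<subseteq> carrier G"
    and u: "u \<in> borel_measurable M" "\<And>x. x \<in> space M \<Longrightarrow> \<bar>u x\<bar> \<le> B"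
  shows "avg F u \<in> borel_measurable M" "integrable M (\<lambda>x. (avg F u x)\<^sup>2)"
    "(\<integral>x. (avg F u x)\<^sup>2 \<partial>M) \<le> (\<integral>x. (u x)\<^sup>2 \<partial>M)"
proof -
  have c: "0 < real (card F)" using F by (simp add: card_gt_0_iff)
  have m: "s \<in> F \<Longrightarrow> (\<lambda>x. u (act s x)) \<in> borel_measurable M" for s
    using F u by (intro measurable_comp_act) auto
  have i: "s \<in> F \<Longrightarrow> integrable M (\<lambda>x. (u (act s x))\<^sup>2)" for s
    using F u by (intro integrable_bounded_sq[where B=B] m) (auto intro: act_space)
  show am: "avg F u \<in> borel_measurable M" unfolding avg_def[abs_def]
    by (intro borel_measurable_divide borel_measurable_sum borel_measurable_const m)
  have le: "(avg F u x)\<^sup>2 \<le> (\<Sum>s\<in>F. (u (act s x))\<^sup>2) / real (card F)" for x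
  proof -
    have "(avg F u x)\<^sup>2 \<le> (\<Sum>s\<in>F. (u (act s x))\<^sup>2) * real (card F) / (real (card F))\<^sup>2"
      unfolding avg_def power_divide by (intro divide_right_mono sum_squared_le_sum_of_squares) simp
    thus ?thesis using c by (simp add: power2_eq_square)
  qed
  have ir: "integrable M (\<lambda>x. (\<Sum>s\<in>F. (u (act s x))\<^sup>2) / real (card F))"
    using i by simp
  show ai: "integrable M (\<lambda>x. (avg F u x)\<^sup>2)"
    by (rule Bochner_Integration.integrable_bound[OF ir]) (use le am in \<open>auto simp: sum_nonneg\<close>)
  have "(\<integral>x. (avg F u x)\<^sup>2 \<partial>M) \<le> (\<integral>x. (\<Sum>s\<in>F. (u (act s x))\<^sup>2) / real (card F) \<partial>M)"
    by (rule integral_mono[OF ai ir le])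
  also have "\<dots> = (\<Sum>s\<in>F. \<integral>x. (u (act s x))\<^sup>2 \<partial>M) / real (card F)" using i by (simp add: integral_sum)
  also have "(\<Sum>s\<in>F. \<integral>x. (u (act s x))\<^sup>2 \<partial>M) = (\<Sum>s\<in>F. \<integral>x. (u x)\<^sup>2 \<partial>M)"
    by (intro sum.cong refl integral_act) (use F u in auto)
  finally show "(\<integral>x. (avg F u x)\<^sup>2 \<partial>M) \<le> (\<integral>x. (u x)\<^sup>2 \<partial>M)" using c by simp
qed

theorem mean_ergodic_in_probability:
  assumes ergodic: "\<And>A. A \<in> sets M \<Longrightarrow> (\<And>s. s \<in> carrier G \<Longrightarrow> act s -` A \<inter> space M = A) \<Longrightarrow>
        measure M A = 0 \<or> measure M A = 1"
    and \<phi>: "\<phi> \<in> borel_measurable M" "\<And>x. x \<in> space M \<Longrightarrow> \<bar>\<phi> x\<bar> \<le> B"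
    and F: "folner_sequence G F" and \<kappa>: "0 < \<kappa>"
  shows "(\<lambda>n. measure M {x \<in> space M. \<kappa> \<le> \<bar>avg (F n) \<phi> x - (\<integral>x. \<phi> x \<partial>M)\<bar>}) \<longlonglongrightarrow> 0"
proof -
  define a where "a = (\<integral>x. \<phi> x \<partial>M)"
  define \<phi>' where "\<phi>' = (\<lambda>x. \<phi> x - a)"
  have \<phi>': "\<phi>' \<in> borel_measurable M" "\<And>x. x \<in> space M \<Longrightarrow> \<bar>\<phi>' x\<bar> \<le> B + \<bar>a\<bar>"
    using \<phi> by (auto simp: \<phi>'_def intro: order.trans[OF abs_triangle_ineq4] add_mono)
  have mean: "(\<integral>x. \<phi>' x \<partial>M) = 0"
    using integrable_bounded[OF \<phi>] by (simp add: \<phi>'_def a_def prob_space)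
  have Fn: "finite (F n)" "F n \<noteq> {}" "F n \<subseteq> carrier G" for n using F by (auto simp: folner_sequence_def)
  have avg': "avg (F n) \<phi>' x = avg (F n) \<phi> x - a" for n x
    using Fn[of n] by (simp add: avg_def \<phi>'_def sum_subtractf diff_divide_distrib)
  show ?thesis unfolding a_def[symmetric]
  proof (rule LIMSEQ_I)
    fix r :: real assume r: "0 < r"
    obtain u where u: "averages \<phi>' u" "(\<integral>x. (u x)\<^sup>2 \<partial>M) < r * (\<kappa>/2)\<^sup>2"
      using averages_small[OF ergodic \<phi>' mean, of "r * (\<kappa>/2)\<^sup>2"] r \<kappa> by auto
    have ub: "u \<in> borel_measurable M" "\<And>x. x \<in> space M \<Longrightarrow> \<bar>u x\<bar> \<le> B + \<bar>a\<bar>"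
      using averages_basic[OF u(1) \<phi>'] by auto
    have "eventually (\<lambda>n. \<forall>x\<in>space M. \<bar>avg (F n) \<phi>' x - avg (F n) u x\<bar> \<le> \<kappa>/2) sequentially"
      by (rule avg_averages[OF F \<phi>' u(1)]) (use \<kappa> in auto)
    then obtain N where N: "\<And>n x. n \<ge> N \<Longrightarrow> x \<in> space M \<Longrightarrow> \<bar>avg (F n) \<phi>' x - avg (F n) u x\<bar> \<le> \<kappa>/2"
      by (auto simp: eventually_sequentially)
    show "\<exists>no. \<forall>n\<ge>no. norm (measure M {x \<in> space M. \<kappa> \<le> \<bar>avg (F n) \<phi> x - a\<bar>} - 0) < r"
    proof (intro exI allI impI)
      fix n assume n: "N \<le> n"
      note av = avg_sq_le[OF Fn[of n] ub]
      have [measurable]: "avg (F n) u \<in> borel_measurable M" by (rule av)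
      have "measure M {x \<in> space M. \<kappa> \<le> \<bar>avg (F n) \<phi> x - a\<bar>}
          \<le> measure M {x \<in> space M. (\<kappa>/2)\<^sup>2 \<le> (avg (F n) u x)\<^sup>2}"
      proof (rule finite_measure_mono)
        show "{x \<in> space M. \<kappa> \<le> \<bar>avg (F n) \<phi> x - a\<bar>} \<subseteq> {x \<in> space M. (\<kappa>/2)\<^sup>2 \<le> (avg (F n) u x)\<^sup>2}"
        proof safe
          fix x assume x: "x \<in> space M" "\<kappa> \<le> \<bar>avg (F n) \<phi> x - a\<bar>"
          hence "\<bar>\<kappa>/2\<bar> \<le> \<bar>avg (F n) u x\<bar>" using N[OF n x(1)] \<kappa> unfolding avg' by linarith
          thus "(\<kappa>/2)\<^sup>2 \<le> (avg (F n) u x)\<^sup>2" by (simp only: abs_le_square_iff)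
        qed
      qed simp
      also have "\<dots> \<le> (\<integral>x. (avg (F n) u x)\<^sup>2 \<partial>M) / (\<kappa>/2)\<^sup>2"
        by (rule integral_Markov_inequality_measure[where A="space M"]) (use av \<kappa> in auto)
      also have "\<dots> < r"
        using av(3) u(2) \<kappa> by (simp add: pos_divide_less_eq)
      finally show "norm (measure M {x \<in> space M. \<kappa> \<le> \<bar>avg (F n) \<phi> x - a\<bar>} - 0) < r" by simp
    qed
  qed
qed

end

section \<open>Empirical measures and weak* neighbourhoods\<close>

lemma space_borel_of [simp]: "space (borel_of T) = topspace T"
  by (simp add: borel_of_def space_measure_of_conv)

lemma sets_borel_of: "sets (borel_of T) = sigma_sets (topspace T) {U. openin T U}"
  unfolding borel_of_def by (rule sets_measure_of) (auto dest: openin_subset)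

lemma openin_borel_of: "openin T U \<Longrightarrow> U \<in> sets (borel_of T)"
  by (simp add: sets_borel_of sigma_sets.Basic)

lemma continuous_map_measurable:
  assumes "continuous_map T T' g"
  shows "g \<in> measurable (borel_of T) (borel_of T')"
  unfolding borel_of_def[of T']
proof (rule measurable_measure_of)
  show "g \<in> space (borel_of T) \<rightarrow> topspace T'" using assms by (auto simp: continuous_map_def)
  fix U assume "U \<in> {U. openin T' U}"
  hence "openin T {x \<in> topspace T. g x \<in> U}" using assms by (auto simp: continuous_map_def)
  moreover have "g -` U \<inter> space (borel_of T) = {x \<in> topspace T. g x \<in> U}" by auto
  ultimately show "g -` U \<inter> space (borel_of T) \<in> sets (borel_of T)" by (simp add: openin_borel_of)
qed (auto dest: openin_subset)

lemma continuous_map_borel_measurable: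
  assumes "continuous_map T euclideanreal \<phi>"
  shows "\<phi> \<in> borel_measurable (borel_of T)"
proof (rule borel_measurableI)
  fix U :: "real set" assume "open U"
  hence "openin T {x \<in> topspace T. \<phi> x \<in> U}" using assms by (auto simp: continuous_map_def)
  moreover have "\<phi> -` U \<inter> space (borel_of T) = {x \<in> topspace T. \<phi> x \<in> U}" by auto
  ultimately show "\<phi> -` U \<inter> space (borel_of T) \<in> sets (borel_of T)" by (simp add: openin_borel_of)
qed

text \<open>As the image of the uniform measure on \<open>F\<close> under the orbit map, the empirical measure inherits
  countable additivity, and integrals along it are orbit averages.\<close>

lemma empirical_measure_eq_distr:
  assumes F: "finite F" "F \<noteq> {}" and sub: "\<And>s. s \<in> F \<Longrightarrow> act s x \<in> topspace T"
  shows "empirical_measure T act F x = distr (uniform_count_measure F) (borel_of T) (\<lambda>s. act s x)"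
  unfolding empirical_measure_def distr_def space_borel_of
proof (rule measure_of_eq)
  show "sets (borel_of T) \<subseteq> Pow (topspace T)" using sets.space_closed[of "borel_of T"] by simp
  fix A assume "A \<in> sigma_sets (topspace T) (sets (borel_of T))"
  hence A: "A \<in> sets (borel_of T)" using sets.sigma_sets_eq[of "borel_of T"] by simp
  have c: "0 < card F" using F by (simp add: card_gt_0_iff)
  have "(\<Sum>s\<in>F. emeasure (return (borel_of T) (act s x)) A) = (\<Sum>s\<in>F. indicator A (act s x))"
    using A by simp
  also have "\<dots> = of_nat (card {s \<in> F. act s x \<in> A})"
    using F by (simp add: indicator_def sum.If_cases Int_def)
  also have "\<dots> / of_nat (card F) = ennreal (real (card {s \<in> F. act s x \<in> A}) / real (card F))"
    using c by (simp add: ennreal_of_nat_eq_real_of_nat divide_ennreal)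
  also have "\<dots> = emeasure (uniform_count_measure F) ((\<lambda>s. act s x) -` A \<inter> space (uniform_count_measure F))"
    using F by (subst emeasure_uniform_count_measure) (auto simp: Int_def conj_commute space_uniform_count_measure)
  finally show "(\<Sum>s\<in>F. emeasure (return (borel_of T) (act s x)) A) / of_nat (card F) =
      emeasure (uniform_count_measure F) ((\<lambda>s. act s x) -` A \<inter> space (uniform_count_measure F))" .
qed

lemma empirical_measure_props:
  assumes F: "finite F" "F \<noteq> {}" and sub: "\<And>s. s \<in> F \<Longrightarrow> act s x \<in> topspace T"
  shows "empirical_measure T act F x \<in> borel_prob_measures T"
    and "continuous_map T euclideanreal \<phi> \<Longrightarrow>
      (\<integral>y. \<phi> y \<partial>empirical_measure T act F x) = (\<Sum>s\<in>F. \<phi> (act s x)) / real (card F)"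
proof -
  have m: "(\<lambda>s. act s x) \<in> measurable (uniform_count_measure F) (borel_of T)"
    by (rule measurableI) (use sub in \<open>auto simp: space_uniform_count_measure sets_uniform_count_measure\<close>)
  interpret prob_space "uniform_count_measure F" by (rule prob_space_uniform_count_measure[OF F])
  note eq = empirical_measure_eq_distr[of F act x T, OF F sub]
  show "empirical_measure T act F x \<in> borel_prob_measures T"
    unfolding borel_prob_measures_def using prob_space_distr[OF m] by (simp add: eq)
  show "(\<integral>y. \<phi> y \<partial>empirical_measure T act F x) = (\<Sum>s\<in>F. \<phi> (act s x)) / real (card F)"
    if "continuous_map T euclideanreal \<phi>"
  proof -
    have "(\<integral>y. \<phi> y \<partial>empirical_measure T act F x) = (\<integral>s. \<phi> (act s x) \<partial>uniform_count_measure F)"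
      by (subst eq, assumption, subst integral_distr[OF m continuous_map_borel_measurable[OF that]]) (rule refl)
    thus ?thesis by (simp add: integral_uniform_count_measure[OF F(1)])
  qed
qed

lemma compact_space_bounded_function:
  assumes "compact_space T" "continuous_map T euclideanreal \<phi>"
  obtains B where "\<And>x. x \<in> topspace T \<Longrightarrow> \<bar>\<phi> x\<bar> \<le> B"
proof -
  have "compact (\<phi> ` topspace T)"
    using image_compactin[OF _ assms(2), of "topspace T"] assms(1)
    by (simp add: compact_space_def)
  thus ?thesis using compact_imp_bounded bounded_real that by (metis imageI)
qed

text \<open>The points with empirical measure in \<open>C\<close> need not form a measurable set, so the exceptional points
  are covered by measurable sets \<open>D n\<close>.\<close>

lemma (in pmp_action) empirical_measures_converge:
  assumes ergodic: "\<And>A. A \<in> sets M \<Longrightarrow> (\<And>s. s \<in> carrier G \<Longrightarrow> act s -` A \<inter> space M = A) \<Longrightarrow>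
        measure M A = 0 \<or> measure M A = 1"
    and T: "sets M = sets (borel_of T)" "compact_space T"
    and F: "folner_sequence G F" and C: "C \<in> weak_star_nhds T M"
  shows "\<exists>D. (\<forall>n. D n \<in> sets M) \<and> (\<lambda>n. measure M (D n)) \<longlonglongrightarrow> 0 \<and>
     (\<forall>n. \<forall>x\<in>topspace T - D n. empirical_measure T act (F n) x \<in> C)"
proof -
  have sp: "space M = topspace T" using sets_eq_imp_space_eq[OF T(1)] by simp
  have Fn: "finite (F n)" "F n \<noteq> {}" "F n \<subseteq> carrier G" for n using F by (auto simp: folner_sequence_def)
  let ?S = "{{\<nu> \<in> borel_prob_measures T. (\<integral>x. \<phi> x \<partial>\<nu>) \<in> U} |\<phi> U.
          continuous_map T euclideanreal \<phi> \<and> open U}"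
  let ?P = "\<lambda>V. M \<in> V \<longrightarrow> (\<exists>D. (\<forall>n. D n \<in> sets M) \<and> (\<lambda>n. measure M (D n)) \<longlonglongrightarrow> 0 \<and>
     (\<forall>n. \<forall>x\<in>topspace T - D n. empirical_measure T act (F n) x \<in> V))"
  obtain V where V: "openin (weak_star_topology T) V" "M \<in> V" "V \<subseteq> C"
    using C by (auto simp: weak_star_nhds_def)
  have "generate_topology_on ?S V" using V(1) unfolding weak_star_topology_def openin_topology_generated_by_iff .
  hence "?P V"
  proof induction
    case Empty
    thus ?case by simp
  next
    case (Int a b)
    show ?case
    proof
      assume "M \<in> a \<inter> b"
      then obtain D D' where D: "\<forall>n. D n \<in> sets M" "(\<lambda>n. measure M (D n)) \<longlonglongrightarrow> 0"
          "\<forall>n. \<forall>x\<in>topspace T - D n. empirical_measure T act (F n) x \<in> a"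
        and D': "\<forall>n. D' n \<in> sets M" "(\<lambda>n. measure M (D' n)) \<longlonglongrightarrow> 0"
          "\<forall>n. \<forall>x\<in>topspace T - D' n. empirical_measure T act (F n) x \<in> b" using Int.IH by blast
      have "(\<lambda>n. measure M (D n \<union> D' n)) \<longlonglongrightarrow> 0"
      proof (rule tendsto_sandwich[OF always_eventually always_eventually tendsto_const])
        show "(\<lambda>n. measure M (D n) + measure M (D' n)) \<longlonglongrightarrow> 0"
          using tendsto_add[OF D(2) D'(2)] by simp
        show "\<forall>n. measure M (D n \<union> D' n) \<le> measure M (D n) + measure M (D' n)"
          using D(1) D'(1) by (intro allI measure_Un_le) auto
      qed simp
      thus "\<exists>D. (\<forall>n. D n \<in> sets M) \<and> (\<lambda>n. measure M (D n)) \<longlonglongrightarrow> 0 \<and>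
          (\<forall>n. \<forall>x\<in>topspace T - D n. empirical_measure T act (F n) x \<in> a \<inter> b)"
        using D D' by (intro exI[of _ "\<lambda>n. D n \<union> D' n"]) auto
    qed
  next
    case (UN K)
    show ?case
    proof
      assume "M \<in> \<Union>K"
      then obtain k where k: "k \<in> K" "M \<in> k" by blast
      then obtain D where "\<forall>n. D n \<in> sets M" "(\<lambda>n. measure M (D n)) \<longlonglongrightarrow> 0"
          "\<forall>n. \<forall>x\<in>topspace T - D n. empirical_measure T act (F n) x \<in> k" using UN.IH by blast
      thus "\<exists>D. (\<forall>n. D n \<in> sets M) \<and> (\<lambda>n. measure M (D n)) \<longlonglongrightarrow> 0 \<and>
          (\<forall>n. \<forall>x\<in>topspace T - D n. empirical_measure T act (F n) x \<in> \<Union>K)"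
        using k(1) by (intro exI[of _ D]) blast
    qed
  next
    case (Basis s)
    then obtain \<phi> U where s: "s = {\<nu> \<in> borel_prob_measures T. (\<integral>x. \<phi> x \<partial>\<nu>) \<in> U}"
      and \<phi>: "continuous_map T euclideanreal \<phi>" and U: "open U" by blast
    show ?case
    proof
      assume "M \<in> s"
      hence "(\<integral>x. \<phi> x \<partial>M) \<in> U" by (simp add: s)
      then obtain \<kappa> where \<kappa>: "0 < \<kappa>" "ball (\<integral>x. \<phi> x \<partial>M) \<kappa> \<subseteq> U" using U open_contains_ball by blast
      obtain B where B: "\<And>x. x \<in> topspace T \<Longrightarrow> \<bar>\<phi> x\<bar> \<le> B"
        using compact_space_bounded_function[OF T(2) \<phi>] by blast
      have \<phi>m[measurable]: "\<phi> \<in> borel_measurable M"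
        using continuous_map_borel_measurable[OF \<phi>] measurable_cong_sets[OF T(1) refl] by blast
      define D where "D = (\<lambda>n. {x \<in> space M. \<kappa> \<le> \<bar>avg (F n) \<phi> x - (\<integral>x. \<phi> x \<partial>M)\<bar>})"
      have "D n \<in> sets M" for n
      proof -
        have [measurable]: "avg (F n) \<phi> \<in> borel_measurable M"
          by (rule avg_sq_le(1)[OF Fn \<phi>m]) (use B sp in auto)
        show ?thesis unfolding D_def by measurable
      qed
      moreover have "(\<lambda>n. measure M (D n)) \<longlonglongrightarrow> 0" unfolding D_def
        by (rule mean_ergodic_in_probability[OF ergodic \<phi>m _ F \<kappa>(1)]) (use B sp in auto)
      moreover have "empirical_measure T act (F n) x \<in> s" if "x \<in> topspace T - D n" for n x
      proof -
        have sub: "\<And>t. t \<in> F n \<Longrightarrow> act t x \<in> topspace T" using act_space subsetD[OF Fn(3)] that sp by auto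
        have "(\<integral>y. \<phi> y \<partial>empirical_measure T act (F n) x) = avg (F n) \<phi> x"
          using empirical_measure_props(2)[of "F n" act x T, OF Fn(1,2) sub \<phi>] by (simp add: avg_def)
        moreover have "avg (F n) \<phi> x \<in> U"
          using that \<kappa>(2) sp by (auto simp: D_def dist_real_def abs_minus_commute)
        ultimately show ?thesis using empirical_measure_props(1)[of "F n" act x T, OF Fn(1,2) sub] by (simp add: s)
      qed
      ultimately show "\<exists>D. (\<forall>n. D n \<in> sets M) \<and> (\<lambda>n. measure M (D n)) \<longlonglongrightarrow> 0 \<and>
          (\<forall>n. \<forall>x\<in>topspace T - D n. empirical_measure T act (F n) x \<in> s)"
        by (intro exI[of _ D]) auto
    qed
  qed
  thus ?thesis using V by blast
qed

section \<open>Names of orbit segments\<close>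

text \<open>The cell of the partition \<open>\<beta>\<close> that contains \<open>x\<close>.\<close>

definition cell :: "'x set set \<Rightarrow> 'x \<Rightarrow> 'x set" where
  "cell \<beta> x = (THE B. B \<in> \<beta> \<and> x \<in> B)"

text \<open>The \<open>\<beta>\<close>-name of \<open>x\<close> along \<open>F\<close>: the cells that the orbit visits at the times in \<open>F\<close>.\<close>

definition names :: "('g \<Rightarrow> 'x \<Rightarrow> 'x) \<Rightarrow> 'x set set \<Rightarrow> 'g set \<Rightarrow> 'x \<Rightarrow> 'g \<Rightarrow> 'x set" where
  "names act \<beta> F x = (\<lambda>s\<in>F. cell \<beta> (act s x))"

lemma cell_eq:
  assumes "partition_on S \<beta>" "B \<in> \<beta>" "x \<in> B"
  shows "cell \<beta> x = B"
  unfolding cell_def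
proof (rule the_equality)
  fix B' assume "B' \<in> \<beta> \<and> x \<in> B'"
  thus "B' = B" using assms partition_onD2[OF assms(1)] by (auto simp: disjoint_def)
qed (use assms in auto)

lemma cell_in:
  assumes "partition_on S \<beta>" "x \<in> S"
  shows "cell \<beta> x \<in> \<beta>" "x \<in> cell \<beta> x"
proof -
  obtain B where B: "B \<in> \<beta>" "x \<in> B" using assms partition_onD1[OF assms(1)] by blast
  show "cell \<beta> x \<in> \<beta>" "x \<in> cell \<beta> x" using cell_eq[OF assms(1) B] B by auto
qed

lemma names_in_PiE:
  assumes "partition_on S \<beta>" "x \<in> S" "\<And>s. s \<in> F \<Longrightarrow> act s x \<in> S"
  shows "names act \<beta> F x \<in> F \<rightarrow>\<^sub>E \<beta>"
  unfolding names_def using assms cell_in(1)[OF assms(1)] by auto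

lemma names_eq_iff:
  "names act \<beta> F x = names act \<beta> F y \<longleftrightarrow> (\<forall>s\<in>F. cell \<beta> (act s x) = cell \<beta> (act s y))"
  unfolding names_def by (auto simp: fun_eq_iff restrict_def)

lemma partition_join_eq_fibers:
  assumes \<beta>: "partition_on S \<beta>" and F: "F \<noteq> {}"
    and act: "\<And>s x. s \<in> F \<Longrightarrow> x \<in> S \<Longrightarrow> act s x \<in> S"
  shows "partition_join S act F \<beta> = fibers S (names act \<beta> F)"
proof -
  define P where "P = (\<lambda>s. (\<lambda>B. act s -` B \<inter> S) ` \<beta>)"
  have mem: "p = act s -` cell \<beta> (act s x) \<inter> S" if "s \<in> F" "p \<in> P s" "x \<in> p" for s p x
    using that cell_eq[OF \<beta>] by (auto simp: P_def)
  have in_P: "act s -` cell \<beta> (act s x) \<inter> S \<in> P s" if "s \<in> F" "x \<in> S" for s x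
    using that cell_in[OF \<beta> act] by (auto simp: P_def)
  have fib: "{y \<in> S. names act \<beta> F y = names act \<beta> F x} = (\<Inter>s\<in>F. act s -` cell \<beta> (act s x) \<inter> S)"
    if "x \<in> S" for x
  proof (intro equalityI subsetI)
    fix y assume "y \<in> {y \<in> S. names act \<beta> F y = names act \<beta> F x}"
    hence y: "y \<in> S" "\<And>s. s \<in> F \<Longrightarrow> cell \<beta> (act s y) = cell \<beta> (act s x)" by (simp_all add: names_eq_iff)
    show "y \<in> (\<Inter>s\<in>F. act s -` cell \<beta> (act s x) \<inter> S)"
    proof (rule INT_I)
      fix s assume "s \<in> F"
      thus "y \<in> act s -` cell \<beta> (act s x) \<inter> S" using cell_in(2)[OF \<beta> act[of s y]] y by simp
    qed
  next
    fix y assume y: "y \<in> (\<Inter>s\<in>F. act s -` cell \<beta> (act s x) \<inter> S)"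
    hence "y \<in> S" using F by auto
    moreover have "cell \<beta> (act s y) = cell \<beta> (act s x)" if "s \<in> F" for s
      by (rule cell_eq[OF \<beta> cell_in(1)[OF \<beta> act[OF that \<open>x \<in> S\<close>]]]) (use y that in blast)
    ultimately show "y \<in> {y \<in> S. names act \<beta> F y = names act \<beta> F x}" by (simp add: names_eq_iff)
  qed
  have "partition_join S act F \<beta> = common_refinement (P ` F)" by (simp add: partition_join_def P_def)
  also have "\<dots> = fibers S (names act \<beta> F)"
  proof (intro equalityI subsetI)
    fix A assume "A \<in> common_refinement (P ` F)"
    then obtain f where f: "f \<in> (\<Pi>\<^sub>E p\<in>P ` F. p)" and A: "A = \<Inter> (f ` (P ` F))" "A \<noteq> {}"
      by (auto simp: common_refinement_def)
    then obtain x where x: "x \<in> A" by blast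
    have fs: "f (P s) = act s -` cell \<beta> (act s x) \<inter> S" if "s \<in> F" for s
      by (rule mem[OF that]) (use f that x A in auto)
    obtain s where s: "s \<in> F" using F by blast
    have "x \<in> f (P s)" using x A s by auto
    hence "x \<in> S" using fs[OF s] by simp
    have "A = (\<Inter>s\<in>F. act s -` cell \<beta> (act s x) \<inter> S)" unfolding A(1) using fs by auto
    also note fib[OF \<open>x \<in> S\<close>, symmetric]
    finally show "A \<in> fibers S (names act \<beta> F)" using \<open>x \<in> S\<close> unfolding fibers_def by blast
  next
    fix A assume "A \<in> fibers S (names act \<beta> F)"
    then obtain x where x: "x \<in> S" and A: "A = {y \<in> S. names act \<beta> F y = names act \<beta> F x}"
      by (auto simp: fibers_def)
    define f where "f = (\<lambda>p\<in>P ` F. THE q. q \<in> p \<and> x \<in> q)"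
    have fs: "f (P s) = act s -` cell \<beta> (act s x) \<inter> S" if s: "s \<in> F" for s
    proof -
      have "(THE q. q \<in> P s \<and> x \<in> q) = act s -` cell \<beta> (act s x) \<inter> S"
      proof (rule the_equality)
        show "act s -` cell \<beta> (act s x) \<inter> S \<in> P s \<and> x \<in> act s -` cell \<beta> (act s x) \<inter> S"
          using in_P[OF s x] cell_in(2)[OF \<beta> act[OF s x]] x by simp
        show "q = act s -` cell \<beta> (act s x) \<inter> S" if "q \<in> P s \<and> x \<in> q" for q
          using mem[OF s, of q x] that by blast
      qed
      thus ?thesis using s by (simp add: f_def)
    qed
    have "f \<in> (\<Pi>\<^sub>E p\<in>P ` F. p)"
    proof
      fix p assume "p \<in> P ` F"
      then obtain s where "s \<in> F" "p = P s" by blast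
      thus "f p \<in> p" using fs in_P x by simp
    qed (auto simp: f_def)
    moreover have "A = \<Inter> (f ` (P ` F))" unfolding A fib[OF x] using fs by (simp add: image_image)
    moreover have "A \<noteq> {}" using A x by auto
    ultimately show "A \<in> common_refinement (P ` F)" unfolding common_refinement_def by blast
  qed
  finally show ?thesis .
qed

lemma ln_real_of_nat_nonneg: "0 \<le> ln (real n)"
  by (cases n) auto

context pmp_action
begin

lemma names_measurable:
  assumes \<beta>: "partition_on (space M) \<beta>" "\<beta> \<subseteq> sets M" and F: "finite F" "F \<subseteq> carrier G"
  shows "{x \<in> space M. names act \<beta> F x = v} \<in> sets M"
proof (cases "v \<in> F \<rightarrow>\<^sub>E \<beta>")
  case False
  have "names act \<beta> F x \<noteq> v" if "x \<in> space M" for x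
    using names_in_PiE[OF \<beta>(1) that, of F act] act_space that F False by blast
  hence "{x \<in> space M. names act \<beta> F x = v} = {}" by blast
  thus ?thesis by (simp only: sets.empty_sets)
next
  case True
  have "names act \<beta> F x = v \<longleftrightarrow> (\<forall>s\<in>F. act s x \<in> v s)" if x: "x \<in> space M" for x
  proof
    assume *: "names act \<beta> F x = v"
    show "\<forall>s\<in>F. act s x \<in> v s"
    proof
      fix s assume s: "s \<in> F"
      have "v s = cell \<beta> (act s x)" using s by (simp add: *[symmetric] names_def)
      thus "act s x \<in> v s" using cell_in(2)[OF \<beta>(1) act_space] s x F by auto
    qed
  next
    assume *: "\<forall>s\<in>F. act s x \<in> v s"
    show "names act \<beta> F x = v"
    proof (rule extensionalityI)
      fix s assume "s \<in> F"
      thus "names act \<beta> F x s = v s" unfolding names_def using True * cell_eq[OF \<beta>(1)]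
        by (auto simp: PiE_iff)
    qed (use True in \<open>auto simp: names_def PiE_iff\<close>)
  qed
  hence "{x \<in> space M. names act \<beta> F x = v} = {x \<in> space M. \<forall>s\<in>F. act s x \<in> v s}" by blast
  also have "\<dots> \<in> sets M"
  proof (rule sets.sets_Collect_finite_All[OF _ F(1)])
    fix s assume s: "s \<in> F"
    hence "act s -` v s \<inter> space M \<in> sets M"
      by (intro measurable_sets[OF act_measurable]) (use F True \<beta> in \<open>auto simp: PiE_iff\<close>)
    moreover have "act s -` v s \<inter> space M = {x \<in> space M. act s x \<in> v s}" by auto
    ultimately show "{x \<in> space M. act s x \<in> v s} \<in> sets M" by simp
  qed
  finally show ?thesis .
qed

text \<open>Here the definite description in \<open>entropy_wrt\<close> is seen to be well defined: the limit exists, is the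
  same along every F{\o}lner sequence, and is the infimum of the normalised entropies.\<close>

lemma entropy_wrt_le_ent_names:
  assumes am: "amenable G" and \<beta>: "finite \<beta>" "partition_on (space M) \<beta>" "\<beta> \<subseteq> sets M"
    and K: "finite K" "K \<noteq> {}" "K \<subseteq> carrier G"
  shows "entropy_wrt G act M \<beta> \<le> ent M (names act \<beta> K) / real (card K)"
proof -
  define h where "h = (\<lambda>F. ent M (names act \<beta> F))"
  have fin: "finite (names act \<beta> F ` space M)" if "finite F" "F \<subseteq> carrier G" for F
  proof (rule finite_subset)
    show "names act \<beta> F ` space M \<subseteq> F \<rightarrow>\<^sub>E \<beta>"
      using names_in_PiE[OF \<beta>(2), of _ F act] act_space that by blast
    show "finite (F \<rightarrow>\<^sub>E \<beta>)" using that \<beta> by (intro finite_PiE) auto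
  qed
  note meas = names_measurable[OF \<beta>(2,3)]
  have sub: "h (insert t F) + h A \<le> h (insert t A) + h F"
    if F: "finite F" "A \<subseteq> F" "t \<in> carrier G - F" "insert t F \<subseteq> carrier G" for A F t
  proof -
    have fA: "finite A" "A \<subseteq> carrier G" and tF: "finite {t}" "{t} \<subseteq> carrier G" "F \<subseteq> carrier G"
      and D: "finite (F - A)" "F - A \<subseteq> carrier G" using F finite_subset by auto
    have "ent M (\<lambda>x. (names act \<beta> {t} x, names act \<beta> (F - A) x, names act \<beta> A x)) + ent M (names act \<beta> A)
        \<le> ent M (\<lambda>x. (names act \<beta> {t} x, names act \<beta> A x)) + ent M (\<lambda>x. (names act \<beta> (F - A) x, names act \<beta> A x))"
      by (rule ent_submodular) (intro fin meas fA tF D)+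
    moreover have "ent M (\<lambda>x. (names act \<beta> {t} x, names act \<beta> (F - A) x, names act \<beta> A x)) = h (insert t F)"
      unfolding h_def by (rule ent_cong) (use F(2) in \<open>auto simp: names_eq_iff\<close>)
    moreover have "ent M (\<lambda>x. (names act \<beta> {t} x, names act \<beta> A x)) = h (insert t A)"
      unfolding h_def by (rule ent_cong) (auto simp: names_eq_iff)
    moreover have "ent M (\<lambda>x. (names act \<beta> (F - A) x, names act \<beta> A x)) = h F"
      unfolding h_def by (rule ent_cong) (use F(2) in \<open>auto simp: names_eq_iff\<close>)
    ultimately show ?thesis by (simp add: h_def)
  qed
  have const: "ent M u = 0" if "\<And>x y. u x = u y" for u :: "'x \<Rightarrow> 'g \<Rightarrow> 'x set"
  proof -
    obtain x where x: "x \<in> space M" using not_empty by blast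
    have "ent M u = (\<Sum>v\<in>{u x}. nlog (measure M {y \<in> space M. u y = v}))"
      by (rule ent_eq_sum) (use that in auto)
    also have "\<dots> = nlog (measure M {y \<in> space M. u y = u x})" by simp
    also have "{y \<in> space M. u y = u x} = space M" using that by blast
    finally show ?thesis by (simp add: nlog_def prob_space)
  qed
  have empty: "h {} = 0" unfolding h_def by (rule const) (simp add: names_eq_iff)
  have mono: "h A \<le> h F" if F: "finite F" "A \<subseteq> F" "F \<subseteq> carrier G" for A F
  proof -
    have fA: "finite A" "A \<subseteq> carrier G" using F finite_subset by auto
    \<comment> \<open>Submodularity with two copies of the same map says that conditional entropy is non-negative.\<close>
    have "ent M (\<lambda>x. (names act \<beta> F x, names act \<beta> F x, names act \<beta> A x)) + ent M (names act \<beta> A)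
        \<le> ent M (\<lambda>x. (names act \<beta> F x, names act \<beta> A x)) + ent M (\<lambda>x. (names act \<beta> F x, names act \<beta> A x))"
      by (rule ent_submodular) (intro fin meas fA F)+
    moreover have "ent M (\<lambda>x. (names act \<beta> F x, names act \<beta> F x, names act \<beta> A x)) = h F"
      unfolding h_def by (rule ent_cong) (use F(2) in \<open>auto simp: names_eq_iff\<close>)
    moreover have "ent M (\<lambda>x. (names act \<beta> F x, names act \<beta> A x)) = h F"
      unfolding h_def by (rule ent_cong) (use F(2) in \<open>auto simp: names_eq_iff\<close>)
    ultimately show ?thesis by (simp add: h_def)
  qed
  have inv: "h ((\<lambda>s. s \<otimes> g) ` F) = h F" if F: "finite F" "F \<subseteq> carrier G" and g: "g \<in> carrier G" for F g
  proof -
    let ?V = "names act \<beta> F ` space M"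
    have "h ((\<lambda>s. s \<otimes> g) ` F) = ent M (\<lambda>x. names act \<beta> F (act g x))"
      unfolding h_def by (rule ent_cong) (use F g in \<open>auto simp: names_eq_iff act_mult subset_iff\<close>)
    also have "\<dots> = (\<Sum>v\<in>?V. nlog (measure M {x \<in> space M. names act \<beta> F (act g x) = v}))"
      by (rule ent_eq_sum) (use fin F g act_space in auto)
    also have "\<dots> = (\<Sum>v\<in>?V. nlog (measure M {x \<in> space M. names act \<beta> F x = v}))"
    proof (intro sum.cong refl arg_cong[where f=nlog])
      fix v
      have "{x \<in> space M. names act \<beta> F (act g x) = v} = act g -` {x \<in> space M. names act \<beta> F x = v} \<inter> space M"
        using act_space g by auto
      thus "measure M {x \<in> space M. names act \<beta> F (act g x) = v} = measure M {x \<in> space M. names act \<beta> F x = v}"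
        using act_invariant[OF g meas[OF F]] by simp
    qed
    also have "\<dots> = h F" unfolding h_def by (rule ent_eq_sum[symmetric]) (use fin F in auto)
    finally show ?thesis .
  qed
  define L where "L = Inf {h K / real (card K) |K. finite K \<and> K \<noteq> {} \<and> K \<subseteq> carrier G}"
  have ow1: "(\<lambda>n. h (F n) / real (card (F n))) \<longlonglongrightarrow> L" if "folner_sequence G F" for F
    unfolding L_def
  proof (rule ornstein_weiss_limit(1)[of h])
    show "h (insert t F) + h A \<le> h (insert t A) + h F"
      if "finite F" "A \<subseteq> F" "t \<in> carrier G - F" "insert t F \<subseteq> carrier G" for A F t
      using that by (rule sub)
    show "h A \<le> h F" if "finite F" "A \<subseteq> F" "F \<subseteq> carrier G" for A F
      using that by (rule mono)
    show "h ((\<lambda>s. s \<otimes> g) ` F) = h F" if "finite F" "F \<subseteq> carrier G" "g \<in> carrier G" for F g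
      using that by (rule inv)
  qed (rule empty, rule that)
  have ow2: "L \<le> h K / real (card K)"
    unfolding L_def
  proof (rule ornstein_weiss_limit(2)[of h])
    show "h (insert t F) + h A \<le> h (insert t A) + h F"
      if "finite F" "A \<subseteq> F" "t \<in> carrier G - F" "insert t F \<subseteq> carrier G" for A F t
      using that by (rule sub)
    show "h A \<le> h F" if "finite F" "A \<subseteq> F" "F \<subseteq> carrier G" for A F
      using that by (rule mono)
    show "h ((\<lambda>s. s \<otimes> g) ` F) = h F" if "finite F" "F \<subseteq> carrier G" "g \<in> carrier G" for F g
      using that by (rule inv)
  qed (rule empty K)+
  have pe: "partition_entropy M (partition_join (space M) act (F n) \<beta>) = h (F n)"
    if F: "folner_sequence G F" for F n
  proof -
    have "partition_join (space M) act (F n) \<beta> = fibers (space M) (names act \<beta> (F n))"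
      by (rule partition_join_eq_fibers[OF \<beta>(2)]) (use F act_space in \<open>auto simp: folner_sequence_def\<close>)
    thus ?thesis by (simp add: h_def ent_def)
  qed
  have "entropy_wrt G act M \<beta> = L" unfolding entropy_wrt_def
  proof (rule the_equality)
    show *: "\<forall>F. folner_sequence G F \<longrightarrow>
        (\<lambda>n. partition_entropy M (partition_join (space M) act (F n) \<beta>) / real (card (F n))) \<longlonglongrightarrow> L"
      using ow1 by (simp add: pe)
    fix l assume l: "\<forall>F. folner_sequence G F \<longrightarrow>
        (\<lambda>n. partition_entropy M (partition_join (space M) act (F n) \<beta>) / real (card (F n))) \<longlonglongrightarrow> l"
    obtain F where F: "folner_sequence G F" using am by (auto simp: amenable_def)
    show "l = L" using LIMSEQ_unique l * F by blast
  qed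
  thus ?thesis using ow2 by (simp add: h_def)
qed

text \<open>If the names of the points of \<open>Z\<close> are few, the entropy is small: the remaining names carry
  mass at most \<open>1 - \<mu>(Z)\<close> and number at most \<open>card \<beta> ^ card F\<close>.\<close>

lemma ent_names_le:
  assumes \<beta>: "finite \<beta>" "partition_on (space M) \<beta>" "\<beta> \<subseteq> sets M"
    and F: "finite F" "F \<subseteq> carrier G" and Z: "Z \<in> sets M"
  shows "ent M (names act \<beta> F) \<le> ln (real (card (names act \<beta> F ` Z))) + 2
      + measure M (space M - Z) * (real (card F) * ln (real (card \<beta>)))"
proof -
  have Zs: "Z \<subseteq> space M" using Z sets.sets_into_space by blast
  let ?n = "names act \<beta> F"
  define V where "V = F \<rightarrow>\<^sub>E \<beta>"
  define I where "I = ?n ` Z"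
  define p where "p = (\<lambda>v. measure M {x \<in> space M. ?n x = v})"
  have V: "finite V" unfolding V_def using F \<beta> by (intro finite_PiE) auto
  have sub: "?n ` space M \<subseteq> V" unfolding V_def
    using names_in_PiE[OF \<beta>(2), of _ F act] act_space F by blast
  have IV: "I \<subseteq> V" using sub Zs by (auto simp: I_def)
  have fI: "finite I" using IV V finite_subset by blast
  note meas = names_measurable[OF \<beta>(2,3) F]
  have pm: "sum p J = measure M {x \<in> space M. ?n x \<in> J}" if "finite J" for J
  proof -
    have "{x \<in> space M. ?n x \<in> J} = (\<Union>v\<in>J. {x \<in> space M. ?n x = v})" by auto
    thus ?thesis unfolding p_def
      by (simp, subst finite_measure_finite_Union[OF that]) (use meas in \<open>auto simp: disjoint_family_on_def\<close>)
  qed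
  have "ent M ?n = (\<Sum>v\<in>V. nlog (p v))" unfolding p_def by (rule ent_eq_sum[OF V sub])
  also have "\<dots> = (\<Sum>v\<in>I. nlog (p v)) + (\<Sum>v\<in>V - I. nlog (p v))"
    using sum.subset_diff[OF IV V, of "\<lambda>v. nlog (p v)"] by linarith
  also have "(\<Sum>v\<in>I. nlog (p v)) \<le> ln (real (card I)) + 1"
  proof -
    have "(\<Sum>v\<in>I. nlog (p v)) \<le> sum p I * ln (real (card I)) + 1"
      by (rule sum_nlog_le[OF fI]) (simp add: p_def)
    also have "sum p I * ln (real (card I)) \<le> 1 * ln (real (card I))"
      by (rule mult_right_mono) (use pm[OF fI] in \<open>auto intro: ln_real_of_nat_nonneg\<close>)
    finally show ?thesis by simp
  qed
  also have "(\<Sum>v\<in>V - I. nlog (p v)) \<le> measure M (space M - Z) * (real (card F) * ln (real (card \<beta>))) + 1"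
  proof -
    have cV: "card V = card \<beta> ^ card F" unfolding V_def using F by (simp add: card_PiE)
    have "(\<Sum>v\<in>V - I. nlog (p v)) \<le> sum p (V - I) * ln (real (card (V - I))) + 1"
      by (rule sum_nlog_le) (use V in \<open>auto simp: p_def\<close>)
    also have "sum p (V - I) * ln (real (card (V - I))) \<le> measure M (space M - Z) * (real (card F) * ln (real (card \<beta>)))"
    proof (rule mult_mono)
      have "sum p (V - I) = measure M {x \<in> space M. ?n x \<in> V - I}" using pm V by simp
      also have "\<dots> \<le> measure M (space M - Z)"
        by (rule finite_measure_mono) (use Z in \<open>auto simp: I_def\<close>)
      finally show "sum p (V - I) \<le> measure M (space M - Z)" .
      have "ln (real (card (V - I))) \<le> ln (real (card V))"
        using card_mono[OF V, of "V - I"] by (cases "card (V - I) = 0") (auto intro: ln_real_of_nat_nonneg)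
      also have "\<dots> = real (card F) * ln (real (card \<beta>))" unfolding cV of_nat_power
        by (cases "card \<beta> = 0") (auto simp: ln_realpow power_0_left)
      finally show "ln (real (card (V - I))) \<le> real (card F) * ln (real (card \<beta>))" .
    qed (auto intro: ln_real_of_nat_nonneg)
    finally show ?thesis by simp
  qed
  finally show ?thesis by (simp add: I_def)
qed

end

section \<open>Counting sparse configurations\<close>

text \<open>Maps from \<open>F\<close> to \<open>V\<close> that are defined at a proportion of at most \<open>\<alpha>\<close> of the sites; \<open>None\<close> marks the
  other sites.\<close>

definition sparse_maps :: "'g set \<Rightarrow> 'v set \<Rightarrow> real \<Rightarrow> ('g \<Rightarrow> 'v option) set" where
  "sparse_maps F V \<alpha> = {w \<in> F \<rightarrow>\<^sub>E insert None (Some ` V). real (card {s \<in> F. w s \<noteq> None}) \<le> \<alpha> * real (card F)}"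

lemma finite_sparse_maps: "finite F \<Longrightarrow> finite V \<Longrightarrow> finite (sparse_maps F V \<alpha>)"
  unfolding sparse_maps_def by (rule finite_subset[of _ "F \<rightarrow>\<^sub>E insert None (Some ` V)"]) (auto intro: finite_PiE)

text \<open>A proportion small enough that the sparse maps with at most \<open>q\<close> values number at most
  \<open>exp (\<eta> card F)\<close>. With \<open>t\<close> as in the definition both \<open>q t\<close> and \<open>sparse_rate q \<eta> * ln (1 / t)\<close> are at most
  \<open>\<eta> / 2\<close>.\<close>

definition sparse_rate :: "nat \<Rightarrow> real \<Rightarrow> real" where
  "sparse_rate q \<eta> = (let t = min 1 (\<eta> / (2 * (real q + 1))) in \<eta> / (2 * (ln (1 / t) + 1)))"

lemma sparse_rate_pos: "0 < \<eta> \<Longrightarrow> 0 < sparse_rate q \<eta>"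
  unfolding sparse_rate_def Let_def
  by (intro divide_pos_pos mult_pos_pos add_nonneg_pos ln_ge_zero) auto

text \<open>Weighting each occupied site by \<open>t\<close>, the total weight of all maps is \<open>(1 + q t) ^ card F\<close>,
  while every sparse map has weight at least \<open>t powr (\<alpha> * card F)\<close>.\<close>

lemma card_sparse_maps_le:
  fixes F :: "'g set" and V :: "'v set"
  assumes \<eta>: "0 < \<eta>" and F: "finite F" and V: "finite V" and q: "card V \<le> q" and \<alpha>: "\<alpha> \<le> sparse_rate q \<eta>"
  shows "real (card (sparse_maps F V \<alpha>)) \<le> exp (\<eta> * real (card F))"
proof -
  define t where "t = min 1 (\<eta> / (2 * (real q + 1)))"
  have t: "0 < t" "t \<le> 1" using \<eta> by (auto simp: t_def)
  have rate: "sparse_rate q \<eta> = \<eta> / (2 * (ln (1 / t) + 1))" by (simp add: sparse_rate_def t_def Let_def)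
  have lt: "0 \<le> ln (1 / t)" using t by (intro ln_ge_zero) auto
  have \<alpha>lt: "\<alpha> * ln (1 / t) \<le> \<eta> / 2"
  proof -
    have "\<alpha> * ln (1 / t) \<le> sparse_rate q \<eta> * (ln (1 / t) + 1)"
      using \<alpha> lt sparse_rate_pos[OF \<eta>, of q] by (intro mult_mono) auto
    also have "\<dots> = \<eta> / 2" unfolding rate using lt by (simp add: field_simps)
    finally show ?thesis .
  qed
  have qt: "real q * t \<le> \<eta> / 2"
  proof -
    have "real q * t \<le> (real q + 1) * (\<eta> / (2 * (real q + 1)))"
      by (rule mult_mono) (use t in \<open>auto simp: t_def\<close>)
    also have "\<dots> = \<eta> / 2" by (simp add: field_simps)
    finally show ?thesis .
  qed
  define n where "n = real (card F)"
  define wt :: "'v option \<Rightarrow> real" where "wt = (\<lambda>v. if v = None then 1 else t)"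
  let ?V = "insert None (Some ` V)"
  have wt0: "0 \<le> wt v" for v using t by (simp add: wt_def)
  have low: "t powr (\<alpha> * n) \<le> (\<Prod>s\<in>F. wt (w s))" if "w \<in> sparse_maps F V \<alpha>" for w
  proof -
    have "(\<Prod>s\<in>F. wt (w s)) = t ^ card {s \<in> F. w s \<noteq> None}"
      unfolding wt_def using F by (simp add: prod.If_cases Int_def)
    also have "\<dots> = t powr real (card {s \<in> F. w s \<noteq> None})" using t by (simp add: powr_realpow)
    also have "\<dots> \<ge> t powr (\<alpha> * n)"
      using that t by (intro powr_mono') (auto simp: sparse_maps_def n_def)
    finally show ?thesis .
  qed
  have "real (card (sparse_maps F V \<alpha>)) * t powr (\<alpha> * n) = (\<Sum>w\<in>sparse_maps F V \<alpha>. t powr (\<alpha> * n))" by simp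
  also have "\<dots> \<le> (\<Sum>w\<in>sparse_maps F V \<alpha>. \<Prod>s\<in>F. wt (w s))" by (rule sum_mono[OF low])
  also have "\<dots> \<le> (\<Sum>w\<in>F \<rightarrow>\<^sub>E ?V. \<Prod>s\<in>F. wt (w s))"
    by (rule sum_mono2) (use F V wt0 in \<open>auto simp: sparse_maps_def intro!: finite_PiE prod_nonneg\<close>)
  also have "\<dots> = (\<Prod>s\<in>F. \<Sum>v\<in>?V. wt v)"
    using F V by (subst prod_sum_PiE) auto
  also have "\<dots> = (1 + real (card V) * t) ^ card F"
  proof -
    have "(\<Sum>v\<in>?V. wt v) = wt None + (\<Sum>v\<in>Some ` V. wt v)" using V by (subst sum.insert) auto
    also have "(\<Sum>v\<in>Some ` V. wt v) = real (card V) * t" by (subst sum.reindex) (auto simp: wt_def)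
    finally show ?thesis by (simp add: wt_def)
  qed
  also have "\<dots> \<le> exp (real (card V) * t) ^ card F"
    using t by (intro power_mono exp_ge_add_one_self) auto
  also have "\<dots> \<le> exp (real q * t) ^ card F"
    using t q by (intro power_mono) (auto intro: mult_right_mono)
  also have "\<dots> = exp (real q * t * n)" by (simp add: n_def exp_of_nat2_mult)
  finally have *: "real (card (sparse_maps F V \<alpha>)) * t powr (\<alpha> * n) \<le> exp (real q * t * n)" .
  have "t powr (\<alpha> * n) * exp (\<alpha> * ln (1 / t) * n) = 1"
    using t by (simp add: powr_def ln_div exp_add[symmetric])
  hence "real (card (sparse_maps F V \<alpha>)) =
      real (card (sparse_maps F V \<alpha>)) * t powr (\<alpha> * n) * exp (\<alpha> * ln (1 / t) * n)"
    by (simp add: mult.assoc)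
  also have "\<dots> \<le> exp (real q * t * n) * exp (\<alpha> * ln (1 / t) * n)"
    by (rule mult_right_mono[OF *]) simp
  also have "\<dots> = exp ((real q * t + \<alpha> * ln (1 / t)) * n)" by (simp add: exp_add[symmetric] algebra_simps)
  also have "\<dots> \<le> exp (\<eta> * n)"
    using qt \<alpha>lt by (auto simp: n_def intro!: mult_right_mono)
  finally show ?thesis by (simp add: n_def)
qed

section \<open>Uniform separation for expansive actions\<close>

text \<open>Markov's inequality for the number of visits to the complement of \<open>U\<close>.\<close>

lemma (in pmp_action) measure_many_visits:
  assumes U: "U \<in> sets M" "measure M (space M - U) \<le> \<kappa>" and F: "finite F" "F \<noteq> {}" "F \<subseteq> carrier G"
    and \<alpha>: "0 < \<alpha>"
  shows "\<exists>D\<in>sets M. measure M D \<le> \<kappa> / \<alpha> \<and>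
    (\<forall>x\<in>space M - D. real (card {s \<in> F. act s x \<notin> U}) \<le> \<alpha> * real (card F))"
proof -
  have c: "0 < real (card F)" using F by (simp add: card_gt_0_iff)
  define u where "u = (\<lambda>x. \<Sum>s\<in>F. indicator (space M - U) (act s x) :: real)"
  have im: "(indicator (space M - U) :: 'x \<Rightarrow> real) \<in> borel_measurable M" using U by simp
  have m: "(\<lambda>x. indicator (space M - U) (act s x) :: real) \<in> borel_measurable M" if "s \<in> F" for s
    by (rule measurable_comp_act[OF _ im]) (use that F in auto)
  have i: "integrable M (\<lambda>x. indicator (space M - U) (act s x) :: real)" if "s \<in> F" for s
    by (rule integrable_bounded[where B=1]) (use m that in \<open>auto simp: indicator_def\<close>)
  have ui: "integrable M u" unfolding u_def using i by simp
  have "(\<integral>x. u x \<partial>M) = (\<Sum>s\<in>F. \<integral>x. indicator (space M - U) (act s x) \<partial>M)"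
    unfolding u_def using i by simp
  also have "\<dots> = (\<Sum>s\<in>F. \<integral>x. indicator (space M - U) x \<partial>M)"
    by (intro sum.cong refl integral_act im) (use F in auto)
  also have "\<dots> = real (card F) * measure M (space M - U)" using U by simp
  finally have int: "(\<integral>x. u x \<partial>M) \<le> real (card F) * \<kappa>" using U c by simp
  define D where "D = {x \<in> space M. \<alpha> * real (card F) \<le> u x}"
  have um: "u \<in> borel_measurable M" using ui by simp
  have D: "D \<in> sets M" unfolding D_def using um by measurable
  have "measure M D \<le> (\<integral>x. u x \<partial>M) / (\<alpha> * real (card F))" unfolding D_def
    by (rule integral_Markov_inequality_measure[where A="space M", OF ui])
       (use \<alpha> c in \<open>auto simp: u_def intro!: sum_nonneg\<close>)
  also have "\<dots> \<le> real (card F) * \<kappa> / (\<alpha> * real (card F))"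
    by (rule divide_right_mono[OF int]) (use \<alpha> in simp)
  also have "\<dots> = \<kappa> / \<alpha>" using c by simp
  finally have mD: "measure M D \<le> \<kappa> / \<alpha>" .
  have "real (card {s \<in> F. act s x \<notin> U}) \<le> \<alpha> * real (card F)" if x: "x \<in> space M - D" for x
  proof -
    have "u x = (\<Sum>s\<in>F. if act s x \<notin> U then 1 else 0)" unfolding u_def
      by (intro sum.cong refl) (use x F act_space in \<open>auto simp: indicator_def subset_iff\<close>)
    also have "\<dots> = real (card {s \<in> F. act s x \<notin> U})" using F by (simp add: sum.If_cases Int_def)
    finally show ?thesis using x by (auto simp: D_def)
  qed
  thus ?thesis using D mD by blast
qed

text \<open>A continuous action of a countable group on a compact metric space.\<close>

locale compact_metric_action = group G + Metric_space M d
  for G :: "('g, 'b) monoid_scheme" (structure) and M :: "'x set" and d :: "'x \<Rightarrow> 'x \<Rightarrow> real" +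
  fixes act :: "'g \<Rightarrow> 'x \<Rightarrow> 'x"
  assumes countable_carrier: "countable (carrier G)"
    and compact_mtopology: "compact_space mtopology"
    and act_continuous: "s \<in> carrier G \<Longrightarrow> continuous_map mtopology mtopology (act s)"
    and act_one': "x \<in> M \<Longrightarrow> act \<one> x = x"
    and act_mult': "x \<in> M \<Longrightarrow> s \<in> carrier G \<Longrightarrow> t \<in> carrier G \<Longrightarrow> act (s \<otimes> t) x = act s (act t x)"
begin

lemma act_in: "s \<in> carrier G \<Longrightarrow> x \<in> M \<Longrightarrow> act s x \<in> M"
  using act_continuous[of s] by (auto simp: continuous_map_def)

lemma finite_net:
  assumes "0 < e"
  obtains Q where "finite Q" "Q \<subseteq> M" "\<And>x. x \<in> M \<Longrightarrow> \<exists>q\<in>Q. d x q < e"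
proof -
  have "mtotally_bounded M"
    using compactin_imp_mtotally_bounded[of M] compact_mtopology by (simp add: compact_space_def)
  hence "\<exists>Q. finite Q \<and> Q \<subseteq> M \<and> M \<subseteq> (\<Union>q\<in>Q. mball q e)"
    using assms by (simp add: mtotally_bounded_def)
  then obtain Q where Q: "finite Q" "Q \<subseteq> M" "M \<subseteq> (\<Union>q\<in>Q. mball q e)" by (elim exE conjE)
  have "\<exists>q\<in>Q. d x q < e" if x: "x \<in> M" for x
  proof -
    obtain q where "q \<in> Q" "x \<in> mball q e" using x Q(3) by blast
    thus ?thesis by (auto simp: commute[of x])
  qed
  thus thesis using that[OF Q(1,2)] by simp
qed

lemma pmp_action_of_ergodic:
  assumes "\<mu> \<in> ergodic_measures G mtopology act"
  shows "pmp_action G \<mu> act" "sets \<mu> = sets (borel_of mtopology)" "space \<mu> = M"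
    "\<And>A. A \<in> sets \<mu> \<Longrightarrow> (\<And>s. s \<in> carrier G \<Longrightarrow> act s -` A \<inter> space \<mu> = A) \<Longrightarrow>
        measure \<mu> A = 0 \<or> measure \<mu> A = 1"
proof -
  have p: "prob_space \<mu>" and s: "sets \<mu> = sets (borel_of mtopology)"
    using assms by (auto simp: ergodic_measures_def borel_prob_measures_def)
  show "sets \<mu> = sets (borel_of mtopology)" by (rule s)
  have sp: "space \<mu> = M" using sets_eq_imp_space_eq[OF s] by simp
  thus "space \<mu> = M" .
  show "\<And>A. A \<in> sets \<mu> \<Longrightarrow> (\<And>s. s \<in> carrier G \<Longrightarrow> act s -` A \<inter> space \<mu> = A) \<Longrightarrow>
        measure \<mu> A = 0 \<or> measure \<mu> A = 1"
    using assms by (auto simp: ergodic_measures_def)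
  interpret prob_space \<mu> by (rule p)
  show "pmp_action G \<mu> act"
  proof unfold_locales
    fix s assume "s \<in> carrier G"
    thus "act s \<in> measurable \<mu> \<mu>"
      using continuous_map_measurable[OF act_continuous] measurable_cong_sets[OF s s] by blast
  qed (use assms sp countable_carrier act_one' act_mult' in \<open>auto simp: ergodic_measures_def\<close>)
qed

text \<open>Inner regularity of finite Borel measures. The sets that can be approximated from inside by closed
  and from outside by open sets form a \<open>\<sigma>\<close>-algebra, and open sets are increasing unions of closed
  ones.\<close>

lemma closed_inner_regular:
  assumes \<mu>: "finite_measure \<mu>" "sets \<mu> = sets (borel_of mtopology)" and A: "A \<in> sets \<mu>" and e: "0 < e"
  shows "\<exists>C. closedin mtopology C \<and> C \<subseteq> A \<and> measure \<mu> (A - C) < e"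
proof -
  interpret finite_measure \<mu> by (rule \<mu>)
  have op: "openin mtopology U \<Longrightarrow> U \<in> sets \<mu>" for U using openin_borel_of \<mu>(2) by blast
  have sp: "space \<mu> = M" using sets_eq_imp_space_eq[OF \<mu>(2)] by simp
  have cl: "closedin mtopology C \<Longrightarrow> C \<in> sets \<mu>" for C
  proof -
    assume C: "closedin mtopology C"
    hence "M - C \<in> sets \<mu>" by (intro op) (simp add: closedin_def)
    hence "space \<mu> - (M - C) \<in> sets \<mu>" by (rule sets.compl_sets)
    moreover have "space \<mu> - (M - C) = C" using sp closedin_subset[OF C] by auto
    ultimately show "C \<in> sets \<mu>" by simp
  qed
  have "A \<in> sigma_sets M {U. openin mtopology U}" using A \<mu>(2) by (simp add: sets_borel_of)
  hence "\<forall>e>0. \<exists>C U. closedin mtopology C \<and> openin mtopology U \<and> C \<subseteq> A \<and> A \<subseteq> U \<and> measure \<mu> (U - C) < e"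
  proof induction
    case (Basic U)
    hence U: "openin mtopology U" by simp
    show ?case
    proof (intro allI impI)
      fix e :: real assume e: "0 < e"
      have "fsigma_in mtopology U" by (rule open_imp_fsigma_in[OF metrizable_space_mtopology U])
      then obtain C where C: "\<And>n. closedin mtopology (C n)" "\<And>n. C n \<subseteq> C (Suc n)" "\<Union>(range C) = U"
        unfolding fsigma_in_ascending by blast
      have "incseq C" using C(2) by (rule incseq_SucI)
      hence "(\<lambda>n. measure \<mu> (C n)) \<longlonglongrightarrow> measure \<mu> U"
        using finite_Lim_measure_incseq[of C] C cl by auto
      hence "eventually (\<lambda>n. measure \<mu> U - e < measure \<mu> (C n)) sequentially"
        by (rule order_tendstoD) (use e in simp)
      then obtain n where n: "measure \<mu> U - e < measure \<mu> (C n)" by (auto simp: eventually_sequentially)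
      have "measure \<mu> (U - C n) = measure \<mu> U - measure \<mu> (C n)"
        by (rule finite_measure_Diff) (use op[OF U] cl C in auto)
      thus "\<exists>C V. closedin mtopology C \<and> openin mtopology V \<and> C \<subseteq> U \<and> U \<subseteq> V \<and> measure \<mu> (V - C) < e"
        using C n U by (intro exI[of _ "C n"] exI[of _ U]) auto
    qed
  next
    case Empty
    show ?case by (intro allI impI exI[of _ "{}"]) simp
  next
    case (Compl A)
    show ?case
    proof (intro allI impI)
      fix e :: real assume "0 < e"
      then obtain C U where CU: "closedin mtopology C" "openin mtopology U" "C \<subseteq> A" "A \<subseteq> U" "measure \<mu> (U - C) < e"
        using Compl.IH[rule_format, OF \<open>0 < e\<close>] by (elim exE conjE)
      have "(M - C) - (M - U) = U - C" using openin_subset[OF CU(2)] by auto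
      moreover have "closedin mtopology (M - U)" using CU(2) by (simp add: openin_closedin_eq)
      moreover have "openin mtopology (M - C)" using CU(1) by (simp add: closedin_def)
      moreover have "M - U \<subseteq> M - A" "M - A \<subseteq> M - C" using CU(3,4) by blast+
      ultimately show "\<exists>C U. closedin mtopology C \<and> openin mtopology U \<and> C \<subseteq> M - A \<and> M - A \<subseteq> U \<and> measure \<mu> (U - C) < e"
        using CU(5) by (intro exI[of _ "M - U"] exI[of _ "M - C"]) simp
    qed
  next
    case (Union A)
    show ?case
    proof (intro allI impI)
      fix e :: real assume e: "0 < e"
      have "\<exists>C U. closedin mtopology C \<and> openin mtopology U \<and> C \<subseteq> A n \<and> A n \<subseteq> U \<and> measure \<mu> (U - C) < e / 2 * (1/2) ^ Suc n" for n
        by (rule Union.IH[of n, rule_format]) (use e in simp)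
      then obtain C U where CU: "\<And>n. closedin mtopology (C n)" "\<And>n. openin mtopology (U n)" "\<And>n. C n \<subseteq> A n"
          "\<And>n. A n \<subseteq> U n" "\<And>n. measure \<mu> (U n - C n) < e / 2 * (1/2) ^ Suc n" by metis
      have [measurable]: "C n \<in> sets \<mu>" "U n \<in> sets \<mu>" for n using CU op cl by auto
      define C' where "C' = (\<lambda>n. \<Union>i<n. C i)"
      have C'm: "C' n \<in> sets \<mu>" for n unfolding C'_def by measurable
      have "incseq C'" unfolding C'_def by (intro incseq_SucI UN_mono) auto
      moreover have "\<Union>(range C') = (\<Union>n. C n)" unfolding C'_def by auto
      ultimately have "(\<lambda>n. measure \<mu> (C' n)) \<longlonglongrightarrow> measure \<mu> (\<Union>n. C n)"
        using finite_Lim_measure_incseq[of C'] C'm by auto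
      hence "eventually (\<lambda>n. measure \<mu> (\<Union>n. C n) - e / 2 < measure \<mu> (C' n)) sequentially"
        by (rule order_tendstoD) (use e in simp)
      then obtain N where N: "measure \<mu> (\<Union>n. C n) - e / 2 < measure \<mu> (C' N)" by (auto simp: eventually_sequentially)
      have sums: "(\<lambda>n. e / 2 * (1/2) ^ Suc n) sums (e / 2 * 1)"
        by (intro sums_mult power_half_series)
      have sm: "summable (\<lambda>n. measure \<mu> (U n - C n))"
        by (rule summable_comparison_test[OF _ sums_summable[OF sums]]) (use CU(5) in \<open>auto intro!: exI[of _ 0] less_imp_le\<close>)
      have "measure \<mu> (\<Union>n. U n - C n) \<le> suminf (\<lambda>n. measure \<mu> (U n - C n))"
        by (rule finite_measure_subadditive_countably) (use sm in auto)
      also have "\<dots> \<le> suminf (\<lambda>n. e / 2 * (1/2) ^ Suc n)"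
        by (rule suminf_le[OF _ sm sums_summable[OF sums]]) (use CU(5) in \<open>auto intro: less_imp_le\<close>)
      also have "\<dots> = e / 2" using sums by (simp add: sums_iff)
      finally have 1: "measure \<mu> (\<Union>n. U n - C n) \<le> e / 2" .
      have 2: "measure \<mu> ((\<Union>n. C n) - C' N) < e / 2"
      proof -
        have "measure \<mu> ((\<Union>n. C n) - C' N) = measure \<mu> (\<Union>n. C n) - measure \<mu> (C' N)"
          by (rule finite_measure_Diff) (use C'm in \<open>auto simp: C'_def\<close>)
        thus ?thesis using N by simp
      qed
      have "measure \<mu> ((\<Union>n. U n) - C' N) \<le> measure \<mu> ((\<Union>n. U n - C n) \<union> ((\<Union>n. C n) - C' N))"
        by (rule finite_measure_mono) (use C'm in auto)
      also have "\<dots> \<le> measure \<mu> (\<Union>n. U n - C n) + measure \<mu> ((\<Union>n. C n) - C' N)"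
        by (rule measure_Un_le) (use C'm in auto)
      also have "\<dots> < e" using 1 2 by simp
      finally have 3: "measure \<mu> ((\<Union>n. U n) - C' N) < e" .
      have "closedin mtopology (C' N)" unfolding C'_def by (rule closedin_Union) (use CU in auto)
      moreover have "openin mtopology (\<Union>n. U n)" using CU by (intro openin_Union) auto
      moreover have "C' N \<subseteq> (\<Union>n. A n)" unfolding C'_def using CU(3) by auto
      moreover have "(\<Union>n. A n) \<subseteq> (\<Union>n. U n)" using CU(4) by auto
      ultimately show "\<exists>C U. closedin mtopology C \<and> openin mtopology U \<and> C \<subseteq> (\<Union>n. A n) \<and> (\<Union>n. A n) \<subseteq> U \<and> measure \<mu> (U - C) < e"
        using 3 by blast
    qed
  qed
  then obtain C U where CU: "closedin mtopology C" "openin mtopology U" "C \<subseteq> A" "A \<subseteq> U" "measure \<mu> (U - C) < e"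
    using e by (elim allE[of _ e] impE exE conjE)
  have "measure \<mu> (A - C) \<le> measure \<mu> (U - C)"
    by (rule finite_measure_mono) (use CU(4) op[OF CU(2)] cl[OF CU(1)] in auto)
  thus ?thesis using CU(1,3,5) by (intro exI[of _ C]) simp
qed

lemma disjoint_closed_sets_apart:
  assumes \<beta>: "finite \<beta>" and cl: "\<And>B. B \<in> \<beta> \<Longrightarrow> closedin mtopology (C B)"
    and disj: "\<And>B B'. B \<in> \<beta> \<Longrightarrow> B' \<in> \<beta> \<Longrightarrow> B \<noteq> B' \<Longrightarrow> C B \<inter> C B' = {}"
  shows "\<exists>e>0. \<forall>B\<in>\<beta>. \<forall>B'\<in>\<beta>. \<forall>x\<in>C B. \<forall>y\<in>C B'. d x y \<le> e \<longrightarrow> B = B'"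
proof (cases "\<beta> = {}")
  case True
  thus ?thesis by (auto intro: exI[of _ 1])
next
  case False
  define U where "U = (\<lambda>B. M - (\<Union>B'\<in>\<beta> - {B}. C B'))"
  have "openin mtopology (U B)" if "B \<in> \<beta>" for B
  proof -
    have "closedin mtopology (\<Union>B'\<in>\<beta> - {B}. C B')" by (rule closedin_Union) (use \<beta> cl in auto)
    thus ?thesis by (simp add: U_def closedin_def)
  qed
  moreover have "M \<subseteq> \<Union>(U ` \<beta>)"
  proof
    fix x assume x: "x \<in> M"
    show "x \<in> \<Union>(U ` \<beta>)"
    proof (cases "\<exists>B\<in>\<beta>. x \<in> C B")
      case True
      then obtain B where "B \<in> \<beta>" "x \<in> C B" by blast
      hence "x \<in> U B" using disj x by (auto simp: U_def)
      thus ?thesis using \<open>B \<in> \<beta>\<close> by blast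
    next
      case False
      thus ?thesis using \<open>\<beta> \<noteq> {}\<close> x by (auto simp: U_def)
    qed
  qed
  ultimately obtain e where e: "0 < e" "\<forall>x\<in>M. \<exists>V\<in>U ` \<beta>. mball x e \<subseteq> V"
    using lebesgue_number[of M "U ` \<beta>"] compact_mtopology by (auto simp: compact_space_def)
  show ?thesis
  proof (intro exI[of _ "e / 2"] conjI ballI impI)
    fix B B' x y assume B: "B \<in> \<beta>" "B' \<in> \<beta>" "x \<in> C B" "y \<in> C B'" and xy: "d x y \<le> e / 2"
    have xM: "x \<in> M" "y \<in> M" using B cl closedin_subset by fastforce+
    then obtain V where V: "V \<in> \<beta>" "mball x e \<subseteq> U V" using e by blast
    have "x \<in> U V" "y \<in> U V" using V xM xy e by auto
    hence "B = V" "B' = V" using B by (auto simp: U_def)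
    thus "B = B'" by simp
  qed (use e in simp)
qed

text \<open>The number of names of the points of \<open>Z\<close>. A point \<open>y\<close> of \<open>Z\<close> is described by a nearby point
  of the separated set \<open>A\<close>, the exceptional times with the net points that \<open>y\<close> visits then, its
  cells at the boundary times of \<open>F\<close>, and its cells when it is outside the closed pieces \<open>C B\<close>.
  Two points with the same description stay \<open>e0\<close>-close along \<open>F\<close>, hence \<open>e'\<close>-close along the
  \<open>W\<close>-interior of \<open>F\<close>, so they have the same name.\<close>

lemma card_names_le:
  assumes \<beta>: "finite \<beta>" "partition_on M \<beta>" and F: "finite F" "F \<subseteq> carrier G"
    and Z: "Z \<subseteq> M" and A: "finite A" "A \<subseteq> M" and Q: "finite Q" "Q \<subseteq> M"
    and net: "\<And>x. x \<in> M \<Longrightarrow> \<exists>q\<in>Q. d x q < e0 / 2"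
    and W: "W \<subseteq> carrier G"
    and expansive: "\<And>x y. x \<in> M \<Longrightarrow> y \<in> M \<Longrightarrow> (\<And>s. s \<in> W \<Longrightarrow> d (act s x) (act s y) \<le> e0) \<Longrightarrow> d x y \<le> e'"
    and near: "\<And>y. y \<in> Z \<Longrightarrow> \<exists>x\<in>A. real (card {s \<in> F. d (act s x) (act s y) > e0 / 2}) \<le> \<delta> * real (card F)"
    and visits: "\<And>y. y \<in> Z \<Longrightarrow> real (card {s \<in> F. act s y \<notin> (\<Union>B\<in>\<beta>. C B)}) \<le> \<alpha> * real (card F)"
    and CB: "\<And>B. B \<in> \<beta> \<Longrightarrow> C B \<subseteq> B"
    and apart: "\<And>B B' x y. B \<in> \<beta> \<Longrightarrow> B' \<in> \<beta> \<Longrightarrow> x \<in> C B \<Longrightarrow> y \<in> C B' \<Longrightarrow> d x y \<le> e' \<Longrightarrow> B = B'"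
  shows "card (names act \<beta> F ` Z) \<le> card A * card (sparse_maps F Q \<delta>)
     * card \<beta> ^ card {s \<in> F. \<exists>w\<in>W. w \<otimes> s \<notin> F} * card (sparse_maps F \<beta> \<alpha>)"
proof -
  define bd where "bd = {s \<in> F. \<exists>w\<in>W. w \<otimes> s \<notin> F}"
  define q where "q = (\<lambda>x. SOME q. q \<in> Q \<and> d x q < e0 / 2)"
  have q: "q x \<in> Q" "d x (q x) < e0 / 2" if "x \<in> M" for x
  proof -
    have "\<exists>q. q \<in> Q \<and> d x q < e0 / 2" using net[OF that] by blast
    hence "q x \<in> Q \<and> d x (q x) < e0 / 2" unfolding q_def by (rule someI_ex)
    thus "q x \<in> Q" "d x (q x) < e0 / 2" by auto
  qed
  define a where "a = (\<lambda>y. SOME x. x \<in> A \<and> real (card {s \<in> F. d (act s x) (act s y) > e0 / 2}) \<le> \<delta> * real (card F))"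
  have a: "a y \<in> A" "real (card {s \<in> F. d (act s (a y)) (act s y) > e0 / 2}) \<le> \<delta> * real (card F)" if "y \<in> Z" for y
  proof -
    have "\<exists>x. x \<in> A \<and> real (card {s \<in> F. d (act s x) (act s y) > e0 / 2}) \<le> \<delta> * real (card F)"
      using near[OF that] by blast
    hence "a y \<in> A \<and> real (card {s \<in> F. d (act s (a y)) (act s y) > e0 / 2}) \<le> \<delta> * real (card F)"
      unfolding a_def by (rule someI_ex)
    thus "a y \<in> A" "real (card {s \<in> F. d (act s (a y)) (act s y) > e0 / 2}) \<le> \<delta> * real (card F)" by auto
  qed
  define w1 where "w1 = (\<lambda>y. \<lambda>s\<in>F. if d (act s (a y)) (act s y) > e0 / 2 then Some (q (act s y)) else None)"
  define w2 where "w2 = (\<lambda>y. \<lambda>s\<in>bd. cell \<beta> (act s y))"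
  define w3 where "w3 = (\<lambda>y. \<lambda>s\<in>F. if act s y \<notin> (\<Union>B\<in>\<beta>. C B) then Some (cell \<beta> (act s y)) else None)"
  define code where "code = (\<lambda>y. (a y, w1 y, w2 y, w3 y))"
  have inM: "act s y \<in> M" if "s \<in> F" "y \<in> M" for s y using that F act_in by auto
  have determines: "names act \<beta> F y = names act \<beta> F y'" if y: "y \<in> Z" "y' \<in> Z" and eq: "code y = code y'" for y y'
    unfolding names_eq_iff
  proof
    have yM: "y \<in> M" "y' \<in> M" using y Z by auto
    have aM: "a y \<in> M" using a(1)[OF y(1)] A by auto
    have ea: "a y = a y'" and e1: "w1 y = w1 y'" and e2: "w2 y = w2 y'" and e3: "w3 y = w3 y'"
      using eq by (auto simp: code_def)
    have close: "d (act s y) (act s y') \<le> e0" if s: "s \<in> F" for s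
    proof -
      have m: "act s y \<in> M" "act s y' \<in> M" "act s (a y) \<in> M" using inM s yM aM by auto
      have w: "w1 y s = w1 y' s" using e1 by simp
      show ?thesis
      proof (cases "d (act s (a y)) (act s y) > e0 / 2")
        case True
        hence "w1 y s = Some (q (act s y))" using s by (simp add: w1_def)
        moreover from this w have "w1 y' s = Some (q (act s y'))" using s by (auto simp: w1_def split: if_splits)
        ultimately have qq: "q (act s y) = q (act s y')" using w by simp
        have "d (act s y) (act s y') \<le> d (act s y) (q (act s y)) + d (q (act s y)) (act s y')"
          by (rule triangle) (use m q(1) Q in auto)
        also have "\<dots> \<le> e0" using q(2)[OF m(1)] q(2)[OF m(2)] qq by (simp add: commute)
        finally show ?thesis .
      next
        case False
        hence "w1 y s = None" using s by (simp add: w1_def)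
        hence "\<not> d (act s (a y)) (act s y') > e0 / 2" using w s ea by (auto simp: w1_def split: if_splits)
        moreover have "d (act s y) (act s y') \<le> d (act s y) (act s (a y)) + d (act s (a y)) (act s y')"
          by (rule triangle) (use m in auto)
        ultimately show ?thesis using False by (simp add: commute)
      qed
    qed
    fix s assume s: "s \<in> F"
    have m: "act s y \<in> M" "act s y' \<in> M" using inM s yM by auto
    show "cell \<beta> (act s y) = cell \<beta> (act s y')"
    proof (cases "s \<in> bd")
      case True
      thus ?thesis using fun_cong[OF e2, of s] by (simp add: w2_def)
    next
      case False
      have w: "w3 y s = w3 y' s" using e3 by simp
      show ?thesis
      proof (cases "act s y \<in> (\<Union>B\<in>\<beta>. C B)")
        case True
        hence "w3 y s = None" using s by (simp add: w3_def)
        hence "act s y' \<in> (\<Union>B\<in>\<beta>. C B)" using w s by (auto simp: w3_def split: if_splits)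
        then obtain B' where B': "B' \<in> \<beta>" "act s y' \<in> C B'" by blast
        obtain B where B: "B \<in> \<beta>" "act s y \<in> C B" using True by blast
        have "d (act s y) (act s y') \<le> e'"
        proof (rule expansive[OF m])
          fix w assume w: "w \<in> W"
          hence "w \<otimes> s \<in> F" using False s by (auto simp: bd_def)
          moreover have "w \<in> carrier G" "s \<in> carrier G" using w W s F by auto
          hence "act w (act s y) = act (w \<otimes> s) y" "act w (act s y') = act (w \<otimes> s) y'"
            using yM by (simp_all add: act_mult')
          ultimately show "d (act w (act s y)) (act w (act s y')) \<le> e0" using close by simp
        qed
        hence "B = B'" using apart B B' by blast
        thus ?thesis using cell_eq[OF \<beta>(2) B(1)] cell_eq[OF \<beta>(2) B'(1)] CB B B' by blast
      next
        case False
        hence "w3 y s = Some (cell \<beta> (act s y))" using s by (simp add: w3_def)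
        thus ?thesis using w s by (auto simp: w3_def split: if_splits)
      qed
    qed
  qed
  let ?R = "A \<times> sparse_maps F Q \<delta> \<times> (bd \<rightarrow>\<^sub>E \<beta>) \<times> sparse_maps F \<beta> \<alpha>"
  have bdF: "bd \<subseteq> F" "finite bd" using F by (auto simp: bd_def)
  have sub: "code ` Z \<subseteq> ?R"
  proof
    fix c assume "c \<in> code ` Z"
    then obtain y where y: "y \<in> Z" and c: "c = code y" by blast
    have yM: "y \<in> M" using y Z by auto
    have "{s \<in> F. w1 y s \<noteq> None} = {s \<in> F. d (act s (a y)) (act s y) > e0 / 2}" by (auto simp: w1_def)
    hence 1: "w1 y \<in> sparse_maps F Q \<delta>" unfolding sparse_maps_def
      using a(2)[OF y] q(1) inM yM by (auto simp: w1_def)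
    have 2: "w2 y \<in> bd \<rightarrow>\<^sub>E \<beta>" unfolding w2_def using cell_in(1)[OF \<beta>(2)] inM yM bdF by auto
    have "{s \<in> F. w3 y s \<noteq> None} = {s \<in> F. act s y \<notin> (\<Union>B\<in>\<beta>. C B)}" by (auto simp: w3_def)
    hence 3: "w3 y \<in> sparse_maps F \<beta> \<alpha>" unfolding sparse_maps_def
      using visits[OF y] cell_in(1)[OF \<beta>(2)] inM yM by (auto simp: w3_def)
    show "c \<in> ?R" unfolding c code_def using a(1)[OF y] 1 2 3 by simp
  qed
  have fR: "finite ?R" using A F Q \<beta> bdF by (intro finite_cartesian_product finite_sparse_maps finite_PiE) auto
  have "names act \<beta> F ` Z = (\<lambda>c. names act \<beta> F (SOME y. y \<in> Z \<and> code y = c)) ` code ` Z"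
    unfolding image_image
  proof (rule image_cong[OF refl])
    fix y assume "y \<in> Z"
    hence "\<exists>y'. y' \<in> Z \<and> code y' = code y" by blast
    hence "(SOME y'. y' \<in> Z \<and> code y' = code y) \<in> Z \<and> code (SOME y'. y' \<in> Z \<and> code y' = code y) = code y"
      by (rule someI_ex)
    thus "names act \<beta> F y = names act \<beta> F (SOME y'. y' \<in> Z \<and> code y' = code y)"
      by (intro determines[OF \<open>y \<in> Z\<close>]) auto
  qed
  hence "card (names act \<beta> F ` Z) \<le> card (code ` Z)"
    using card_image_le[OF finite_subset[OF sub fR], of "\<lambda>c. names act \<beta> F (SOME y. y \<in> Z \<and> code y = c)"]
    by (simp only:)
  also have "\<dots> \<le> card ?R" by (rule card_mono[OF fR sub])
  also have "\<dots> = card A * card (sparse_maps F Q \<delta>) * card \<beta> ^ card bd * card (sparse_maps F \<beta> \<alpha>)"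
    using bdF by (simp add: card_cartesian_product card_PiE)
  finally show ?thesis by (simp add: bd_def)
qed

end

text \<open>Expansiveness in its uniform form: orbits that are \<open>e0\<close>-close on a large finite window start close
  together.\<close>

locale expansive_action = compact_metric_action +
  fixes e0 :: real
  assumes infinite_carrier: "infinite (carrier G)" and amenable: "amenable G"
    and e0_pos: "0 < e0"
    and expansive: "0 < e \<Longrightarrow> \<exists>W. finite W \<and> W \<subseteq> carrier G \<and>
        (\<forall>x\<in>M. \<forall>y\<in>M. (\<forall>s\<in>W. d (act s x) (act s y) \<le> e0) \<longrightarrow> d x y \<le> e)"
begin

text \<open>A separated set of maximal size is also spanning in the corresponding sense: every admissible point
  is near one of its elements at all but a proportion \<open>\<delta>\<close> of the times.\<close>

lemma max_separated_eqD:
  assumes "max_separated mtopology d act C \<delta> F \<epsilon> = enat N"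
  obtains A where "finite A" "A \<subseteq> M" "card A \<le> N"
    "\<And>y. y \<in> M \<Longrightarrow> empirical_measure mtopology act F y \<in> C \<Longrightarrow> 0 \<le> \<delta> \<Longrightarrow> 0 \<le> \<epsilon> \<Longrightarrow> F \<subseteq> carrier G \<Longrightarrow>
       \<exists>x\<in>A. real (card {s \<in> F. d (act s x) (act s y) > \<epsilon>}) \<le> \<delta> * real (card F)"
proof -
  define P where "P = (\<lambda>A. finite A \<and> A \<subseteq> {x \<in> M. empirical_measure mtopology act F x \<in> C} \<and> separated d act \<delta> F \<epsilon> A)"
  have bound: "card A \<le> N" if "P A" for A
  proof -
    have "enat (card A) \<le> max_separated mtopology d act C \<delta> F \<epsilon>"
      unfolding max_separated_def by (rule SUP_upper) (use that in \<open>simp add: P_def\<close>)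
    thus ?thesis using assms by simp
  qed
  have "P {}" by (simp add: P_def separated_def)
  moreover have "\<forall>A. P A \<longrightarrow> card A < Suc N" using bound by (simp add: less_Suc_eq_le)
  ultimately obtain A where A: "P A" and max: "\<And>A'. P A' \<Longrightarrow> card A' \<le> card A"
    using ex_has_greatest_nat[of P "{}" card "Suc N"] by (metis less_imp_le)
  have fin: "finite A" "A \<subseteq> M" using A by (auto simp: P_def)
  have "\<exists>x\<in>A. real (card {s \<in> F. d (act s x) (act s y) > \<epsilon>}) \<le> \<delta> * real (card F)"
    if y: "y \<in> M" "empirical_measure mtopology act F y \<in> C" and pos: "0 \<le> \<delta>" "0 \<le> \<epsilon>" "F \<subseteq> carrier G" for y
  proof (cases "y \<in> A")
    case True
    have emp: "{s \<in> F. d (act s y) (act s y) > \<epsilon>} = {}"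
    proof -
      have "d (act s y) (act s y) = 0" if "s \<in> F" for s
      proof -
        have "act s y \<in> M" using act_in that pos(3) y(1) by blast
        thus ?thesis by simp
      qed
      thus ?thesis using pos by auto
    qed
    hence "real (card {s \<in> F. d (act s y) (act s y) > \<epsilon>}) \<le> \<delta> * real (card F)"
      unfolding emp using pos by simp
    thus ?thesis using True by blast
  next
    case False
    have "\<not> P (insert y A)"
    proof
      assume "P (insert y A)"
      hence "card (insert y A) \<le> card A" by (rule max)
      thus False using fin False by simp
    qed
    hence "\<not> separated d act \<delta> F \<epsilon> (insert y A)" using A y by (auto simp: P_def)
    then obtain u v where uv: "u \<in> insert y A" "v \<in> insert y A" "u \<noteq> v"
      "\<not> real (card {s \<in> F. d (act s u) (act s v) > \<epsilon>}) \<ge> \<delta> * real (card F)"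
      by (auto simp: separated_def)
    have "\<not> (u \<in> A \<and> v \<in> A)" using A uv by (auto simp: P_def separated_def)
    then consider "u = y" "v \<in> A" | "v = y" "u \<in> A" using uv by blast
    thus ?thesis
    proof cases
      case 1
      have "{s \<in> F. d (act s v) (act s y) > \<epsilon>} = {s \<in> F. d (act s u) (act s v) > \<epsilon>}"
        using 1 by (simp add: commute[of "act _ y"])
      thus ?thesis using 1 uv(4) by (intro bexI[of _ v]) auto
    next
      case 2
      thus ?thesis using uv(4) by (intro bexI[of _ u]) auto
    qed
  qed
  thus thesis using that[of A] fin bound[OF A] by blast
qed

text \<open>Separated points have different itineraries among the points of a finite net.\<close>

lemma max_separated_finite:
  assumes \<delta>: "0 < \<delta>" and Q: "finite Q" "Q \<subseteq> M" "\<And>x. x \<in> M \<Longrightarrow> \<exists>q\<in>Q. d x q < \<epsilon> / 2"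
    and F: "finite F" "F \<noteq> {}" "F \<subseteq> carrier G"
  obtains N where "max_separated mtopology d act C \<delta> F \<epsilon> = enat N" "N \<le> card Q ^ card F"
proof -
  define q where "q = (\<lambda>x. SOME q. q \<in> Q \<and> d x q < \<epsilon> / 2)"
  have q: "q x \<in> Q \<and> d x (q x) < \<epsilon> / 2" if x: "x \<in> M" for x
  proof -
    have "\<exists>q. q \<in> Q \<and> d x q < \<epsilon> / 2" using Q(3)[OF x] by blast
    thus ?thesis unfolding q_def by (rule someI_ex)
  qed
  have bound: "card A \<le> card Q ^ card F"
    if A: "finite A" "A \<subseteq> {x \<in> topspace mtopology. empirical_measure mtopology act F x \<in> C}"
      "separated d act \<delta> F \<epsilon> A" for A
  proof -
    have AM: "A \<subseteq> M" using A by auto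
    define c where "c = (\<lambda>x. \<lambda>s\<in>F. q (act s x))"
    have inM: "act s x \<in> M" if "x \<in> A" "s \<in> F" for s x using that AM F act_in by blast
    have "inj_on c A"
    proof (rule inj_onI, rule ccontr)
      fix x y assume xy: "x \<in> A" "y \<in> A" "c x = c y" "x \<noteq> y"
      have "d (act s x) (act s y) \<le> \<epsilon>" if s: "s \<in> F" for s
      proof -
        have m: "act s x \<in> M" "act s y \<in> M" using inM xy s by auto
        have e: "q (act s x) = q (act s y)" using fun_cong[OF xy(3), of s] s by (simp add: c_def)
        have "d (act s x) (act s y) \<le> d (act s x) (q (act s x)) + d (q (act s x)) (act s y)"
          by (rule triangle) (use m q Q in auto)
        also have "d (q (act s x)) (act s y) = d (act s y) (q (act s y))" by (simp add: e commute)
        finally show ?thesis using q[OF m(1)] q[OF m(2)] by linarith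
      qed
      hence emp: "{s \<in> F. d (act s x) (act s y) > \<epsilon>} = {}" by (auto simp: not_less)
      have "real (card {s \<in> F. d (act s x) (act s y) > \<epsilon>}) \<ge> \<delta> * real (card F)"
        using A(3) xy by (auto simp: separated_def)
      hence "\<delta> * real (card F) \<le> 0" unfolding emp by simp
      thus False using \<delta> F by (simp add: mult_le_0_iff)
    qed
    hence "card A = card (c ` A)" by (simp add: card_image)
    also have "\<dots> \<le> card (F \<rightarrow>\<^sub>E Q)"
    proof (rule card_mono)
      show "finite (F \<rightarrow>\<^sub>E Q)" using F Q by (intro finite_PiE) auto
      show "c ` A \<subseteq> F \<rightarrow>\<^sub>E Q" unfolding c_def using q inM by auto
    qed
    also have "\<dots> = card Q ^ card F" using F by (simp add: card_PiE)
    finally show ?thesis .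
  qed
  have "max_separated mtopology d act C \<delta> F \<epsilon> \<le> enat (card Q ^ card F)"
    unfolding max_separated_def by (rule SUP_least) (use bound in auto)
  thus thesis using that by (cases "max_separated mtopology d act C \<delta> F \<epsilon>") auto
qed

text \<open>The proportion \<open>sparse_rate (card Q) (\<eta> / 4)\<close> and the scale \<open>e0 / 2\<close> are the same for all \<open>\<mu>\<close>, \<open>\<beta>\<close> and \<open>C\<close>; only
  the index from which on the estimate holds depends on them. The error budget is \<open>\<eta> / 4\<close> for the
  exceptional times, \<open>\<eta> / 8\<close> each for the visits outside the closed pieces, the boundary of the
  F{\o}lner set and the additive constant \<open>2\<close>, and \<open>\<eta> / 4\<close> for the points outside \<open>Z\<close>.\<close>

lemma separated_lower_bound:
  assumes K: "folner_sequence G K" and \<eta>: "0 < \<eta>"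
    and Q: "finite Q" "Q \<subseteq> M" "\<And>x. x \<in> M \<Longrightarrow> \<exists>q\<in>Q. d x q < e0 / 2"
    and \<mu>: "\<mu> \<in> ergodic_measures G mtopology act" and C: "C \<in> weak_star_nhds mtopology \<mu>"
    and \<beta>: "finite \<beta>" "partition_on (space \<mu>) \<beta>" "\<beta> \<subseteq> sets \<mu>"
  shows "eventually (\<lambda>n. \<forall>N. max_separated mtopology d act C (sparse_rate (card Q) (\<eta> / 4)) (K n) (e0 / 2) = enat N \<longrightarrow>
      exp (real (card (K n)) * (entropy_wrt G act \<mu> \<beta> - \<eta>)) \<le> real N) sequentially"
proof -
  note \<mu>p = pmp_action_of_ergodic[OF \<mu>]
  interpret pmp_action G \<mu> act by (rule \<mu>p)
  define \<delta> where "\<delta> = sparse_rate (card Q) (\<eta> / 4)"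
  define b where "b = ln (real (card \<beta>))"
  have b0: "0 \<le> b" unfolding b_def by (rule ln_real_of_nat_nonneg)
  define \<alpha> where "\<alpha> = sparse_rate (card \<beta>) (\<eta> / 8)"
  have pos: "0 < \<delta>" "0 < \<alpha>" using \<eta> by (auto simp: \<delta>_def \<alpha>_def intro!: sparse_rate_pos)
  \<comment> \<open>Each of the two exceptional sets has mass at most \<open>\<tau>\<close>; the bound \<open>1 / 4\<close> keeps their complement
    non-empty.\<close>
  define \<tau> where "\<tau> = min (\<eta> / (8 * (b + 1))) (1 / 4)"
  have \<tau>: "0 < \<tau>" "\<tau> \<le> 1 / 4" "\<tau> * b \<le> \<eta> / 8"
  proof -
    show "0 < \<tau>" using \<eta> b0 by (simp add: \<tau>_def)
    show "\<tau> \<le> 1 / 4" unfolding \<tau>_def by (rule min.cobounded2)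
    have "\<tau> * b \<le> \<eta> / (8 * (b + 1)) * (b + 1)"
      by (rule mult_mono) (use \<eta> b0 in \<open>auto simp: \<tau>_def\<close>)
    also have "\<dots> = \<eta> / 8" using b0 by (simp add: field_simps)
    finally show "\<tau> * b \<le> \<eta> / 8" .
  qed
  have \<beta>M: "partition_on M \<beta>" using \<beta>(2) \<mu>p(3) by simp
  have "space \<mu> \<noteq> {}" by (rule not_empty)
  hence "\<beta> \<noteq> {}" using partition_onD1[OF \<beta>(2)] by auto
  hence c\<beta>: "0 < card \<beta>" using \<beta>(1) by (simp add: card_gt_0_iff)
  \<comment> \<open>Closed pieces of the cells, missing mass at most \<open>\<alpha> \<tau>\<close> in total.\<close>
  have "\<exists>C. closedin mtopology C \<and> C \<subseteq> B \<and> measure \<mu> (B - C) < \<alpha> * \<tau> / real (card \<beta>)" if "B \<in> \<beta>" for B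
    by (rule closed_inner_regular[OF finite_measure_axioms \<mu>p(2)]) (use that \<beta> pos \<tau> c\<beta> in auto)
  then obtain P where P: "\<And>B. B \<in> \<beta> \<Longrightarrow> closedin mtopology (P B)" "\<And>B. B \<in> \<beta> \<Longrightarrow> P B \<subseteq> B"
    "\<And>B. B \<in> \<beta> \<Longrightarrow> measure \<mu> (B - P B) < \<alpha> * \<tau> / real (card \<beta>)" by metis
  have Psets: "P B \<in> sets \<mu>" if "B \<in> \<beta>" for B
  proof -
    have "openin mtopology (M - P B)" using P(1)[OF that] by (simp add: closedin_def)
    hence "space \<mu> - (M - P B) \<in> sets \<mu>" using openin_borel_of \<mu>p(2) by blast
    moreover have "space \<mu> - (M - P B) = P B" using \<mu>p(3) closedin_subset[OF P(1)[OF that]] by auto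
    ultimately show ?thesis by simp
  qed
  define U where "U = (\<Union>B\<in>\<beta>. P B)"
  have U: "U \<in> sets \<mu>" unfolding U_def using \<beta>(1) Psets by (intro sets.finite_UN) auto
  have mU: "measure \<mu> (space \<mu> - U) \<le> \<alpha> * \<tau>"
  proof -
    have "space \<mu> - U \<subseteq> (\<Union>B\<in>\<beta>. B - P B)" using partition_onD1[OF \<beta>(2)] by (auto simp: U_def)
    hence "measure \<mu> (space \<mu> - U) \<le> measure \<mu> (\<Union>B\<in>\<beta>. B - P B)"
      by (rule finite_measure_mono) (use \<beta> Psets in \<open>auto intro!: sets.finite_UN\<close>)
    also have "\<dots> \<le> (\<Sum>B\<in>\<beta>. measure \<mu> (B - P B))"
      by (rule finite_measure_subadditive_finite) (use \<beta> Psets in auto)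
    also have "\<dots> \<le> (\<Sum>B\<in>\<beta>. \<alpha> * \<tau> / real (card \<beta>))"
      by (rule sum_mono) (use P(3) in \<open>auto intro: less_imp_le\<close>)
    also have "\<dots> = \<alpha> * \<tau>" using c\<beta> by simp
    finally show ?thesis .
  qed
  have "\<exists>e>0. \<forall>B\<in>\<beta>. \<forall>B'\<in>\<beta>. \<forall>x\<in>P B. \<forall>y\<in>P B'. d x y \<le> e \<longrightarrow> B = B'"
  proof (rule disjoint_closed_sets_apart[OF \<beta>(1) P(1)])
    fix B B' assume "B \<in> \<beta>" "B' \<in> \<beta>" "B \<noteq> B'"
    hence "B \<inter> B' = {}" using partition_onD2[OF \<beta>(2)] by (auto simp: disjoint_def)
    thus "P B \<inter> P B' = {}" using P(2)[OF \<open>B \<in> \<beta>\<close>] P(2)[OF \<open>B' \<in> \<beta>\<close>] by blast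
  qed
  then obtain e' where e': "0 < e'" "\<And>B B' x y. B \<in> \<beta> \<Longrightarrow> B' \<in> \<beta> \<Longrightarrow> x \<in> P B \<Longrightarrow> y \<in> P B' \<Longrightarrow> d x y \<le> e' \<Longrightarrow> B = B'"
    by metis
  obtain W where W: "finite W" "W \<subseteq> carrier G"
    "\<And>x y. x \<in> M \<Longrightarrow> y \<in> M \<Longrightarrow> (\<And>s. s \<in> W \<Longrightarrow> d (act s x) (act s y) \<le> e0) \<Longrightarrow> d x y \<le> e'"
    using expansive[OF e'(1)] by metis
  obtain D where D: "\<And>n. D n \<in> sets \<mu>" "(\<lambda>n. measure \<mu> (D n)) \<longlonglongrightarrow> 0"
    "\<And>n x. x \<in> topspace mtopology - D n \<Longrightarrow> empirical_measure mtopology act (K n) x \<in> C"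
    using empirical_measures_converge[OF \<mu>p(4,2) compact_mtopology K C] by metis
  define bd where "bd = (\<lambda>n. real (card {s \<in> K n. \<exists>w\<in>W. w \<otimes> s \<notin> K n}) / real (card (K n)))"
  have "eventually (\<lambda>n. measure \<mu> (D n) < \<tau>) sequentially"
    by (rule order_tendstoD(2)[OF D(2) \<tau>(1)])
  moreover have "eventually (\<lambda>n. bd n < \<eta> / (8 * (b + 1))) sequentially"
    unfolding bd_def by (rule order_tendstoD(2)[OF folner_interior[OF K W(1,2)]]) (use \<eta> b0 in simp)
  moreover have "eventually (\<lambda>n. 16 / \<eta> \<le> real (card (K n))) sequentially"
    using folner_card_at_top[OF K infinite_carrier] by (simp add: filterlim_at_top)
  ultimately show ?thesis unfolding \<delta>_def[symmetric]
  proof eventually_elim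
    case (elim n)
    have F: "finite (K n)" "K n \<noteq> {}" "K n \<subseteq> carrier G" using K by (auto simp: folner_sequence_def)
    define k where "k = real (card (K n))"
    have k: "0 < k" using F by (simp add: k_def card_gt_0_iff)
    obtain D' where D': "D' \<in> sets \<mu>" "measure \<mu> D' \<le> \<alpha> * \<tau> / \<alpha>"
      "\<And>x. x \<in> space \<mu> - D' \<Longrightarrow> real (card {s \<in> K n. act s x \<notin> U}) \<le> \<alpha> * real (card (K n))"
      using measure_many_visits[OF U mU F pos(2)] by blast
    define Z where "Z = space \<mu> - (D n \<union> D')"
    have Zs: "Z \<in> sets \<mu>" unfolding Z_def using D(1) D'(1) by auto
    have ZM: "Z \<subseteq> M" using \<mu>p(3) by (auto simp: Z_def)
    have "measure \<mu> (space \<mu> - Z) \<le> measure \<mu> (D n \<union> D')"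
      by (rule finite_measure_mono) (use D(1) D'(1) in \<open>auto simp: Z_def\<close>)
    also have "\<dots> \<le> measure \<mu> (D n) + measure \<mu> D'" by (rule measure_Un_le) (use D(1) D'(1) in auto)
    also have "\<dots> \<le> 2 * \<tau>" using elim(1) D'(2) pos by simp
    finally have mZ: "measure \<mu> (space \<mu> - Z) \<le> 2 * \<tau>" .
    have "Z \<noteq> {}"
    proof
      assume "Z = {}"
      hence "measure \<mu> (space \<mu>) \<le> 2 * \<tau>" using mZ by simp
      thus False using \<tau>(2) prob_space by simp
    qed
    show ?case
    proof (intro allI impI)
      fix N assume N: "max_separated mtopology d act C \<delta> (K n) (e0 / 2) = enat N"
      obtain A where A: "finite A" "A \<subseteq> M" "card A \<le> N"
        and near: "\<And>y. y \<in> M \<Longrightarrow> empirical_measure mtopology act (K n) y \<in> C \<Longrightarrow> 0 \<le> \<delta> \<Longrightarrow> 0 \<le> e0 / 2 \<Longrightarrow> K n \<subseteq> carrier G \<Longrightarrow>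
       \<exists>x\<in>A. real (card {s \<in> K n. d (act s x) (act s y) > e0 / 2}) \<le> \<delta> * real (card (K n))"
        using max_separated_eqD[OF N] by blast
      let ?L = "card (names act \<beta> (K n) ` Z)"
      define bn where "bn = card {s \<in> K n. \<exists>w\<in>W. w \<otimes> s \<notin> K n}"
      have cnt: "?L \<le> card A * card (sparse_maps (K n) Q \<delta>) * card \<beta> ^ bn * card (sparse_maps (K n) \<beta> \<alpha>)"
        unfolding bn_def
      proof (rule card_names_le[OF \<beta>(1) \<beta>M F(1,3) ZM A(1,2) Q W(2,3)])
        show "\<exists>x\<in>A. real (card {s \<in> K n. d (act s x) (act s y) > e0 / 2}) \<le> \<delta> * real (card (K n))" if "y \<in> Z" for y
          by (rule near) (use that D(3) ZM pos e0_pos F in \<open>auto simp: Z_def\<close>)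
        show "real (card {s \<in> K n. act s y \<notin> (\<Union>B\<in>\<beta>. P B)}) \<le> \<alpha> * real (card (K n))" if "y \<in> Z" for y
          using D'(3)[of y] that by (simp add: Z_def U_def)
        show "P B \<subseteq> B" if "B \<in> \<beta>" for B by (rule P(2)[OF that])
        show "B = B'" if "B \<in> \<beta>" "B' \<in> \<beta>" "x \<in> P B" "y \<in> P B'" "d x y \<le> e'" for B B' x y
          using e'(2) that by blast
      qed auto
      have "names act \<beta> (K n) ` Z \<subseteq> K n \<rightarrow>\<^sub>E \<beta>"
        using names_in_PiE[OF \<beta>M, of _ "K n" act] ZM act_in F(3) by blast
      moreover have "finite (K n \<rightarrow>\<^sub>E \<beta>)" using F \<beta> by (intro finite_PiE) auto
      ultimately have "finite (names act \<beta> (K n) ` Z)" by (rule finite_subset)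
      hence L: "0 < ?L" using \<open>Z \<noteq> {}\<close> by (simp add: card_gt_0_iff)
      have "real ?L \<le> real (card A) * real (card (sparse_maps (K n) Q \<delta>)) * real (card \<beta>) ^ bn * real (card (sparse_maps (K n) \<beta> \<alpha>))"
        using cnt by (simp only: of_nat_mult[symmetric] of_nat_power[symmetric] of_nat_le_iff)
      also have "\<dots> \<le> real N * exp (\<eta> / 4 * k) * real (card \<beta>) ^ bn * exp (\<eta> / 8 * k)"
        unfolding k_def using A(3)
        by (intro mult_mono mult_nonneg_nonneg card_sparse_maps_le F Q \<beta>) (use \<eta> in \<open>auto simp: \<delta>_def \<alpha>_def\<close>)
      also have "real (card \<beta>) ^ bn = exp (real bn * b)"
        using c\<beta> by (simp add: b_def exp_of_nat_mult)
      also have "real N * exp (\<eta> / 4 * k) * exp (real bn * b) * exp (\<eta> / 8 * k) = real N * exp (\<eta> / 4 * k + real bn * b + \<eta> / 8 * k)"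
        by (simp only: exp_add mult.assoc)
      finally have LN: "real ?L \<le> real N * exp (\<eta> / 4 * k + real bn * b + \<eta> / 8 * k)" .
      have N0: "0 < real N"
      proof (rule ccontr)
        assume "\<not> 0 < real N"
        hence "real ?L \<le> 0" using LN by simp
        thus False using L by simp
      qed
      have "ln (real ?L) \<le> ln (real N * exp (\<eta> / 4 * k + real bn * b + \<eta> / 8 * k))"
        using LN L N0 by (subst ln_le_cancel_iff) auto
      also have "\<dots> = ln (real N) + (\<eta> / 4 * k + real bn * b + \<eta> / 8 * k)"
        using N0 by (simp add: ln_mult)
      finally have lnL: "ln (real ?L) \<le> ln (real N) + (\<eta> / 4 * k + real bn * b + \<eta> / 8 * k)" .
      have bnb: "real bn * b \<le> \<eta> / 8 * k"
      proof -
        have "real bn = bd n * k" using k by (simp add: bd_def bn_def k_def)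
        hence "real bn * b = bd n * b * k" by simp
        also have "bd n * b \<le> \<eta> / (8 * (b + 1)) * (b + 1)"
          by (rule mult_mono) (use elim(2) b0 \<eta> in auto)
        also have "\<dots> = \<eta> / 8" using b0 by (simp add: field_simps)
        finally show ?thesis using k by simp
      qed
      have two: "2 \<le> \<eta> / 8 * k" using elim(3) \<eta> by (simp add: k_def field_simps)
      have "measure \<mu> (space \<mu> - Z) * (k * b) \<le> 2 * \<tau> * (k * b)"
        by (rule mult_right_mono[OF mZ]) (use k b0 in simp)
      also have "\<dots> = 2 * k * (\<tau> * b)" by simp
      also have "\<dots> \<le> 2 * k * (\<eta> / 8)" by (rule mult_left_mono[OF \<tau>(3)]) (use k in simp)
      finally have rest: "measure \<mu> (space \<mu> - Z) * (k * b) \<le> \<eta> / 4 * k" by simp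
      have "entropy_wrt G act \<mu> \<beta> * k \<le> ent \<mu> (names act \<beta> (K n))"
        using entropy_wrt_le_ent_names[OF amenable \<beta> F] k by (simp add: k_def pos_le_divide_eq)
      also have "\<dots> \<le> ln (real ?L) + 2 + measure \<mu> (space \<mu> - Z) * (k * b)"
        unfolding k_def b_def by (rule ent_names_le[OF \<beta> F(1,3) Zs])
      also have "\<dots> \<le> ln (real N) + 7 / 8 * (\<eta> * k)" using lnL bnb two rest by simp
      also have "\<dots> \<le> ln (real N) + \<eta> * k" using k \<eta> by simp
      finally have "k * (entropy_wrt G act \<mu> \<beta> - \<eta>) \<le> ln (real N)" by (simp add: algebra_simps)
      hence "exp (k * (entropy_wrt G act \<mu> \<beta> - \<eta>)) \<le> exp (ln (real N))" by simp
      thus "exp (real (card (K n)) * (entropy_wrt G act \<mu> \<beta> - \<eta>)) \<le> real N" using N0 by (simp add: k_def)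
    qed
  qed
qed

theorem uniform_separation: "uniform_separation_property G mtopology d act"
  unfolding uniform_separation_property_def
proof (intro allI impI)
  fix K \<eta> assume K: "folner_sequence G K \<and> tempered G K" and \<eta>: "(0::real) < \<eta>"
  hence Kf: "folner_sequence G K" by simp
  have Kn: "finite (K n)" "K n \<noteq> {}" "K n \<subseteq> carrier G" for n using Kf by (auto simp: folner_sequence_def)
  obtain Q where Q: "finite Q" "Q \<subseteq> M" "\<And>x. x \<in> M \<Longrightarrow> \<exists>q\<in>Q. d x q < e0 / 2"
    using finite_net[of "e0 / 2"] e0_pos by auto
  obtain Q' where Q': "finite Q'" "Q' \<subseteq> M" "\<And>x. x \<in> M \<Longrightarrow> \<exists>q\<in>Q'. d x q < e0 / 2 / 2"
    using finite_net[of "e0 / 2 / 2"] e0_pos by auto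
  define \<delta> where "\<delta> = sparse_rate (card Q) (\<eta> / 2 / 4)"
  have \<delta>: "0 < \<delta>" unfolding \<delta>_def by (rule sparse_rate_pos) (use \<eta> in simp)
  show "\<exists>\<epsilon>>0. \<exists>\<delta>>0. \<forall>\<mu>\<in>ergodic_measures G mtopology act. \<forall>C\<in>weak_star_nhds mtopology \<mu>. \<exists>n0. \<forall>n\<ge>n0.
       exp_ereal (ereal (real (card (K n))) * (metric_entropy G act \<mu> - ereal \<eta>))
       \<le> ereal_of_enat (max_separated mtopology d act C \<delta> (K n) \<epsilon>)"
  proof (rule exI[of _ "e0 / 2"], intro conjI, use e0_pos in simp, rule exI[of _ \<delta>], intro conjI ballI, rule \<delta>)
    fix \<mu> C assume \<mu>: "\<mu> \<in> ergodic_measures G mtopology act" and C: "C \<in> weak_star_nhds mtopology \<mu>"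
    note \<mu>p = pmp_action_of_ergodic[OF \<mu>]
    interpret pmp_action G \<mu> act by (rule \<mu>p)
    let ?S = "{\<beta>. finite \<beta> \<and> partition_on (space \<mu>) \<beta> \<and> \<beta> \<subseteq> sets \<mu>}"
    have \<eta>2: "0 < \<eta> / 2" using \<eta> by simp
    note lower = separated_lower_bound[OF Kf \<eta>2 Q \<mu> C, folded \<delta>_def]
    have upper: "\<exists>N. max_separated mtopology d act C \<delta> (K n) (e0 / 2) = enat N \<and> N \<le> card Q' ^ card (K n)" for n
      by (rule max_separated_finite[OF \<delta> Q' Kn]) blast+
    \<comment> \<open>The entropy is finite because separated sets have at most exponential size.\<close>
    have fin: "entropy_wrt G act \<mu> \<beta> \<le> \<eta> / 2 + ln (real (card Q'))" if \<beta>: "\<beta> \<in> ?S" for \<beta>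
    proof -
      have "eventually (\<lambda>n. \<forall>N. max_separated mtopology d act C \<delta> (K n) (e0 / 2) = enat N \<longrightarrow>
         exp (real (card (K n)) * (entropy_wrt G act \<mu> \<beta> - \<eta> / 2)) \<le> real N) sequentially"
        by (rule lower) (use \<beta> in auto)
      then obtain n where n: "\<And>N. max_separated mtopology d act C \<delta> (K n) (e0 / 2) = enat N \<Longrightarrow>
         exp (real (card (K n)) * (entropy_wrt G act \<mu> \<beta> - \<eta> / 2)) \<le> real N"
        unfolding eventually_sequentially by blast
      obtain N where N: "max_separated mtopology d act C \<delta> (K n) (e0 / 2) = enat N" "N \<le> card Q' ^ card (K n)"
        using upper by blast
      have k: "0 < real (card (K n))" using Kn by (simp add: card_gt_0_iff)
      have "exp (real (card (K n)) * (entropy_wrt G act \<mu> \<beta> - \<eta> / 2)) \<le> real N" by (rule n[OF N(1)])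
      also have "\<dots> \<le> real (card Q') ^ card (K n)" using N(2) by (simp only: of_nat_power[symmetric] of_nat_le_iff)
      finally have le: "exp (real (card (K n)) * (entropy_wrt G act \<mu> \<beta> - \<eta> / 2)) \<le> real (card Q') ^ card (K n)" .
      have q: "0 < real (card Q')"
      proof -
        obtain x where "x \<in> space \<mu>" using not_empty by blast
        hence "Q' \<noteq> {}" using Q'(3)[of x] \<mu>p(3) by auto
        thus ?thesis using Q'(1) by (simp add: card_gt_0_iff)
      qed
      have "ln (exp (real (card (K n)) * (entropy_wrt G act \<mu> \<beta> - \<eta> / 2))) \<le> ln (real (card Q') ^ card (K n))"
        using le q by (subst ln_le_cancel_iff) auto
      hence "real (card (K n)) * (entropy_wrt G act \<mu> \<beta> - \<eta> / 2) \<le> real (card (K n)) * ln (real (card Q'))"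
        using q by (simp add: ln_realpow)
      thus ?thesis using k by simp
    qed
    have "metric_entropy G act \<mu> \<le> ereal (\<eta> / 2 + ln (real (card Q')))"
      unfolding metric_entropy_def by (rule SUP_least) (use fin in simp)
    moreover have "ereal (entropy_wrt G act \<mu> {space \<mu>}) \<le> metric_entropy G act \<mu>"
      unfolding metric_entropy_def
      by (rule SUP_upper) (use not_empty in \<open>auto simp: partition_on_def disjoint_def\<close>)
    ultimately obtain h where h: "metric_entropy G act \<mu> = ereal h"
      by (cases "metric_entropy G act \<mu>") auto
    have "ereal (h - \<eta> / 2) < metric_entropy G act \<mu>" using h \<eta> by simp
    then obtain \<beta> where \<beta>: "\<beta> \<in> ?S" "ereal (h - \<eta> / 2) < ereal (entropy_wrt G act \<mu> \<beta>)"
      unfolding metric_entropy_def less_SUP_iff by blast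
    have "eventually (\<lambda>n. \<forall>N. max_separated mtopology d act C \<delta> (K n) (e0 / 2) = enat N \<longrightarrow>
         exp (real (card (K n)) * (entropy_wrt G act \<mu> \<beta> - \<eta> / 2)) \<le> real N) sequentially"
      by (rule lower) (use \<beta> in auto)
    then obtain n0 where n0: "\<And>n N. n \<ge> n0 \<Longrightarrow> max_separated mtopology d act C \<delta> (K n) (e0 / 2) = enat N \<Longrightarrow>
         exp (real (card (K n)) * (entropy_wrt G act \<mu> \<beta> - \<eta> / 2)) \<le> real N"
      unfolding eventually_sequentially by blast
    show "\<exists>n0. \<forall>n\<ge>n0. exp_ereal (ereal (real (card (K n))) * (metric_entropy G act \<mu> - ereal \<eta>))
       \<le> ereal_of_enat (max_separated mtopology d act C \<delta> (K n) (e0 / 2))"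
    proof (intro exI allI impI)
      fix n assume n: "n0 \<le> n"
      obtain N where N: "max_separated mtopology d act C \<delta> (K n) (e0 / 2) = enat N" using upper by blast
      have "exp (real (card (K n)) * (h - \<eta>)) \<le> exp (real (card (K n)) * (entropy_wrt G act \<mu> \<beta> - \<eta> / 2))"
        using \<beta>(2) by (simp add: mult_left_mono)
      also have "\<dots> \<le> real N" by (rule n0[OF n N])
      finally show "exp_ereal (ereal (real (card (K n))) * (metric_entropy G act \<mu> - ereal \<eta>))
         \<le> ereal_of_enat (max_separated mtopology d act C \<delta> (K n) (e0 / 2))"
        by (simp add: N h exp_ereal_def)
    qed
  qed
qed

end

section \<open>The module \<open>\<int>\<Gamma>/\<int>\<Gamma>f\<close> and its characters\<close>

text \<open>An element \<open>f\<close> of the integral group ring. The ring itself enters only through its additive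
  structure, right multiplication by \<open>f\<close> and left multiplication by group elements.\<close>

locale group_ring_element = group G for G :: "('g, 'b) monoid_scheme" (structure) +
  fixes f :: "'g \<Rightarrow> int"
  assumes f_carrier: "f \<in> carrier (integral_group_ring G)"
begin

abbreviation ZG :: "('g \<Rightarrow> int) ring" where "ZG \<equiv> integral_group_ring G"

abbreviation supp :: "('g \<Rightarrow> int) \<Rightarrow> 'g set" where "supp a \<equiv> {t. a t \<noteq> 0}"

lemma ZG_carrier_iff: "a \<in> carrier ZG \<longleftrightarrow> finite (supp a) \<and> supp a \<subseteq> carrier G"
  by (auto simp: integral_group_ring_def)

lemma ZG_mult:
  assumes "s \<in> carrier G" "finite S" "supp a \<subseteq> S" "S \<subseteq> carrier G"
  shows "(a \<otimes>\<^bsub>ZG\<^esub> b) s = (\<Sum>t\<in>S. a t * b (inv t \<otimes> s))"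
  unfolding integral_group_ring_def using assms
  by (auto intro!: sum.mono_neutral_left)

lemma ZG_mult_outside: "s \<notin> carrier G \<Longrightarrow> (a \<otimes>\<^bsub>ZG\<^esub> b) s = 0"
  by (simp add: integral_group_ring_def)

lemma ZG_mult_support:
  assumes "supp a \<subseteq> carrier G" "supp b \<subseteq> carrier G"
  shows "supp (a \<otimes>\<^bsub>ZG\<^esub> b) \<subseteq> (\<lambda>(t, u). t \<otimes> u) ` (supp a \<times> supp b)"
proof
  fix s assume "s \<in> supp (a \<otimes>\<^bsub>ZG\<^esub> b)"
  hence nz: "(a \<otimes>\<^bsub>ZG\<^esub> b) s \<noteq> 0" by simp
  hence s: "s \<in> carrier G" using ZG_mult_outside by blast
  have "\<exists>t. t \<in> carrier G \<and> a t \<noteq> 0 \<and> b (inv t \<otimes> s) \<noteq> 0"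
  proof (rule ccontr)
    assume *: "\<not> ?thesis"
    have "(a \<otimes>\<^bsub>ZG\<^esub> b) s = (\<Sum>t\<in>{t \<in> carrier G. a t \<noteq> 0}. a t * b (inv t \<otimes> s))"
      using s by (simp add: integral_group_ring_def)
    also have "\<dots> = 0" by (rule sum.neutral) (use * in auto)
    finally show False using nz by simp
  qed
  then obtain t where t: "t \<in> carrier G" "a t \<noteq> 0" "b (inv t \<otimes> s) \<noteq> 0" by blast
  have "s = t \<otimes> (inv t \<otimes> s)" using t s by (simp add: m_assoc[symmetric])
  thus "s \<in> (\<lambda>(t, u). t \<otimes> u) ` (supp a \<times> supp b)"
    by (intro image_eqI[of _ _ "(t, inv t \<otimes> s)"]) (use t in auto)
qed

lemma ZG_mult_closed:
  assumes "a \<in> carrier ZG" "b \<in> carrier ZG"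
  shows "a \<otimes>\<^bsub>ZG\<^esub> b \<in> carrier ZG"
proof -
  have "supp a \<subseteq> carrier G" "supp b \<subseteq> carrier G" "finite (supp a \<times> supp b)"
    using assms by (auto simp: ZG_carrier_iff)
  thus ?thesis using finite_subset[OF ZG_mult_support] ZG_mult_outside
    by (auto simp: ZG_carrier_iff)
qed

lemma ZG_add [simp]: "(a \<oplus>\<^bsub>ZG\<^esub> b) = (\<lambda>s. a s + b s)"
  by (simp add: integral_group_ring_def)

lemma ZG_add_closed: "a \<in> carrier ZG \<Longrightarrow> b \<in> carrier ZG \<Longrightarrow> (\<lambda>s. a s + b s) \<in> carrier ZG"
proof -
  assume "a \<in> carrier ZG" "b \<in> carrier ZG"
  hence *: "finite (supp a \<union> supp b)" "supp a \<union> supp b \<subseteq> carrier G" by (auto simp: ZG_carrier_iff)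
  have "supp (\<lambda>s. a s + b s) \<subseteq> supp a \<union> supp b" by auto
  thus ?thesis unfolding ZG_carrier_iff using * finite_subset by (meson order.trans)
qed

lemma ZG_uminus_closed: "a \<in> carrier ZG \<Longrightarrow> (\<lambda>s. - a s) \<in> carrier ZG"
  unfolding ZG_carrier_iff by auto

lemma ZG_diff_closed: "a \<in> carrier ZG \<Longrightarrow> b \<in> carrier ZG \<Longrightarrow> (\<lambda>s. a s - b s) \<in> carrier ZG"
  using ZG_add_closed[OF _ ZG_uminus_closed, of a b] by simp

lemma ZG_zero_closed: "(\<lambda>_. 0) \<in> carrier ZG"
  unfolding ZG_carrier_iff by auto

lemma supp_group_delta: "supp (group_delta t) = {t}"
  by (auto simp: group_delta_def)

lemma ZG_delta_closed: "t \<in> carrier G \<Longrightarrow> group_delta t \<in> carrier ZG"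
  unfolding ZG_carrier_iff supp_group_delta by simp

text \<open>The left ideal \<open>\<int>\<Gamma>f\<close>.\<close>

definition fideal :: "('g \<Rightarrow> int) set" where "fideal = PIdl\<^bsub>ZG\<^esub> f"

lemma fideal_iff: "i \<in> fideal \<longleftrightarrow> (\<exists>x\<in>carrier ZG. i = x \<otimes>\<^bsub>ZG\<^esub> f)"
  by (auto simp: fideal_def cgenideal_def)

lemma fideal_closed: "i \<in> fideal \<Longrightarrow> i \<in> carrier ZG"
  unfolding fideal_iff by (elim bexE) (simp add: ZG_mult_closed f_carrier)

lemma mult_right_diff:
  assumes "x \<in> carrier ZG" "y \<in> carrier ZG"
  shows "(\<lambda>s. x s - y s) \<otimes>\<^bsub>ZG\<^esub> b = (\<lambda>s. (x \<otimes>\<^bsub>ZG\<^esub> b) s - (y \<otimes>\<^bsub>ZG\<^esub> b) s)"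
proof
  fix s
  let ?S = "supp x \<union> supp y"
  have S: "finite ?S" "?S \<subseteq> carrier G" using assms by (auto simp: ZG_carrier_iff)
  show "((\<lambda>s. x s - y s) \<otimes>\<^bsub>ZG\<^esub> b) s = (x \<otimes>\<^bsub>ZG\<^esub> b) s - (y \<otimes>\<^bsub>ZG\<^esub> b) s"
  proof (cases "s \<in> carrier G")
    case True
    note m = ZG_mult[OF True S(1) _ S(2)]
    have "((\<lambda>s. x s - y s) \<otimes>\<^bsub>ZG\<^esub> b) s = (\<Sum>t\<in>?S. (x t - y t) * b (inv t \<otimes> s))" by (rule m) auto
    moreover have "(x \<otimes>\<^bsub>ZG\<^esub> b) s = (\<Sum>t\<in>?S. x t * b (inv t \<otimes> s))" by (rule m) auto
    moreover have "(y \<otimes>\<^bsub>ZG\<^esub> b) s = (\<Sum>t\<in>?S. y t * b (inv t \<otimes> s))" by (rule m) auto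
    ultimately show ?thesis by (simp add: left_diff_distrib sum_subtractf)
  qed (simp add: ZG_mult_outside)
qed

lemma fideal_diff: "i \<in> fideal \<Longrightarrow> j \<in> fideal \<Longrightarrow> (\<lambda>s. i s - j s) \<in> fideal"
proof -
  assume "i \<in> fideal" "j \<in> fideal"
  then obtain x y where x: "x \<in> carrier ZG" "i = x \<otimes>\<^bsub>ZG\<^esub> f" and y: "y \<in> carrier ZG" "j = y \<otimes>\<^bsub>ZG\<^esub> f"
    unfolding fideal_iff by (elim bexE)
  have "(\<lambda>s. i s - j s) = (\<lambda>s. x s - y s) \<otimes>\<^bsub>ZG\<^esub> f" unfolding x(2) y(2) mult_right_diff[OF x(1) y(1)] ..
  thus ?thesis unfolding fideal_iff using ZG_diff_closed[OF x(1) y(1)] by (rule bexI)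
qed

lemma fideal_zero: "(\<lambda>_. 0) \<in> fideal"
proof -
  have "f \<otimes>\<^bsub>ZG\<^esub> f \<in> fideal" using f_carrier by (auto simp: fideal_iff)
  from fideal_diff[OF this this] show ?thesis by simp
qed

lemma fideal_uminus: "i \<in> fideal \<Longrightarrow> (\<lambda>s. - i s) \<in> fideal"
  using fideal_diff[OF fideal_zero] by simp

lemma fideal_add: "i \<in> fideal \<Longrightarrow> j \<in> fideal \<Longrightarrow> (\<lambda>s. i s + j s) \<in> fideal"
  using fideal_diff[OF _ fideal_uminus, of i j] by simp

text \<open>The class of \<open>a\<close> modulo \<open>\<int>\<Gamma>f\<close>.\<close>

definition cls :: "('g \<Rightarrow> int) \<Rightarrow> ('g \<Rightarrow> int) set" where
  "cls a = (\<lambda>i s. i s + a s) ` fideal"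

lemma cls_memI: "i \<in> fideal \<Longrightarrow> (\<lambda>s. i s + a s) \<in> cls a"
  unfolding cls_def by (rule imageI)

abbreviation Q :: "('g \<Rightarrow> int) set monoid" where "Q \<equiv> quotient_module G f"

lemma Q_carrier: "carrier Q = cls ` carrier ZG"
proof -
  have "fideal #>\<^bsub>add_monoid ZG\<^esub> a = cls a" for a
    by (simp add: r_coset_def cls_def image_def) blast
  thus ?thesis
    by (simp add: quotient_module_def FactGroup_def RCOSETS_def fideal_def[symmetric] image_def) blast
qed

lemma cls_in_Q: "a \<in> carrier ZG \<Longrightarrow> cls a \<in> carrier Q"
  by (simp add: Q_carrier)

lemma cls_eq_iff: "cls a = cls b \<longleftrightarrow> (\<lambda>s. a s - b s) \<in> fideal"
proof
  assume "cls a = cls b"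
  moreover have "a \<in> cls a" unfolding cls_def by (rule image_eqI[OF _ fideal_zero]) simp
  ultimately obtain i where "i \<in> fideal" "a = (\<lambda>s. i s + b s)" by (auto simp: cls_def)
  thus "(\<lambda>s. a s - b s) \<in> fideal" by simp
next
  have sub: "cls a \<subseteq> cls b" if d: "(\<lambda>s. a s - b s) \<in> fideal" for a b
  proof
    fix c assume "c \<in> cls a"
    then obtain i where i: "i \<in> fideal" "c = (\<lambda>s. i s + a s)" by (auto simp: cls_def)
    have 1: "(\<lambda>s. i s + (a s - b s)) \<in> fideal" by (rule fideal_add[OF i(1) d])
    have 2: "c = (\<lambda>s. (i s + (a s - b s)) + b s)" by (simp add: i)
    show "c \<in> cls b" using cls_memI[OF 1, of b] by (simp only: 2)
  qed
  assume d: "(\<lambda>s. a s - b s) \<in> fideal"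
  moreover have "(\<lambda>s. b s - a s) \<in> fideal" using fideal_uminus[OF d] by simp
  ultimately show "cls a = cls b" using sub by blast
qed

lemma Q_mult: "cls a \<otimes>\<^bsub>Q\<^esub> cls b = cls (\<lambda>s. a s + b s)"
proof -
  have "cls a \<otimes>\<^bsub>Q\<^esub> cls b = (\<Union>x\<in>cls a. \<Union>y\<in>cls b. {\<lambda>s. x s + y s})"
    by (simp add: quotient_module_def FactGroup_def set_mult_def)
  also have "\<dots> = cls (\<lambda>s. a s + b s)"
  proof (intro equalityI subsetI)
    fix c assume "c \<in> (\<Union>x\<in>cls a. \<Union>y\<in>cls b. {\<lambda>s. x s + y s})"
    then obtain i j where ij: "i \<in> fideal" "j \<in> fideal" "c = (\<lambda>s. (i s + a s) + (j s + b s))"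
      by (auto simp: cls_def)
    have eq: "c = (\<lambda>s. (i s + j s) + (a s + b s))" unfolding ij(3) by (simp add: algebra_simps)
    show "c \<in> cls (\<lambda>s. a s + b s)" 
      using cls_memI[OF fideal_add[OF ij(1,2)], of "\<lambda>s. a s + b s"] by (simp only: eq)
  next
    fix c assume "c \<in> cls (\<lambda>s. a s + b s)"
    then obtain i where i: "i \<in> fideal" "c = (\<lambda>s. i s + (a s + b s))" by (auto simp: cls_def)
    have eq: "c = (\<lambda>s. (i s + a s) + (0 + b s))" using i by (simp add: add.assoc)
    show "c \<in> (\<Union>x\<in>cls a. \<Union>y\<in>cls b. {\<lambda>s. x s + y s})"
      by (rule UN_I[OF cls_memI[OF i(1)]], rule UN_I[OF cls_memI[OF fideal_zero]], subst eq, rule singletonI)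
  qed
  finally show ?thesis .
qed

text \<open>Left translation by \<open>u\<close>, which is left multiplication by the group element \<open>u\<close>.\<close>

definition ltrans :: "'g \<Rightarrow> ('g \<Rightarrow> int) \<Rightarrow> 'g \<Rightarrow> int" where
  "ltrans u a = (\<lambda>s. if s \<in> carrier G then a (inv u \<otimes> s) else 0)"

lemma delta_mult: "u \<in> carrier G \<Longrightarrow> group_delta u \<otimes>\<^bsub>ZG\<^esub> a = ltrans u a"
proof
  fix s assume u: "u \<in> carrier G"
  show "(group_delta u \<otimes>\<^bsub>ZG\<^esub> a) s = ltrans u a s"
  proof (cases "s \<in> carrier G")
    case True
    have "(group_delta u \<otimes>\<^bsub>ZG\<^esub> a) s = (\<Sum>t\<in>{u}. group_delta u t * a (inv t \<otimes> s))"
      by (rule ZG_mult[OF True]) (use u in \<open>simp_all add: supp_group_delta\<close>)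
    also have "\<dots> = a (inv u \<otimes> s)" by (simp add: group_delta_def)
    finally show ?thesis using True by (simp add: ltrans_def)
  qed (simp add: ltrans_def ZG_mult_outside)
qed

lemma ltrans_closed: "u \<in> carrier G \<Longrightarrow> a \<in> carrier ZG \<Longrightarrow> ltrans u a \<in> carrier ZG"
  using ZG_mult_closed[OF ZG_delta_closed, of u a] by (simp add: delta_mult)

lemma ltrans_add: "ltrans u (\<lambda>s. a s + b s) = (\<lambda>s. ltrans u a s + ltrans u b s)"
  by (auto simp: ltrans_def)

lemma ltrans_shift: "u \<in> carrier G \<Longrightarrow> v \<in> carrier G \<Longrightarrow> ltrans u (ltrans v a) = ltrans (u \<otimes> v) a"
  by (rule ext) (simp add: ltrans_def inv_mult_group m_assoc)

lemma ltrans_one: "a \<in> carrier ZG \<Longrightarrow> ltrans \<one> a = a"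
  by (rule ext) (auto simp: ltrans_def ZG_carrier_iff)

lemma ltrans_delta: "u \<in> carrier G \<Longrightarrow> t \<in> carrier G \<Longrightarrow> ltrans u (group_delta t) = group_delta (u \<otimes> t)"
proof
  fix s assume *: "u \<in> carrier G" "t \<in> carrier G"
  have "inv u \<otimes> s = t \<longleftrightarrow> s = u \<otimes> t" if s: "s \<in> carrier G"
  proof
    assume "inv u \<otimes> s = t"
    hence "u \<otimes> t = u \<otimes> (inv u \<otimes> s)" by simp
    also have "\<dots> = s" using * s by (simp add: m_assoc[symmetric])
    finally show "s = u \<otimes> t" ..
  next
    assume "s = u \<otimes> t"
    hence "inv u \<otimes> s = inv u \<otimes> (u \<otimes> t)" by simp
    also have "\<dots> = t" using * by (simp add: m_assoc[symmetric])
    finally show "inv u \<otimes> s = t" .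
  qed
  thus "ltrans u (group_delta t) s = group_delta (u \<otimes> t) s"
    using * by (auto simp: ltrans_def group_delta_def)
qed

lemma ltrans_mult:
  assumes u: "u \<in> carrier G" and x: "x \<in> carrier ZG"
  shows "ltrans u (x \<otimes>\<^bsub>ZG\<^esub> b) = ltrans u x \<otimes>\<^bsub>ZG\<^esub> b"
proof
  fix s
  have S: "finite (supp x)" "supp x \<subseteq> carrier G" using x by (auto simp: ZG_carrier_iff)
  show "ltrans u (x \<otimes>\<^bsub>ZG\<^esub> b) s = (ltrans u x \<otimes>\<^bsub>ZG\<^esub> b) s"
  proof (cases "s \<in> carrier G")
    case True
    let ?S = "(\<lambda>t. u \<otimes> t) ` supp x"
    have sub: "supp (ltrans u x) \<subseteq> ?S"
    proof
      fix t assume "t \<in> supp (ltrans u x)"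
      hence t: "t \<in> carrier G" "x (inv u \<otimes> t) \<noteq> 0" by (auto simp: ltrans_def split: if_splits)
      have "t = u \<otimes> (inv u \<otimes> t)" using t u by (simp add: m_assoc[symmetric])
      thus "t \<in> ?S" using t by blast
    qed
    have "(ltrans u x \<otimes>\<^bsub>ZG\<^esub> b) s = (\<Sum>t\<in>?S. ltrans u x t * b (inv t \<otimes> s))"
      by (rule ZG_mult[OF True _ sub]) (use S u in auto)
    also have "\<dots> = (\<Sum>t\<in>supp x. ltrans u x (u \<otimes> t) * b (inv (u \<otimes> t) \<otimes> s))"
      by (subst sum.reindex) (use S u in \<open>auto intro!: inj_onI simp: subset_iff\<close>)
    also have "\<dots> = (\<Sum>t\<in>supp x. x t * b (inv t \<otimes> (inv u \<otimes> s)))"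
    proof (rule sum.cong[OF refl])
      fix t assume "t \<in> supp x"
      hence t: "t \<in> carrier G" using S by auto
      have "inv u \<otimes> (u \<otimes> t) = t" using t u by (simp add: m_assoc[symmetric])
      moreover have "inv (u \<otimes> t) \<otimes> s = inv t \<otimes> (inv u \<otimes> s)" using t u True by (simp add: inv_mult_group m_assoc)
      ultimately show "ltrans u x (u \<otimes> t) * b (inv (u \<otimes> t) \<otimes> s) = x t * b (inv t \<otimes> (inv u \<otimes> s))"
        using t u by (simp add: ltrans_def)
    qed
    also have "\<dots> = (x \<otimes>\<^bsub>ZG\<^esub> b) (inv u \<otimes> s)"
      by (rule ZG_mult[symmetric]) (use S u True in auto)
    finally show ?thesis using True by (simp add: ltrans_def)
  qed (simp add: ltrans_def ZG_mult_outside)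
qed

lemma ltrans_fideal: "u \<in> carrier G \<Longrightarrow> i \<in> fideal \<Longrightarrow> ltrans u i \<in> fideal"
proof -
  assume u: "u \<in> carrier G" and "i \<in> fideal"
  then obtain x where x: "x \<in> carrier ZG" "i = x \<otimes>\<^bsub>ZG\<^esub> f" unfolding fideal_iff by (elim bexE)
  have "ltrans u i = ltrans u x \<otimes>\<^bsub>ZG\<^esub> f" unfolding x(2) by (rule ltrans_mult[OF u x(1)])
  thus ?thesis unfolding fideal_iff using ltrans_closed[OF u x(1)] by (rule bexI)
qed

lemma delta_l_coset_cls:
  assumes u: "u \<in> carrier G" and a: "a \<in> carrier ZG"
  shows "group_delta u <#\<^bsub>ZG\<^esub> cls a = cls (ltrans u a)"
proof -
  have "group_delta u <#\<^bsub>ZG\<^esub> cls a = ltrans u ` cls a"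
    by (auto simp: l_coset_def delta_mult[OF u])
  also have "\<dots> = cls (ltrans u a)"
  proof (intro equalityI subsetI)
    fix c assume "c \<in> ltrans u ` cls a"
    then obtain i where i: "i \<in> fideal" "c = ltrans u (\<lambda>s. i s + a s)" by (auto simp: cls_def)
    thus "c \<in> cls (ltrans u a)" unfolding cls_def using ltrans_fideal[OF u i(1)] by (auto simp: ltrans_add)
  next
    fix c assume "c \<in> cls (ltrans u a)"
    then obtain i where i: "i \<in> fideal" "c = (\<lambda>s. i s + ltrans u a s)" by (auto simp: cls_def)
    have "ltrans u (ltrans (inv u) i) = i"
      using u fideal_closed[OF i(1)] by (simp add: ltrans_shift ltrans_one)
    hence "c = ltrans u (\<lambda>s. ltrans (inv u) i s + a s)" using i(2) by (simp add: ltrans_add)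
    moreover have "(\<lambda>s. ltrans (inv u) i s + a s) \<in> cls a"
      unfolding cls_def using ltrans_fideal[of "inv u" i] u i(1) by blast
    ultimately show "c \<in> ltrans u ` cls a" by blast
  qed
  finally show ?thesis .
qed

subsection \<open>The dual group\<close>

abbreviation chars :: "(('g \<Rightarrow> int) set \<Rightarrow> complex) set" where "chars \<equiv> topspace (X_top G f)"

lemma chars_eq: "chars = hom Q circle_group \<inter> extensional (carrier Q)"
proof -
  have "hom Q circle_group \<inter> extensional (carrier Q) \<subseteq> (\<Pi>\<^sub>E c\<in>carrier Q. sphere 0 1)"
    by (auto simp: hom_def circle_group_def PiE_def Pi_def)
  thus ?thesis by (auto simp: X_top_def pontryagin_dual_def)
qed

lemma char_norm: "\<xi> \<in> chars \<Longrightarrow> c \<in> carrier Q \<Longrightarrow> norm (\<xi> c) = 1"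
  by (auto simp: chars_eq hom_def circle_group_def Pi_def)

lemma char_add:
  assumes "\<xi> \<in> chars" "a \<in> carrier ZG" "b \<in> carrier ZG"
  shows "\<xi> (cls (\<lambda>s. a s + b s)) = \<xi> (cls a) * \<xi> (cls b)"
proof -
  have "\<xi> (cls a \<otimes>\<^bsub>Q\<^esub> cls b) = \<xi> (cls a) * \<xi> (cls b)"
    using assms cls_in_Q by (auto simp: chars_eq hom_def circle_group_def)
  thus ?thesis by (simp add: Q_mult)
qed

lemma charI:
  assumes "\<And>a. a \<in> carrier ZG \<Longrightarrow> norm (\<xi> (cls a)) = 1"
    and "\<And>a b. a \<in> carrier ZG \<Longrightarrow> b \<in> carrier ZG \<Longrightarrow> \<xi> (cls (\<lambda>s. a s + b s)) = \<xi> (cls a) * \<xi> (cls b)"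
    and "\<xi> \<in> extensional (carrier Q)"
  shows "\<xi> \<in> chars"
  unfolding chars_eq hom_def circle_group_def using assms by (auto simp: Q_carrier Q_mult)

lemma char_ext:
  assumes "\<xi> \<in> chars" "\<eta> \<in> chars" "\<And>a. a \<in> carrier ZG \<Longrightarrow> \<xi> (cls a) = \<eta> (cls a)"
  shows "\<xi> = \<eta>"
  using assms by (intro extensionalityI[of \<xi> "carrier Q" \<eta>]) (auto simp: chars_eq Q_carrier)

lemma char_zero: "\<xi> \<in> chars \<Longrightarrow> \<xi> (cls (\<lambda>_. 0)) = 1"
  using char_add[OF _ ZG_zero_closed ZG_zero_closed, of \<xi>] char_norm[of \<xi> "cls (\<lambda>_. 0)"]
    cls_in_Q[OF ZG_zero_closed] by auto

text \<open>A function \<open>\<theta>\<close> lifts the character \<open>\<xi>\<close> if it gives the angles, in turns, of the values of \<open>\<xi>\<close>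
  at the classes of group elements.\<close>

definition lifts :: "('g \<Rightarrow> real) \<Rightarrow> (('g \<Rightarrow> int) set \<Rightarrow> complex) \<Rightarrow> bool" where
  "lifts \<theta> \<xi> \<longleftrightarrow> (\<forall>s\<in>carrier G. \<xi> (cls (group_delta s)) = cis (2 * pi * \<theta> s))"

text \<open>The value at \<open>a\<close>, in turns, of the character with angle function \<open>\<theta>\<close>; see \<open>char_eq_pairing\<close>.\<close>

definition pairing :: "('g \<Rightarrow> int) \<Rightarrow> ('g \<Rightarrow> real) \<Rightarrow> real" where
  "pairing a \<theta> = (\<Sum>s\<in>supp a. real_of_int (a s) * \<theta> s)"

lemma pairing_eq: "finite S \<Longrightarrow> supp a \<subseteq> S \<Longrightarrow> pairing a \<theta> = (\<Sum>s\<in>S. real_of_int (a s) * \<theta> s)"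
  unfolding pairing_def by (rule sum.mono_neutral_left) auto

lemma pairing_add:
  assumes "a \<in> carrier ZG" "b \<in> carrier ZG"
  shows "pairing (\<lambda>s. a s + b s) \<theta> = pairing a \<theta> + pairing b \<theta>"
proof -
  let ?S = "supp a \<union> supp b"
  have S: "finite ?S" using assms by (auto simp: ZG_carrier_iff)
  have "pairing (\<lambda>s. a s + b s) \<theta> = (\<Sum>s\<in>?S. real_of_int (a s + b s) * \<theta> s)" by (rule pairing_eq[OF S]) auto
  moreover have "pairing a \<theta> = (\<Sum>s\<in>?S. real_of_int (a s) * \<theta> s)" by (rule pairing_eq[OF S]) auto
  moreover have "pairing b \<theta> = (\<Sum>s\<in>?S. real_of_int (b s) * \<theta> s)" by (rule pairing_eq[OF S]) auto
  ultimately show ?thesis by (simp add: distrib_right sum.distrib)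
qed

lemma pairing_delta: "pairing (group_delta t) \<theta> = \<theta> t"
  by (subst pairing_eq[of "{t}"]) (auto simp: group_delta_def)

lemma char_multiple:
  assumes \<xi>: "\<xi> \<in> chars" and l: "lifts \<theta> \<xi>" and t: "t \<in> carrier G"
  shows "\<xi> (cls (\<lambda>s. n * group_delta t s)) = cis (2 * pi * (real_of_int n * \<theta> t))"
proof -
  have cl: "(\<lambda>s. n * group_delta t s) \<in> carrier ZG" for n
    using t unfolding ZG_carrier_iff by (auto simp: group_delta_def)
  have step: "\<xi> (cls (\<lambda>s. (n + 1) * group_delta t s)) = \<xi> (cls (\<lambda>s. n * group_delta t s)) * cis (2 * pi * \<theta> t)" for n
    using char_add[OF \<xi> cl[of n] ZG_delta_closed[OF t]] l t by (simp add: lifts_def distrib_right)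
  show ?thesis
  proof (induction n rule: int_induct[where k=0])
    case base
    show ?case using char_zero[OF \<xi>] by simp
  next
    case (step1 n)
    show ?case unfolding step step1(2) cis_mult by (simp add: algebra_simps)
  next
    case (step2 n)
    have "cis (2 * pi * (real_of_int n * \<theta> t)) = \<xi> (cls (\<lambda>s. (n - 1) * group_delta t s)) * cis (2 * pi * \<theta> t)"
      using step[of "n - 1"] step2(2) by simp
    hence "\<xi> (cls (\<lambda>s. (n - 1) * group_delta t s)) = cis (2 * pi * (real_of_int n * \<theta> t)) / cis (2 * pi * \<theta> t)"
      by (simp add: field_simps)
    thus ?case by (simp add: cis_divide algebra_simps)
  qed
qed

lemma char_eq_pairing:
  assumes \<xi>: "\<xi> \<in> chars" and l: "lifts \<theta> \<xi>" and a: "a \<in> carrier ZG"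
  shows "\<xi> (cls a) = cis (2 * pi * pairing a \<theta>)"
proof -
  have "\<xi> (cls a) = cis (2 * pi * pairing a \<theta>)" if "finite S" "supp a \<subseteq> S" "S \<subseteq> carrier G" for S a
    using that
  proof (induction S arbitrary: a rule: finite_induct)
    case empty
    hence "a = (\<lambda>_. 0)" by auto
    thus ?case using char_zero[OF \<xi>] by (simp add: pairing_def)
  next
    case (insert t S)
    define a' where "a' = (\<lambda>s. if s = t then 0 else a s)"
    have t: "t \<in> carrier G" using insert by auto
    have a': "supp a' \<subseteq> S" using insert by (auto simp: a'_def)
    have a'c: "a' \<in> carrier ZG" unfolding ZG_carrier_iff using a' insert finite_subset by blast
    have tc: "(\<lambda>s. a t * group_delta t s) \<in> carrier ZG"
      using t unfolding ZG_carrier_iff by (auto simp: group_delta_def)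
    have eq: "a = (\<lambda>s. a' s + a t * group_delta t s)" by (auto simp: a'_def group_delta_def)
    have pt: "pairing (\<lambda>s. a t * group_delta t s) \<theta> = real_of_int (a t) * \<theta> t"
      by (subst pairing_eq[of "{t}"]) (auto simp: group_delta_def)
    have "\<xi> (cls a) = \<xi> (cls a') * \<xi> (cls (\<lambda>s. a t * group_delta t s))"
      by (subst eq) (rule char_add[OF \<xi> a'c tc])
    also have "\<dots> = cis (2 * pi * pairing a' \<theta>) * cis (2 * pi * (real_of_int (a t) * \<theta> t))"
      using insert.IH[OF a'] insert.prems char_multiple[OF \<xi> l t] by simp
    also have "\<dots> = cis (2 * pi * (pairing a' \<theta> + real_of_int (a t) * \<theta> t))"
      by (simp add: cis_mult algebra_simps)
    also have "pairing a' \<theta> + real_of_int (a t) * \<theta> t = pairing a \<theta>"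
      using pairing_add[OF a'c tc, of \<theta>] eq pt by simp
    finally show ?case .
  qed
  thus ?thesis using a by (auto simp: ZG_carrier_iff)
qed

text \<open>Right convolution by \<open>f\<close> on functions; it is dual to right multiplication by \<open>f\<close>, so a function
  \<open>y\<close> is the angle function of a character exactly when \<open>conv_f y\<close> is integer valued.\<close>

definition conv_f :: "('g \<Rightarrow> real) \<Rightarrow> 'g \<Rightarrow> real" where
  "conv_f y t = (\<Sum>u\<in>supp f. real_of_int (f u) * y (t \<otimes> u))"

lemma pairing_mult_f:
  assumes x: "x \<in> carrier ZG"
  shows "pairing (x \<otimes>\<^bsub>ZG\<^esub> f) y = (\<Sum>t\<in>supp x. real_of_int (x t) * conv_f y t)"
proof -
  have fx: "finite (supp x)" "supp x \<subseteq> carrier G" and ff: "finite (supp f)" "supp f \<subseteq> carrier G"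
    using x f_carrier by (auto simp: ZG_carrier_iff)
  define S where "S = (\<lambda>(t, u). t \<otimes> u) ` (supp x \<times> supp f)"
  have S: "finite S" "S \<subseteq> carrier G" using fx ff by (auto simp: S_def)
  have "pairing (x \<otimes>\<^bsub>ZG\<^esub> f) y = (\<Sum>s\<in>S. real_of_int ((x \<otimes>\<^bsub>ZG\<^esub> f) s) * y s)"
    by (rule pairing_eq[OF S(1)]) (use ZG_mult_support[OF fx(2) ff(2)] in \<open>simp add: S_def\<close>)
  also have "\<dots> = (\<Sum>s\<in>S. \<Sum>t\<in>supp x. real_of_int (x t) * (real_of_int (f (inv t \<otimes> s)) * y s))"
  proof (rule sum.cong[OF refl])
    fix s assume "s \<in> S"
    hence s: "s \<in> carrier G" using S by auto
    show "real_of_int ((x \<otimes>\<^bsub>ZG\<^esub> f) s) * y s = (\<Sum>t\<in>supp x. real_of_int (x t) * (real_of_int (f (inv t \<otimes> s)) * y s))"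
      by (subst ZG_mult[OF s fx(1) subset_refl fx(2)]) (simp add: sum_distrib_right mult.assoc)
  qed
  also have "\<dots> = (\<Sum>t\<in>supp x. real_of_int (x t) * (\<Sum>s\<in>S. real_of_int (f (inv t \<otimes> s)) * y s))"
    by (subst sum.swap) (simp add: sum_distrib_left)
  also have "\<dots> = (\<Sum>t\<in>supp x. real_of_int (x t) * conv_f y t)"
  proof (rule sum.cong[OF refl])
    fix t assume tx: "t \<in> supp x"
    hence t: "t \<in> carrier G" using fx by auto
    have "(\<Sum>s\<in>S. real_of_int (f (inv t \<otimes> s)) * y s) = (\<Sum>s\<in>(\<lambda>u. t \<otimes> u) ` supp f. real_of_int (f (inv t \<otimes> s)) * y s)"
    proof (rule sum.mono_neutral_right[OF S(1)])
      show "(\<lambda>u. t \<otimes> u) ` supp f \<subseteq> S" using tx by (auto simp: S_def)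
      show "\<forall>s\<in>S - (\<lambda>u. t \<otimes> u) ` supp f. real_of_int (f (inv t \<otimes> s)) * y s = 0"
      proof
        fix s assume s: "s \<in> S - (\<lambda>u. t \<otimes> u) ` supp f"
        hence "s \<in> carrier G" using S by auto
        hence "s = t \<otimes> (inv t \<otimes> s)" using t by (simp add: m_assoc[symmetric])
        hence "f (inv t \<otimes> s) = 0" using s by blast
        thus "real_of_int (f (inv t \<otimes> s)) * y s = 0" by simp
      qed
    qed
    also have "\<dots> = (\<Sum>u\<in>supp f. real_of_int (f (inv t \<otimes> (t \<otimes> u))) * y (t \<otimes> u))"
      by (subst sum.reindex) (use t ff in \<open>auto intro!: inj_onI simp: subset_iff\<close>)
    also have "\<dots> = conv_f y t" unfolding conv_f_def
      by (rule sum.cong[OF refl]) (use t ff in \<open>auto simp: m_assoc[symmetric] subset_iff\<close>)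
    finally show "real_of_int (x t) * (\<Sum>s\<in>S. real_of_int (f (inv t \<otimes> s)) * y s) = real_of_int (x t) * conv_f y t"
      by simp
  qed
  finally show ?thesis .
qed

lemma cis_eq_one_iff: "cis (2 * pi * r) = 1 \<longleftrightarrow> r \<in> \<int>"
proof
  assume "cis (2 * pi * r) = 1"
  hence "cos (2 * pi * r) = 1" by (metis cis.sel(1) one_complex.sel(1))
  then obtain n :: int where "2 * pi * r = of_int n * (2 * pi)" using cos_one_2pi_int by (auto simp: mult.commute)
  hence "r = of_int n" by simp
  thus "r \<in> \<int>" by simp
next
  assume "r \<in> \<int>"
  thus "cis (2 * pi * r) = 1" by (auto elim!: Ints_cases simp: cis_multiple_2pi)
qed

lemma conv_f_lift_Ints:
  assumes \<xi>: "\<xi> \<in> chars" and l: "lifts \<theta> \<xi>" and t: "t \<in> carrier G"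
  shows "conv_f \<theta> t \<in> \<int>"
proof -
  have d: "group_delta t \<otimes>\<^bsub>ZG\<^esub> f \<in> fideal" using ZG_delta_closed[OF t] by (auto simp: fideal_iff)
  have "cls (group_delta t \<otimes>\<^bsub>ZG\<^esub> f) = cls (\<lambda>_. 0)" using d by (simp add: cls_eq_iff)
  hence "cis (2 * pi * pairing (group_delta t \<otimes>\<^bsub>ZG\<^esub> f) \<theta>) = 1"
    using char_eq_pairing[OF \<xi> l fideal_closed[OF d]] char_zero[OF \<xi>] by simp
  moreover have "pairing (group_delta t \<otimes>\<^bsub>ZG\<^esub> f) \<theta> = conv_f \<theta> t"
  proof -
    show ?thesis unfolding pairing_mult_f[OF ZG_delta_closed[OF t]] supp_group_delta
      by (simp add: group_delta_def)
  qed
  ultimately show ?thesis by (simp add: cis_eq_one_iff)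
qed

text \<open>The pairing with \<open>y\<close> is integer valued on \<open>\<int>\<Gamma>f\<close>, so modulo \<open>\<int>\<close> it depends only on the class; any
  representative \<open>rep c\<close> may be used.\<close>

lemma char_of_function:
  assumes y: "\<And>t. t \<in> carrier G \<Longrightarrow> conv_f y t \<in> \<int>"
  shows "\<exists>\<xi>\<in>chars. lifts y \<xi>"
proof -
  define rep where "rep = (\<lambda>c. SOME a. a \<in> carrier ZG \<and> c = cls a)"
  define \<xi> where "\<xi> = (\<lambda>c\<in>carrier Q. cis (2 * pi * pairing (rep c) y))"
  have \<xi>c: "\<xi> (cls a) = cis (2 * pi * pairing a y)" if a: "a \<in> carrier ZG" for a
  proof -
    have "\<exists>b. b \<in> carrier ZG \<and> cls a = cls b" using a by blast
    hence r: "rep (cls a) \<in> carrier ZG \<and> cls a = cls (rep (cls a))" unfolding rep_def by (rule someI_ex)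
    hence "(\<lambda>s. a s - rep (cls a) s) \<in> fideal" using cls_eq_iff by blast
    then obtain x where x: "x \<in> carrier ZG" "(\<lambda>s. a s - rep (cls a) s) = x \<otimes>\<^bsub>ZG\<^esub> f" by (auto simp: fideal_iff)
    have "a = (\<lambda>s. rep (cls a) s + (x \<otimes>\<^bsub>ZG\<^esub> f) s)" by (simp add: x(2)[symmetric])
    hence "pairing a y = pairing (rep (cls a)) y + pairing (x \<otimes>\<^bsub>ZG\<^esub> f) y"
      using pairing_add[of "rep (cls a)" "x \<otimes>\<^bsub>ZG\<^esub> f" y] r ZG_mult_closed[OF x(1) f_carrier] by simp
    moreover have "pairing (x \<otimes>\<^bsub>ZG\<^esub> f) y \<in> \<int>" unfolding pairing_mult_f[OF x(1)]
      by (intro Ints_sum Ints_mult y) (use x(1) in \<open>auto simp: ZG_carrier_iff\<close>)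
    ultimately have "cis (2 * pi * pairing a y) = cis (2 * pi * pairing (rep (cls a)) y)"
      using cis_eq_one_iff by (simp add: distrib_left cis_mult[symmetric])
    thus ?thesis using cls_in_Q[OF a] by (simp add: \<xi>_def)
  qed
  have "\<xi> \<in> chars"
  proof (rule charI)
    fix a b assume ab: "a \<in> carrier ZG" "b \<in> carrier ZG"
    show "\<xi> (cls (\<lambda>s. a s + b s)) = \<xi> (cls a) * \<xi> (cls b)"
      using \<xi>c[OF ZG_add_closed[OF ab]] \<xi>c[OF ab(1)] \<xi>c[OF ab(2)] pairing_add[OF ab]
      by (simp add: distrib_left cis_mult)
  qed (use \<xi>c in \<open>auto simp: \<xi>_def\<close>)
  moreover have "lifts y \<xi>" unfolding lifts_def using \<xi>c[OF ZG_delta_closed] by (simp add: pairing_delta)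
  ultimately show ?thesis by blast
qed

lemma lift_exists:
  assumes \<xi>: "\<xi> \<in> chars"
  shows "\<exists>\<theta>. lifts \<theta> \<xi> \<and> (\<forall>s. \<bar>\<theta> s\<bar> \<le> 1 / 2) \<and> (\<forall>s. \<theta> s = Arg (\<xi> (cls (group_delta s))) / (2 * pi))"
proof (intro exI conjI allI)
  show "lifts (\<lambda>s. Arg (\<xi> (cls (group_delta s))) / (2 * pi)) \<xi>"
    unfolding lifts_def
  proof
    fix s assume "s \<in> carrier G"
    hence n: "norm (\<xi> (cls (group_delta s))) = 1" using char_norm[OF \<xi> cls_in_Q[OF ZG_delta_closed]] by simp
    hence "\<xi> (cls (group_delta s)) \<noteq> 0" by auto
    hence "cis (Arg (\<xi> (cls (group_delta s)))) = \<xi> (cls (group_delta s))"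
      using n by (simp add: cis_Arg sgn_div_norm)
    thus "\<xi> (cls (group_delta s)) = cis (2 * pi * (Arg (\<xi> (cls (group_delta s))) / (2 * pi)))" by simp
  qed
  show "\<bar>Arg (\<xi> (cls (group_delta s))) / (2 * pi)\<bar> \<le> 1 / 2" for s
    using Arg_bounded[of "\<xi> (cls (group_delta s))"] pi_gt_zero by (simp add: abs_le_iff field_simps)
qed (rule refl)

lemma char_mult_cnj:
  assumes "\<xi> \<in> chars" "\<eta> \<in> chars"
  shows "(\<lambda>c\<in>carrier Q. \<xi> c * cnj (\<eta> c)) \<in> chars"
proof (rule charI)
  fix a b assume ab: "a \<in> carrier ZG" "b \<in> carrier ZG"
  let ?\<zeta> = "\<lambda>c\<in>carrier Q. \<xi> c * cnj (\<eta> c)"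
  show "?\<zeta> (cls (\<lambda>s. a s + b s)) = ?\<zeta> (cls a) * ?\<zeta> (cls b)"
    using cls_in_Q[OF ZG_add_closed[OF ab]] cls_in_Q[OF ab(1)] cls_in_Q[OF ab(2)]
      char_add[OF assms(1) ab] char_add[OF assms(2) ab] by simp
qed (use assms char_norm cls_in_Q in \<open>auto simp: norm_mult\<close>)

lemma char_eqI:
  assumes "\<xi> \<in> chars" "\<eta> \<in> chars"
    and "\<And>s. s \<in> carrier G \<Longrightarrow> \<xi> (cls (group_delta s)) = \<eta> (cls (group_delta s))"
  shows "\<xi> = \<eta>"
proof -
  obtain \<theta> where l: "lifts \<theta> \<xi>" using lift_exists[OF assms(1)] by blast
  hence l': "lifts \<theta> \<eta>" using assms(3) by (simp add: lifts_def)
  show ?thesis by (rule char_ext[OF assms(1,2)])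
    (simp add: char_eq_pairing[OF assms(1) l] char_eq_pairing[OF assms(2) l'])
qed

subsection \<open>Topology and action\<close>

lemma X_top_eq: "X_top G f = subtopology (product_topology (\<lambda>_. top_of_set (sphere 0 1)) (carrier Q))
    (hom Q circle_group \<inter> extensional (carrier Q))"
  by (simp add: X_top_def pontryagin_dual_def)

lemma continuous_map_evaluation:
  "c \<in> carrier Q \<Longrightarrow> continuous_map (X_top G f) euclidean (\<lambda>\<xi>. \<xi> c)"
  unfolding X_top_eq
  by (intro continuous_map_from_subtopology continuous_map_into_fulltopology[OF
      continuous_map_product_projection[of c "carrier Q" "\<lambda>_. top_of_set (sphere (0::complex) 1)"]])

lemma compact_X_top: "compact_space (X_top G f)"
proof -
  let ?T = "product_topology (\<lambda>_. top_of_set (sphere (0::complex) 1)) (carrier Q)"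
  have ev: "continuous_map ?T euclidean (\<lambda>\<xi>. \<xi> c)" if "c \<in> carrier Q" for c
    using continuous_map_product_projection[OF that, of "\<lambda>_. top_of_set (sphere (0::complex) 1)"]
    by (rule continuous_map_into_fulltopology)
  define E where "E = (\<lambda>c d. {\<xi> \<in> topspace ?T. \<xi> (c \<otimes>\<^bsub>Q\<^esub> d) - \<xi> c * \<xi> d \<in> {0}})"
  have Qm: "c \<otimes>\<^bsub>Q\<^esub> d \<in> carrier Q" if cd: "c \<in> carrier Q" "d \<in> carrier Q" for c d
  proof -
    obtain a b where "a \<in> carrier ZG" "b \<in> carrier ZG" "c = cls a" "d = cls b" using cd by (auto simp: Q_carrier)
    thus ?thesis using cls_in_Q[OF ZG_add_closed] by (simp add: Q_mult)
  qed
  have "closedin ?T (E c d)" if cd: "c \<in> carrier Q" "d \<in> carrier Q" for c d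
    unfolding E_def
  proof (rule closedin_continuous_map_preimage)
    show "continuous_map ?T euclidean (\<lambda>\<xi>. \<xi> (c \<otimes>\<^bsub>Q\<^esub> d) - \<xi> c * \<xi> d)"
      using ev[OF Qm[OF cd]] ev[OF cd(1)] ev[OF cd(2)]
      by (simp add: continuous_map_atin tendsto_mult tendsto_diff)
  qed auto
  hence "closedin ?T (topspace ?T \<inter> (\<Inter>(c, d)\<in>carrier Q \<times> carrier Q. E c d))"
    by (intro closedin_Int closedin_topspace closedin_Inter) (use ZG_zero_closed in \<open>auto simp: Q_carrier\<close>)
  moreover have "topspace ?T \<inter> (hom Q circle_group \<inter> extensional (carrier Q)) =
      topspace ?T \<inter> (\<Inter>(c, d)\<in>carrier Q \<times> carrier Q. E c d)"
    unfolding E_def hom_def circle_group_def topspace_product_topology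
    by (simp only: partial_object.simps monoid.simps topspace_euclidean_subtopology) (auto simp: PiE_def Pi_def)
  ultimately have cl: "closedin ?T (topspace ?T \<inter> (hom Q circle_group \<inter> extensional (carrier Q)))" by simp
  have "compact_space (top_of_set (sphere (0::complex) 1))"
    by (simp add: compact_space_subtopology)
  hence "compact_space ?T" by (simp add: compact_space_product_topology)
  hence "compactin ?T (topspace ?T \<inter> (hom Q circle_group \<inter> extensional (carrier Q)))"
    using cl by (rule closedin_compact_space)
  from compact_space_subtopology[OF this] show ?thesis unfolding X_top_eq subtopology_restrict .
qed

lemma X_act_cls:
  assumes "s \<in> carrier G" "a \<in> carrier ZG"
  shows "X_act G f s \<xi> (cls a) = \<xi> (cls (ltrans (inv s) a))"
  using assms cls_in_Q[OF assms(2)] by (simp add: X_act_def delta_l_coset_cls)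

lemma X_act_chars:
  assumes s: "s \<in> carrier G" and \<xi>: "\<xi> \<in> chars"
  shows "X_act G f s \<xi> \<in> chars"
proof (rule charI)
  fix a assume a: "a \<in> carrier ZG"
  show "norm (X_act G f s \<xi> (cls a)) = 1"
    using char_norm[OF \<xi> cls_in_Q[OF ltrans_closed]] s a by (simp add: X_act_cls)
  fix b assume b: "b \<in> carrier ZG"
  show "X_act G f s \<xi> (cls (\<lambda>s. a s + b s)) = X_act G f s \<xi> (cls a) * X_act G f s \<xi> (cls b)"
    using char_add[OF \<xi> ltrans_closed ltrans_closed] s a b ZG_add_closed[OF a b] by (simp add: X_act_cls ltrans_add)
qed (simp add: X_act_def)

lemma X_act_one: "\<xi> \<in> chars \<Longrightarrow> X_act G f \<one> \<xi> = \<xi>"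
  by (rule char_ext) (simp_all add: X_act_chars X_act_cls ltrans_one)

lemma X_act_mult:
  assumes "\<xi> \<in> chars" "s \<in> carrier G" "t \<in> carrier G"
  shows "X_act G f (s \<otimes> t) \<xi> = X_act G f s (X_act G f t \<xi>)"
  by (rule char_ext) (use assms in \<open>simp_all add: X_act_chars X_act_cls ltrans_closed ltrans_shift inv_mult_group\<close>)

lemma X_act_delta:
  assumes "s \<in> carrier G" "t \<in> carrier G"
  shows "X_act G f s \<xi> (cls (group_delta t)) = \<xi> (cls (group_delta (inv s \<otimes> t)))"
  using assms by (simp add: X_act_cls ZG_delta_closed ltrans_delta)

lemma continuous_map_X_act:
  assumes s: "s \<in> carrier G"
  shows "continuous_map (X_top G f) (X_top G f) (X_act G f s)"
proof -
  have "continuous_map (X_top G f) (product_topology (\<lambda>_. top_of_set (sphere 0 1)) (carrier Q)) (X_act G f s)"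
    unfolding continuous_map_componentwise
  proof (intro conjI ballI)
    show "X_act G f s ` topspace (X_top G f) \<subseteq> extensional (carrier Q)" by (auto simp: X_act_def)
    fix c assume "c \<in> carrier Q"
    then obtain a where a: "a \<in> carrier ZG" and c: "c = cls a" by (auto simp: Q_carrier)
    have q: "cls (ltrans (inv s) a) \<in> carrier Q" using cls_in_Q[OF ltrans_closed] s a by simp
    show "continuous_map (X_top G f) (top_of_set (sphere 0 1)) (\<lambda>\<xi>. X_act G f s \<xi> c)"
      unfolding c X_act_cls[OF s a] continuous_map_in_subtopology
      using continuous_map_evaluation[OF q] char_norm[OF _ q] by auto
  qed
  moreover have "X_act G f s ` topspace (X_top G f) \<subseteq> hom Q circle_group \<inter> extensional (carrier Q)"
    using X_act_chars[OF s] by (auto simp: chars_eq)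
  ultimately show ?thesis by (subst (2) X_top_eq) (auto simp: continuous_map_in_subtopology)
qed

end

(* Two notions of absolute summability share this infix; the one for has_sum is meant. *)
no_notation Infinite_Set_Sum.abs_summable_on (infix \<open>abs'_summable'_on\<close> 50)

section \<open>Convolution by absolutely summable functions\<close>

context group
begin

text \<open>Right convolution by \<open>a\<close>, extending \<open>conv_f\<close> from the group ring to absolutely summable functions.\<close>

definition conv :: "('a \<Rightarrow> real) \<Rightarrow> ('a \<Rightarrow> real) \<Rightarrow> 'a \<Rightarrow> real" where
  "conv a y t = (\<Sum>\<^sub>\<infinity>u\<in>carrier G. a u * y (t \<otimes> u))"

lemma l1_carrier_summable: "a \<in> carrier (l1_algebra G) \<Longrightarrow> (\<lambda>t. \<bar>a t\<bar>) summable_on carrier G"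
  by (simp add: l1_algebra_def)

lemma bij_betw_left_mult:
  assumes "u \<in> carrier G"
  shows "bij_betw (\<lambda>w. u \<otimes> w) (carrier G) (carrier G)"
  by (rule bij_betw_byWitness[where f'="\<lambda>w. inv u \<otimes> w"]) (use assms in \<open>auto simp: m_assoc[symmetric]\<close>)

lemma l1_mult_bounded_summable:
  fixes a y :: "'a \<Rightarrow> real"
  assumes a: "(\<lambda>t. \<bar>a t\<bar>) summable_on A" and y: "\<And>s. s \<in> A \<Longrightarrow> \<bar>y s\<bar> \<le> B"
  shows "(\<lambda>u. a u * y u) abs_summable_on A"
proof (rule Infinite_Sum.abs_summable_on_comparison_test)
  show "(\<lambda>u. B * a u) abs_summable_on A"
    using summable_on_cmult_right[OF a, of "\<bar>B\<bar>"] by (simp add: abs_mult)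
  fix u assume "u \<in> A"
  hence "\<bar>y u\<bar> \<le> \<bar>B\<bar>" using y by fastforce
  hence "\<bar>a u\<bar> * \<bar>y u\<bar> \<le> \<bar>a u\<bar> * \<bar>B\<bar>" by (rule mult_left_mono) simp
  thus "norm (a u * y u) \<le> norm (B * a u)" by (simp add: abs_mult mult.commute)
qed

lemma l1_mult_bounded_le:
  fixes a y :: "'a \<Rightarrow> real"
  assumes a: "(\<lambda>t. \<bar>a t\<bar>) summable_on A" and y: "\<And>s. s \<in> A \<Longrightarrow> \<bar>y s\<bar> \<le> B"
  shows "\<bar>\<Sum>\<^sub>\<infinity>u\<in>A. a u * y u\<bar> \<le> B * (\<Sum>\<^sub>\<infinity>u\<in>A. \<bar>a u\<bar>)"
proof -
  note s = l1_mult_bounded_summable[OF a y]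
  have "norm (\<Sum>\<^sub>\<infinity>u\<in>A. a u * y u) \<le> (\<Sum>\<^sub>\<infinity>u\<in>A. norm (a u * y u))" by (rule norm_infsum_bound[OF s])
  also have "\<dots> \<le> (\<Sum>\<^sub>\<infinity>u\<in>A. B * \<bar>a u\<bar>)"
  proof (rule infsum_mono[OF s summable_on_cmult_right[OF a]])
    fix u assume "u \<in> A"
    hence "\<bar>a u\<bar> * \<bar>y u\<bar> \<le> \<bar>a u\<bar> * B" using y by (intro mult_left_mono) auto
    thus "norm (a u * y u) \<le> B * \<bar>a u\<bar>" by (simp add: abs_mult mult.commute)
  qed
  also have "\<dots> = B * (\<Sum>\<^sub>\<infinity>u\<in>A. \<bar>a u\<bar>)" by (rule infsum_cmult_right')
  finally show ?thesis by simp
qed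

text \<open>Right convolution turns products into composition; the double sum is interchanged by absolute
  summability.\<close>

lemma conv_mult:
  assumes a: "a \<in> carrier (l1_algebra G)" and b: "b \<in> carrier (l1_algebra G)"
    and y: "\<And>s. s \<in> carrier G \<Longrightarrow> \<bar>y s\<bar> \<le> B" and t: "t \<in> carrier G"
  shows "conv a (conv b y) t = conv (a \<otimes>\<^bsub>l1_algebra G\<^esub> b) y t"
proof -
  note as = l1_carrier_summable[OF a] and bs = l1_carrier_summable[OF b]
  define F where "F = (\<lambda>u w. a u * (b (inv u \<otimes> w) * y (t \<otimes> w)))"
  have bu: "(\<lambda>w. \<bar>b (inv u \<otimes> w)\<bar>) summable_on carrier G" if "u \<in> carrier G" for u
    using summable_on_reindex_bij_betw[OF bij_betw_left_mult[of "inv u"], of "\<lambda>w. \<bar>b w\<bar>"] that bs by simp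
  have bu_sum: "(\<Sum>\<^sub>\<infinity>w\<in>carrier G. \<bar>b (inv u \<otimes> w)\<bar>) = (\<Sum>\<^sub>\<infinity>w\<in>carrier G. \<bar>b w\<bar>)" if "u \<in> carrier G" for u
    using infsum_reindex_bij_betw[OF bij_betw_left_mult[of "inv u"], of "\<lambda>w. \<bar>b w\<bar>"] that by simp
  have yt: "\<bar>y (t \<otimes> w)\<bar> \<le> B" if "w \<in> carrier G" for w using y t that by simp
  have inner: "(\<lambda>w. b (inv u \<otimes> w) * y (t \<otimes> w)) abs_summable_on carrier G" if "u \<in> carrier G" for u
    by (rule l1_mult_bounded_summable[OF bu[OF that] yt])
  define N where "N = B * (\<Sum>\<^sub>\<infinity>w\<in>carrier G. \<bar>b w\<bar>)"
  have inner_le: "(\<Sum>\<^sub>\<infinity>w\<in>carrier G. \<bar>b (inv u \<otimes> w) * y (t \<otimes> w)\<bar>) \<le> N" if u: "u \<in> carrier G" for u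
  proof -
    have "(\<Sum>\<^sub>\<infinity>w\<in>carrier G. \<bar>b (inv u \<otimes> w) * y (t \<otimes> w)\<bar>) \<le> (\<Sum>\<^sub>\<infinity>w\<in>carrier G. B * \<bar>b (inv u \<otimes> w)\<bar>)"
    proof (rule infsum_mono[OF _ summable_on_cmult_right[OF bu[OF u]]])
      show "(\<lambda>w. \<bar>b (inv u \<otimes> w) * y (t \<otimes> w)\<bar>) summable_on carrier G" using inner[OF u] by simp
      fix w assume "w \<in> carrier G"
      hence "\<bar>b (inv u \<otimes> w)\<bar> * \<bar>y (t \<otimes> w)\<bar> \<le> \<bar>b (inv u \<otimes> w)\<bar> * B"
        using yt by (intro mult_left_mono) auto
      thus "\<bar>b (inv u \<otimes> w) * y (t \<otimes> w)\<bar> \<le> B * \<bar>b (inv u \<otimes> w)\<bar>"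
        by (simp add: abs_mult mult.commute)
    qed
    also have "\<dots> = N" unfolding N_def by (simp add: infsum_cmult_right' bu_sum[OF u])
    finally show ?thesis .
  qed
  have "(\<lambda>(u, w). F u w) abs_summable_on carrier G \<times> carrier G"
    unfolding Infinite_Sum.abs_summable_on_Sigma_iff
  proof (intro conjI ballI)
    fix u assume u: "u \<in> carrier G"
    show "(\<lambda>w. (case (u, w) of (u, w) \<Rightarrow> F u w)) abs_summable_on carrier G"
      using summable_on_cmult_right[OF inner[OF u], of "\<bar>a u\<bar>"] by (simp add: F_def abs_mult)
  next
    have "(\<lambda>u. \<bar>a u\<bar> * (\<Sum>\<^sub>\<infinity>w\<in>carrier G. \<bar>b (inv u \<otimes> w) * y (t \<otimes> w)\<bar>)) abs_summable_on carrier G"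
    proof (rule l1_mult_bounded_summable)
      show "(\<lambda>u. \<bar>\<bar>a u\<bar>\<bar>) summable_on carrier G" using as by simp
      fix u assume "u \<in> carrier G"
      thus "\<bar>\<Sum>\<^sub>\<infinity>w\<in>carrier G. \<bar>b (inv u \<otimes> w) * y (t \<otimes> w)\<bar>\<bar> \<le> N"
        using inner_le by (simp add: infsum_nonneg)
    qed
    thus "(\<lambda>u. \<Sum>\<^sub>\<infinity>w\<in>carrier G. norm (case (u, w) of (u, w) \<Rightarrow> F u w)) abs_summable_on carrier G"
      by (simp add: F_def abs_mult infsum_cmult_right')
  qed
  hence sw: "(\<lambda>(u, w). F u w) summable_on carrier G \<times> carrier G" by (rule Infinite_Sum.abs_summable_summable)
  have "conv a (conv b y) t = (\<Sum>\<^sub>\<infinity>u\<in>carrier G. \<Sum>\<^sub>\<infinity>w\<in>carrier G. F u w)"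
    unfolding conv_def[of a]
  proof (rule infsum_cong)
    fix u assume u: "u \<in> carrier G"
    have "conv b y (t \<otimes> u) = (\<Sum>\<^sub>\<infinity>w\<in>carrier G. b (inv u \<otimes> w) * y (t \<otimes> u \<otimes> (inv u \<otimes> w)))"
      unfolding conv_def
      by (rule infsum_reindex_bij_betw[OF bij_betw_left_mult[of "inv u"], symmetric]) (use u in simp)
    also have "\<dots> = (\<Sum>\<^sub>\<infinity>w\<in>carrier G. b (inv u \<otimes> w) * y (t \<otimes> w))"
    proof (rule infsum_cong)
      fix w assume w: "w \<in> carrier G"
      have "t \<otimes> u \<otimes> (inv u \<otimes> w) = t \<otimes> (u \<otimes> inv u) \<otimes> w" using t u w by (simp only: m_assoc inv_closed m_closed)
      also have "\<dots> = t \<otimes> w" using t u w by simp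
      finally show "b (inv u \<otimes> w) * y (t \<otimes> u \<otimes> (inv u \<otimes> w)) = b (inv u \<otimes> w) * y (t \<otimes> w)" by simp
    qed
    finally show "a u * conv b y (t \<otimes> u) = (\<Sum>\<^sub>\<infinity>w\<in>carrier G. F u w)"
      by (simp add: F_def infsum_cmult_right')
  qed
  also have "\<dots> = (\<Sum>\<^sub>\<infinity>w\<in>carrier G. \<Sum>\<^sub>\<infinity>u\<in>carrier G. F u w)" by (rule infsum_swap_banach[OF sw])
  also have "\<dots> = conv (a \<otimes>\<^bsub>l1_algebra G\<^esub> b) y t" unfolding conv_def
  proof (rule infsum_cong)
    fix w assume w: "w \<in> carrier G"
    have "(\<Sum>\<^sub>\<infinity>u\<in>carrier G. F u w) = (\<Sum>\<^sub>\<infinity>u\<in>carrier G. a u * b (inv u \<otimes> w) * y (t \<otimes> w))"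
      by (simp add: F_def mult.assoc)
    also have "\<dots> = (\<Sum>\<^sub>\<infinity>u\<in>carrier G. a u * b (inv u \<otimes> w)) * y (t \<otimes> w)" by (rule infsum_cmult_left')
    also have "(\<Sum>\<^sub>\<infinity>u\<in>carrier G. a u * b (inv u \<otimes> w)) = (a \<otimes>\<^bsub>l1_algebra G\<^esub> b) w" using w by (simp add: l1_algebra_def)
    finally show "(\<Sum>\<^sub>\<infinity>u\<in>carrier G. F u w) = (a \<otimes>\<^bsub>l1_algebra G\<^esub> b) w * y (t \<otimes> w)" .
  qed
  finally show ?thesis .
qed

lemma conv_one: "t \<in> carrier G \<Longrightarrow> conv \<one>\<^bsub>l1_algebra G\<^esub> y t = y t"
proof -
  assume t: "t \<in> carrier G"
  have "conv \<one>\<^bsub>l1_algebra G\<^esub> y t = (\<Sum>\<^sub>\<infinity>u\<in>{\<one>}. y t)"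
    unfolding conv_def by (rule infsum_cong_neutral) (use t in \<open>auto simp: l1_algebra_def group_delta_def\<close>)
  thus ?thesis by simp
qed

lemma conv_diff:
  assumes a: "a \<in> carrier (l1_algebra G)" and t: "t \<in> carrier G"
    and y: "\<And>s. s \<in> carrier G \<Longrightarrow> \<bar>y s\<bar> \<le> B" and z: "\<And>s. s \<in> carrier G \<Longrightarrow> \<bar>z s\<bar> \<le> B"
  shows "conv a y t - conv a z t = conv a (\<lambda>s. y s - z s) t"
proof -
  note as = l1_carrier_summable[OF a]
  have 1: "(\<lambda>u. a u * y (t \<otimes> u)) summable_on carrier G" "(\<lambda>u. a u * z (t \<otimes> u)) summable_on carrier G"
    by (rule Infinite_Sum.abs_summable_summable, rule l1_mult_bounded_summable[OF as, where B=B], use y z t in simp)+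
  have "conv a (\<lambda>s. y s - z s) t = (\<Sum>\<^sub>\<infinity>u\<in>carrier G. a u * y (t \<otimes> u) + (- 1) * (a u * z (t \<otimes> u)))"
    unfolding conv_def by (simp add: right_diff_distrib)
  also have "\<dots> = conv a y t + (\<Sum>\<^sub>\<infinity>u\<in>carrier G. (- 1) * (a u * z (t \<otimes> u)))"
    unfolding conv_def by (rule infsum_add[OF 1(1) summable_on_cmult_right[OF 1(2)]])
  also have "\<dots> = conv a y t - conv a z t" unfolding conv_def infsum_cmult_right' by simp
  finally show ?thesis by simp
qed

text \<open>If \<open>y\<close> vanishes on \<open>t V\<close>, only the tail of \<open>a\<close> outside \<open>V\<close> contributes at \<open>t\<close>.\<close>

lemma conv_local:
  assumes a: "a \<in> carrier (l1_algebra G)" and t: "t \<in> carrier G" and V: "V \<subseteq> carrier G"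
    and y: "\<And>s. s \<in> carrier G \<Longrightarrow> \<bar>y s\<bar> \<le> B" and z: "\<And>v. v \<in> V \<Longrightarrow> y (t \<otimes> v) = 0"
  shows "\<bar>conv a y t\<bar> \<le> B * (\<Sum>\<^sub>\<infinity>u\<in>carrier G - V. \<bar>a u\<bar>)"
proof -
  have "conv a y t = (\<Sum>\<^sub>\<infinity>u\<in>carrier G - V. a u * y (t \<otimes> u))"
    unfolding conv_def by (rule infsum_cong_neutral) (use z in auto)
  also have "\<bar>\<dots>\<bar> \<le> B * (\<Sum>\<^sub>\<infinity>u\<in>carrier G - V. \<bar>a u\<bar>)"
    by (rule l1_mult_bounded_le)
      (use y t summable_on_subset_banach[OF l1_carrier_summable[OF a]] in auto)
  finally show ?thesis .
qed

lemma l1_small_tail: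
  assumes a: "a \<in> carrier (l1_algebra G)" and e: "0 < e"
  shows "\<exists>V. finite V \<and> V \<subseteq> carrier G \<and> (\<Sum>\<^sub>\<infinity>u\<in>carrier G - V. \<bar>a u\<bar>) \<le> e"
proof -
  note as = l1_carrier_summable[OF a]
  obtain V where V: "finite V" "V \<subseteq> carrier G"
    and d: "dist (\<Sum>u\<in>V. \<bar>a u\<bar>) (\<Sum>\<^sub>\<infinity>u\<in>carrier G. \<bar>a u\<bar>) \<le> e"
    using infsum_finite_approximation[OF as e] by blast
  have "(\<Sum>\<^sub>\<infinity>u\<in>carrier G - V. \<bar>a u\<bar>) = (\<Sum>\<^sub>\<infinity>u\<in>carrier G. \<bar>a u\<bar>) - (\<Sum>\<^sub>\<infinity>u\<in>V. \<bar>a u\<bar>)"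
    by (rule infsum_Diff[OF as _ V(2)]) (use V in simp)
  thus ?thesis using V d by (auto simp: dist_real_def abs_le_iff intro!: exI[of _ V])
qed

end

section \<open>Compactness of families of closed relations\<close>

text \<open>A decreasing sequence of sequentially closed relations whose intersection lies in the diagonal is
  eventually inside every uniform neighbourhood of the diagonal.\<close>

lemma (in Metric_space) compact_separating_relations:
  assumes comp: "compact_space mtopology"
    and dec: "\<And>n m x y. n \<le> m \<Longrightarrow> P m x y \<Longrightarrow> P n x y"
    and cl: "\<And>n \<sigma> \<tau> x y. limitin mtopology \<sigma> x sequentially \<Longrightarrow> limitin mtopology \<tau> y sequentially \<Longrightarrow>
        (\<And>k. \<sigma> k \<in> M) \<Longrightarrow> (\<And>k. \<tau> k \<in> M) \<Longrightarrow> (\<And>k. P n (\<sigma> k) (\<tau> k)) \<Longrightarrow> P n x y"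
    and sep: "\<And>x y. x \<in> M \<Longrightarrow> y \<in> M \<Longrightarrow> (\<And>n::nat. P n x y) \<Longrightarrow> x = y"
    and e: "0 < e"
  shows "\<exists>n. \<forall>x\<in>M. \<forall>y\<in>M. P n x y \<longrightarrow> d x y \<le> e"
proof (rule ccontr)
  assume "\<nexists>n. \<forall>x\<in>M. \<forall>y\<in>M. P n x y \<longrightarrow> d x y \<le> e"
  hence "\<forall>n. \<exists>x y. x \<in> M \<and> y \<in> M \<and> P n x y \<and> \<not> d x y \<le> e" by blast
  then obtain \<sigma> \<tau> where st: "\<And>n. \<sigma> n \<in> M" "\<And>n. \<tau> n \<in> M" "\<And>n. P n (\<sigma> n) (\<tau> n)" "\<And>n. \<not> d (\<sigma> n) (\<tau> n) \<le> e"
    by metis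
  have sub: "\<exists>l r. l \<in> M \<and> strict_mono r \<and> limitin mtopology (\<sigma> \<circ> r) l sequentially"
    if "range \<sigma> \<subseteq> M" for \<sigma> :: "nat \<Rightarrow> 'a"
    using comp that unfolding compact_space_sequentially by blast
  have "range \<sigma> \<subseteq> M" using st(1) by auto
  then obtain x r where x: "x \<in> M" "strict_mono r" "limitin mtopology (\<sigma> \<circ> r) x sequentially"
    using sub by blast
  have "range (\<tau> \<circ> r) \<subseteq> M" using st(2) by auto
  then obtain y r' where y: "y \<in> M" "strict_mono r'" "limitin mtopology (\<tau> \<circ> r \<circ> r') y sequentially"
    using sub by blast
  have x': "limitin mtopology (\<sigma> \<circ> r \<circ> r') x sequentially" by (rule limitin_subsequence[OF y(2) x(3)])
  have grow: "k \<le> r (r' k)" for k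
    using seq_suble[OF x(2), of "r' k"] seq_suble[OF y(2), of k] by linarith
  have "P n x y" for n
  proof (rule cl)
    have sm: "strict_mono (\<lambda>k. k + n)" by (simp add: strict_mono_def)
    show "limitin mtopology (\<sigma> \<circ> r \<circ> r' \<circ> (\<lambda>k. k + n)) x sequentially" by (rule limitin_subsequence[OF sm x'])
    show "limitin mtopology (\<tau> \<circ> r \<circ> r' \<circ> (\<lambda>k. k + n)) y sequentially" by (rule limitin_subsequence[OF sm y(3)])
    fix k
    have "n \<le> r (r' (k + n))" using grow[of "k + n"] by linarith
    thus "P n ((\<sigma> \<circ> r \<circ> r' \<circ> (\<lambda>k. k + n)) k) ((\<tau> \<circ> r \<circ> r' \<circ> (\<lambda>k. k + n)) k)"
      using dec st(3)[of "r (r' (k + n))"] by simp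
  qed (use st in auto)
  hence "x = y" using sep x y by blast
  have "eventually (\<lambda>k. (\<sigma> \<circ> r \<circ> r') k \<in> M \<and> d ((\<sigma> \<circ> r \<circ> r') k) x < e / 2) sequentially"
    using x' half_gt_zero[OF e] unfolding limitin_metric by blast
  moreover have "eventually (\<lambda>k. (\<tau> \<circ> r \<circ> r') k \<in> M \<and> d ((\<tau> \<circ> r \<circ> r') k) x < e / 2) sequentially"
    using y(3) half_gt_zero[OF e] unfolding limitin_metric \<open>x = y\<close> by blast
  ultimately have "eventually (\<lambda>k. False) sequentially"
  proof eventually_elim
    case (elim k)
    have "d ((\<sigma> \<circ> r \<circ> r') k) ((\<tau> \<circ> r \<circ> r') k) \<le> d ((\<sigma> \<circ> r \<circ> r') k) x + d x ((\<tau> \<circ> r \<circ> r') k)"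
      by (rule triangle) (use elim x in auto)
    also have "\<dots> < e" using elim by (simp add: commute)
    finally show False using st(4)[of "r (r' k)"] by simp
  qed
  thus False by simp
qed

lemma (in Metric_space) limitin_dist_le:
  assumes \<sigma>: "limitin mtopology \<sigma> x sequentially" and \<tau>: "limitin mtopology \<tau> y sequentially"
    and le: "\<And>k. d (\<sigma> k) (\<tau> k) \<le> c"
  shows "d x y \<le> c"
proof (rule field_le_epsilon)
  fix e :: real assume e: "0 < e"
  have xy: "x \<in> M" "y \<in> M" using \<sigma> \<tau> unfolding limitin_metric by auto
  have "eventually (\<lambda>k. \<sigma> k \<in> M \<and> d (\<sigma> k) x < e / 2) sequentially"
    using \<sigma> half_gt_zero[OF e] unfolding limitin_metric by blast
  moreover have "eventually (\<lambda>k. \<tau> k \<in> M \<and> d (\<tau> k) y < e / 2) sequentially"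
    using \<tau> half_gt_zero[OF e] unfolding limitin_metric by blast
  ultimately have "eventually (\<lambda>k. d x y \<le> c + e) sequentially"
  proof eventually_elim
    case (elim k)
    have "d x y \<le> d x (\<sigma> k) + d (\<sigma> k) y" by (rule triangle) (use elim xy in auto)
    also have "d (\<sigma> k) y \<le> d (\<sigma> k) (\<tau> k) + d (\<tau> k) y" by (rule triangle) (use elim xy in auto)
    finally show ?case using elim le[of k] by (simp add: commute)
  qed
  thus "d x y \<le> c + e" by simp
qed

lemma (in Metric_space) compact_uniformly_continuous:
  fixes \<phi> :: "'a \<Rightarrow> complex"
  assumes comp: "compact_space mtopology" and \<phi>: "continuous_map mtopology euclidean \<phi>" and c: "0 < c"
  shows "\<exists>e>0. \<forall>x\<in>M. \<forall>y\<in>M. d x y \<le> e \<longrightarrow> norm (\<phi> x - \<phi> y) \<le> c"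
proof -
  define U where "U = (\<lambda>z. {x \<in> M. \<phi> x \<in> ball z (c / 2)})"
  have "openin mtopology V" if "V \<in> range U" for V
    using that openin_continuous_map_preimage[OF \<phi>, of "ball _ (c / 2)"] by (auto simp: U_def)
  moreover have "M \<subseteq> \<Union>(range U)"
  proof
    fix x assume "x \<in> M"
    hence "x \<in> U (\<phi> x)" using c by (simp add: U_def)
    thus "x \<in> \<Union>(range U)" by blast
  qed
  ultimately obtain e where e: "0 < e" "\<forall>x\<in>M. \<exists>V\<in>range U. mball x e \<subseteq> V"
    using lebesgue_number[of M "range U"] comp by (auto simp: compact_space_def)
  show ?thesis
  proof (intro exI[of _ "e / 2"] conjI ballI impI)
    fix x y assume xy: "x \<in> M" "y \<in> M" "d x y \<le> e / 2"
    obtain z where z: "mball x e \<subseteq> U z" using e(2) xy(1) by blast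
    have "x \<in> mball x e" "y \<in> mball x e" using xy e(1) by auto
    hence "x \<in> U z" "y \<in> U z" using z by blast+
    hence "dist z (\<phi> x) < c / 2" "dist z (\<phi> y) < c / 2" by (auto simp: U_def)
    hence "dist (\<phi> x) (\<phi> y) < c" by (rule dist_triangle_half_r)
    thus "norm (\<phi> x - \<phi> y) \<le> c" by (simp add: dist_norm)
  qed (use e in simp)
qed

lemma (in compact_metric_action) expansive_finite_window:
  assumes ex: "\<And>x y. x \<in> M \<Longrightarrow> y \<in> M \<Longrightarrow> (\<And>s. s \<in> carrier G \<Longrightarrow> d (act s x) (act s y) \<le> e0) \<Longrightarrow> x = y"
    and e: "0 < e"
  shows "\<exists>W. finite W \<and> W \<subseteq> carrier G \<and>
        (\<forall>x\<in>M. \<forall>y\<in>M. (\<forall>s\<in>W. d (act s x) (act s y) \<le> e0) \<longrightarrow> d x y \<le> e)"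
proof -
  define W where "W = (\<lambda>n. from_nat_into (carrier G) ` {..n::nat})"
  have ne: "carrier G \<noteq> {}" using one_closed by blast
  have WG: "W n \<subseteq> carrier G" for n unfolding W_def using from_nat_into[OF ne] by auto
  have "\<exists>n. \<forall>x\<in>M. \<forall>y\<in>M. (\<forall>s\<in>W n. d (act s x) (act s y) \<le> e0) \<longrightarrow> d x y \<le> e"
  proof (rule compact_separating_relations[OF compact_mtopology _ _ _ e])
    fix n m x y assume "n \<le> m" "\<forall>s\<in>W m. d (act s x) (act s y) \<le> e0"
    thus "\<forall>s\<in>W n. d (act s x) (act s y) \<le> e0" by (auto simp: W_def)
  next
    fix n \<sigma> \<tau> x y
    assume l: "limitin mtopology \<sigma> x sequentially" "limitin mtopology \<tau> y sequentially"
      and P: "\<And>k. \<forall>s\<in>W n. d (act s (\<sigma> k)) (act s (\<tau> k)) \<le> e0"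
    show "\<forall>s\<in>W n. d (act s x) (act s y) \<le> e0"
    proof
      fix s assume s: "s \<in> W n"
      hence sG: "s \<in> carrier G" using WG by blast
      show "d (act s x) (act s y) \<le> e0"
      proof (rule limitin_dist_le)
        show "limitin mtopology (act s \<circ> \<sigma>) (act s x) sequentially" by (rule continuous_map_limit[OF act_continuous[OF sG] l(1)])
        show "limitin mtopology (act s \<circ> \<tau>) (act s y) sequentially" by (rule continuous_map_limit[OF act_continuous[OF sG] l(2)])
      qed (use P s in auto)
    qed
  next
    fix x y assume xy: "x \<in> M" "y \<in> M" and P: "\<And>n. \<forall>s\<in>W n. d (act s x) (act s y) \<le> e0"
    show "x = y"
    proof (rule ex[OF xy])
      fix s assume "s \<in> carrier G"
      then obtain n where "from_nat_into (carrier G) n = s"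
        using from_nat_into_surj[OF countable_carrier] by blast
      hence "s \<in> W n" by (auto simp: W_def)
      thus "d (act s x) (act s y) \<le> e0" using P by blast
    qed
  qed
  then obtain n where "\<forall>x\<in>M. \<forall>y\<in>M. (\<forall>s\<in>W n. d (act s x) (act s y) \<le> e0) \<longrightarrow> d x y \<le> e" by blast
  thus ?thesis using WG by (intro exI[of _ "W n"]) (auto simp: W_def)
qed

section \<open>Expansiveness and specification\<close>

text \<open>The function \<open>g\<close> is the inverse of \<open>f\<close> in the \<open>\<ell>\<^sup>1\<close> algebra, and \<open>\<rho>\<close> is any metric for the topology of
  the dual.\<close>

locale l1_invertible_element = group_ring_element +
  fixes g :: "'a \<Rightarrow> real" and \<rho> :: "(('a \<Rightarrow> int) set \<Rightarrow> complex) \<Rightarrow> (('a \<Rightarrow> int) set \<Rightarrow> complex) \<Rightarrow> real"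
  assumes countable_carrier: "countable (carrier G)"
    and f_l1: "(\<lambda>s. real_of_int (f s)) \<in> carrier (l1_algebra G)"
    and g_l1: "g \<in> carrier (l1_algebra G)"
    and g_f: "g \<otimes>\<^bsub>l1_algebra G\<^esub> (\<lambda>s. real_of_int (f s)) = \<one>\<^bsub>l1_algebra G\<^esub>"
    and f_g: "(\<lambda>s. real_of_int (f s)) \<otimes>\<^bsub>l1_algebra G\<^esub> g = \<one>\<^bsub>l1_algebra G\<^esub>"
    and metric: "Metric_space chars \<rho>"
    and metric_topology: "Metric_space.mtopology chars \<rho> = X_top G f"
begin

sublocale X: compact_metric_action G chars \<rho> "X_act G f"
proof -
  interpret Metric_space chars \<rho> by (rule metric)
  show "compact_metric_action G chars \<rho> (X_act G f)"
    by unfold_locales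
      (auto simp: metric_topology countable_carrier compact_X_top continuous_map_X_act X_act_one X_act_mult)
qed

lemma conv_f_eq_conv: "t \<in> carrier G \<Longrightarrow> conv_f y t = conv (\<lambda>s. real_of_int (f s)) y t"
proof -
  assume t: "t \<in> carrier G"
  have ff: "finite (supp f)" "supp f \<subseteq> carrier G" using f_carrier by (auto simp: ZG_carrier_iff)
  have "conv (\<lambda>s. real_of_int (f s)) y t = (\<Sum>\<^sub>\<infinity>u\<in>supp f. real_of_int (f u) * y (t \<otimes> u))"
    unfolding conv_def by (rule infsum_cong_neutral) (use ff in auto)
  thus ?thesis using ff by (simp add: conv_f_def)
qed

text \<open>The \<open>\<ell>\<^sup>1\<close> norm of \<open>f\<close>.\<close>

definition f_norm :: real where "f_norm = (\<Sum>u\<in>supp f. \<bar>real_of_int (f u)\<bar>)"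

lemma f_norm_nonneg: "0 \<le> f_norm"
  unfolding f_norm_def by (simp add: sum_nonneg)

lemma conv_f_bound:
  assumes t: "t \<in> carrier G" and y: "\<And>s. s \<in> carrier G \<Longrightarrow> \<bar>y s\<bar> \<le> B"
  shows "\<bar>conv_f y t\<bar> \<le> f_norm * B"
proof -
  have ff: "supp f \<subseteq> carrier G" using f_carrier by (auto simp: ZG_carrier_iff)
  have "\<bar>conv_f y t\<bar> \<le> (\<Sum>u\<in>supp f. \<bar>real_of_int (f u) * y (t \<otimes> u)\<bar>)" unfolding conv_f_def by (rule sum_abs)
  also have "\<dots> \<le> (\<Sum>u\<in>supp f. \<bar>real_of_int (f u)\<bar> * B)"
  proof (rule sum_mono)
    fix u assume "u \<in> supp f"
    hence "t \<otimes> u \<in> carrier G" using ff t by auto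
    thus "\<bar>real_of_int (f u) * y (t \<otimes> u)\<bar> \<le> \<bar>real_of_int (f u)\<bar> * B"
      unfolding abs_mult by (intro mult_left_mono y) simp_all
  qed
  also have "\<dots> = f_norm * B" by (simp add: f_norm_def sum_distrib_right)
  finally show ?thesis .
qed

lemma conv_g_conv_f:
  assumes y: "\<And>s. s \<in> carrier G \<Longrightarrow> \<bar>y s\<bar> \<le> B" and t: "t \<in> carrier G"
  shows "conv g (conv_f y) t = y t"
proof -
  have "conv g (conv_f y) t = conv g (conv (\<lambda>s. real_of_int (f s)) y) t"
    unfolding conv_def[of g] by (rule infsum_cong) (simp add: conv_f_eq_conv t)
  also have "\<dots> = conv (g \<otimes>\<^bsub>l1_algebra G\<^esub> (\<lambda>s. real_of_int (f s))) y t"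
    by (rule conv_mult[OF g_l1 f_l1 y t])
  finally show ?thesis by (simp add: g_f conv_one[OF t])
qed

lemma conv_f_conv_g:
  assumes y: "\<And>s. s \<in> carrier G \<Longrightarrow> \<bar>y s\<bar> \<le> B" and t: "t \<in> carrier G"
  shows "conv_f (conv g y) t = y t"
proof -
  have "conv_f (conv g y) t = conv ((\<lambda>s. real_of_int (f s)) \<otimes>\<^bsub>l1_algebra G\<^esub> g) y t"
    unfolding conv_f_eq_conv[OF t] by (rule conv_mult[OF f_l1 g_l1 y t])
  thus ?thesis by (simp add: f_g conv_one[OF t])
qed

text \<open>If all angles of the quotient of two characters are at most \<open>1 / (f_norm + 1)\<close>, then \<open>conv_f\<close> of the
  angle function is integer valued with absolute values less than \<open>1\<close>, hence zero; and convolution by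
  \<open>f\<close> is injective on bounded functions.\<close>

lemma chars_expansive:
  "\<exists>c>0. \<forall>\<xi>\<in>chars. \<forall>\<eta>\<in>chars.
    (\<forall>s\<in>carrier G. norm (\<xi> (cls (group_delta s)) - \<eta> (cls (group_delta s))) \<le> c) \<longrightarrow> \<xi> = \<eta>"
proof -
  define \<kappa> where "\<kappa> = 1 / (f_norm + 1)"
  have \<kappa>: "0 < \<kappa>" using f_norm_nonneg by (simp add: \<kappa>_def)
  have "isCont Arg 1" by (rule continuous_at_Arg) (simp add: complex_nonpos_Reals_iff)
  then obtain c' where c': "0 < c'" "\<And>z. dist z 1 < c' \<Longrightarrow> dist (Arg z) (Arg 1) < \<kappa>"
    unfolding continuous_at_eps_delta using \<kappa> by blast
  show ?thesis
  proof (intro exI[of _ "c' / 2"] conjI ballI impI)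
    fix \<xi> \<eta> assume \<xi>: "\<xi> \<in> chars" and \<eta>: "\<eta> \<in> chars"
      and close': "\<forall>s\<in>carrier G. norm (\<xi> (cls (group_delta s)) - \<eta> (cls (group_delta s))) \<le> c' / 2"
    have close: "norm (\<xi> (cls (group_delta s)) - \<eta> (cls (group_delta s))) \<le> c' / 2" if "s \<in> carrier G" for s
      using close' that by (rule bspec)
    define \<zeta> where "\<zeta> = (\<lambda>c\<in>carrier Q. \<xi> c * cnj (\<eta> c))"
    have \<zeta>: "\<zeta> \<in> chars" unfolding \<zeta>_def by (rule char_mult_cnj[OF \<xi> \<eta>])
    obtain \<theta> where l: "lifts \<theta> \<zeta>" and \<theta>: "\<And>s. \<theta> s = Arg (\<zeta> (cls (group_delta s))) / (2 * pi)"
      using lift_exists[OF \<zeta>] by blast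
    have small: "\<bar>\<theta> s\<bar> \<le> \<kappa>" if s: "s \<in> carrier G" for s
    proof -
      let ?c = "cls (group_delta s)"
      have q: "?c \<in> carrier Q" by (rule cls_in_Q[OF ZG_delta_closed[OF s]])
      have n: "norm (\<eta> ?c) = 1" by (rule char_norm[OF \<eta> q])
      have "\<eta> ?c * cnj (\<eta> ?c) = 1" using n by (simp add: complex_norm_square[symmetric])
      hence "\<zeta> ?c - 1 = (\<xi> ?c - \<eta> ?c) * cnj (\<eta> ?c)" using q by (simp add: \<zeta>_def left_diff_distrib)
      hence "norm (\<zeta> ?c - 1) = norm (\<xi> ?c - \<eta> ?c)" using n by (simp add: norm_mult)
      hence "dist (\<zeta> ?c) 1 < c'" using close[OF s] c'(1) by (simp add: dist_norm)
      hence "\<bar>Arg (\<zeta> ?c)\<bar> < \<kappa>" using c'(2) by (fastforce simp: dist_real_def)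
      moreover have "\<bar>\<theta> s\<bar> \<le> \<bar>Arg (\<zeta> ?c)\<bar>"
      proof -
        have "\<bar>Arg (\<zeta> ?c)\<bar> * 1 \<le> \<bar>Arg (\<zeta> ?c)\<bar> * (2 * pi)"
          using pi_gt3 by (intro mult_left_mono) auto
        thus ?thesis unfolding \<theta> by (simp add: abs_divide divide_le_eq)
      qed
      ultimately show ?thesis by simp
    qed
    have zero: "conv_f \<theta> t = 0" if t: "t \<in> carrier G" for t
    proof -
      have "\<bar>conv_f \<theta> t\<bar> \<le> f_norm * \<kappa>" by (rule conv_f_bound[OF t small])
      also have "\<dots> < 1" using f_norm_nonneg by (simp add: \<kappa>_def)
      finally show ?thesis using conv_f_lift_Ints[OF \<zeta> l t] Ints_nonzero_abs_less1 by blast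
    qed
    have "\<theta> t = 0" if t: "t \<in> carrier G" for t
    proof -
      have "\<theta> t = conv g (conv_f \<theta>) t" by (rule conv_g_conv_f[OF small t, symmetric])
      also have "\<dots> = (\<Sum>\<^sub>\<infinity>u\<in>carrier G. 0)" unfolding conv_def by (rule infsum_cong) (simp add: zero t)
      finally show ?thesis by simp
    qed
    hence "\<zeta> (cls (group_delta s)) = 1" if "s \<in> carrier G" for s using l that by (simp add: lifts_def)
    show "\<xi> = \<eta>"
    proof (rule char_eqI[OF \<xi> \<eta>])
      fix s assume s: "s \<in> carrier G"
      let ?c = "cls (group_delta s)"
      have q: "?c \<in> carrier Q" by (rule cls_in_Q[OF ZG_delta_closed[OF s]])
      have n: "cnj (\<eta> ?c) * \<eta> ?c = 1" using char_norm[OF \<eta> q] by (simp add: complex_norm_square[symmetric] mult.commute[of "cnj _"])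
      have "\<xi> ?c * cnj (\<eta> ?c) = 1" using \<open>\<And>s. s \<in> carrier G \<Longrightarrow> \<zeta> (cls (group_delta s)) = 1\<close>[OF s] q by (simp add: \<zeta>_def)
      hence "\<xi> ?c * (cnj (\<eta> ?c) * \<eta> ?c) = \<eta> ?c" by (simp add: mult.assoc[symmetric])
      thus "\<xi> ?c = \<eta> ?c" by (simp add: n)
    qed
  qed (use c' in simp)
qed

lemma action_expansive:
  shows "\<exists>e0>0. \<forall>e>0. \<exists>W. finite W \<and> W \<subseteq> carrier G \<and>
     (\<forall>\<xi>\<in>chars. \<forall>\<eta>\<in>chars. (\<forall>s\<in>W. \<rho> (X_act G f s \<xi>) (X_act G f s \<eta>) \<le> e0) \<longrightarrow> \<rho> \<xi> \<eta> \<le> e)"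
proof -
  obtain c where c: "0 < c" and ex: "\<forall>\<xi>\<in>chars. \<forall>\<eta>\<in>chars.
    (\<forall>s\<in>carrier G. norm (\<xi> (cls (group_delta s)) - \<eta> (cls (group_delta s))) \<le> c) \<longrightarrow> \<xi> = \<eta>"
    using chars_expansive by (elim exE conjE)
  have "continuous_map X.mtopology euclidean (\<lambda>\<xi>. \<xi> (cls (group_delta \<one>)))"
    unfolding metric_topology by (rule continuous_map_evaluation[OF cls_in_Q[OF ZG_delta_closed[OF one_closed]]])
  from X.compact_uniformly_continuous[OF X.compact_mtopology this c]
  obtain e0 where e0: "0 < e0" and uc: "\<forall>\<xi>\<in>chars. \<forall>\<eta>\<in>chars. \<rho> \<xi> \<eta> \<le> e0 \<longrightarrow>
      norm (\<xi> (cls (group_delta \<one>)) - \<eta> (cls (group_delta \<one>))) \<le> c"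
    by (elim exE conjE)
  have "\<exists>W. finite W \<and> W \<subseteq> carrier G \<and>
     (\<forall>\<xi>\<in>chars. \<forall>\<eta>\<in>chars. (\<forall>s\<in>W. \<rho> (X_act G f s \<xi>) (X_act G f s \<eta>) \<le> e0) \<longrightarrow> \<rho> \<xi> \<eta> \<le> e)" if e: "0 < e" for e
  proof (rule X.expansive_finite_window[OF _ e])
    fix \<xi> \<eta> assume \<xi>: "\<xi> \<in> chars" and \<eta>: "\<eta> \<in> chars"
      and close: "\<And>s. s \<in> carrier G \<Longrightarrow> \<rho> (X_act G f s \<xi>) (X_act G f s \<eta>) \<le> e0"
    show "\<xi> = \<eta>"
    proof (rule ex[rule_format, OF \<xi> \<eta>])
      fix s assume s: "s \<in> carrier G"
      have "norm (X_act G f (inv s) \<xi> (cls (group_delta \<one>)) - X_act G f (inv s) \<eta> (cls (group_delta \<one>))) \<le> c"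
        by (rule uc[rule_format]) (use s \<xi> \<eta> close X_act_chars in auto)
      thus "norm (\<xi> (cls (group_delta s)) - \<eta> (cls (group_delta s))) \<le> c" using s by (simp add: X_act_delta)
    qed
  qed
  thus ?thesis using e0 by blast
qed

text \<open>The metric is arbitrary, so its relation to the coordinates comes from compactness only.\<close>

lemma coordinates_determine_metric:
  assumes e: "0 < e"
  shows "\<exists>S c. finite S \<and> S \<subseteq> carrier G \<and> 0 < c \<and> (\<forall>\<xi>\<in>chars. \<forall>\<eta>\<in>chars.
    (\<forall>s\<in>S. norm (\<xi> (cls (group_delta s)) - \<eta> (cls (group_delta s))) \<le> c) \<longrightarrow> \<rho> \<xi> \<eta> \<le> e)"
proof -
  define W where "W = (\<lambda>n. from_nat_into (carrier G) ` {..n::nat})"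
  define P where "P = (\<lambda>n \<xi> \<eta>. \<forall>s\<in>W n. norm (\<xi> (cls (group_delta s)) - \<eta> (cls (group_delta s)) :: complex) \<le> 1 / real (Suc n))"
  have ne: "carrier G \<noteq> {}" using one_closed by blast
  have WG: "W n \<subseteq> carrier G" for n unfolding W_def using from_nat_into[OF ne] by auto
  have ev: "continuous_map X.mtopology euclidean (\<lambda>\<xi>. \<xi> (cls (group_delta s)))" if "s \<in> carrier G" for s
    unfolding metric_topology by (rule continuous_map_evaluation[OF cls_in_Q[OF ZG_delta_closed[OF that]]])
  have "\<exists>n. \<forall>\<xi>\<in>chars. \<forall>\<eta>\<in>chars. P n \<xi> \<eta> \<longrightarrow> \<rho> \<xi> \<eta> \<le> e"
  proof (rule X.compact_separating_relations[OF X.compact_mtopology _ _ _ e])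
    fix n m \<xi> \<eta> assume nm: "n \<le> m" "P m \<xi> \<eta>"
    have "1 / real (Suc m) \<le> 1 / real (Suc n)" using nm(1) by (simp add: field_simps)
    moreover have "W n \<subseteq> W m" using nm(1) by (auto simp: W_def)
    ultimately show "P n \<xi> \<eta>" using nm(2) unfolding P_def by (meson order.trans subsetD)
  next
    fix n \<sigma> \<tau> \<xi> \<eta>
    assume lim: "limitin X.mtopology \<sigma> \<xi> sequentially" "limitin X.mtopology \<tau> \<eta> sequentially"
      and Pk: "\<And>k. P n (\<sigma> k) (\<tau> k)"
    show "P n \<xi> \<eta>" unfolding P_def
    proof
      fix s assume s: "s \<in> W n"
      hence sG: "s \<in> carrier G" using WG by blast
      let ?c = "cls (group_delta s)"
      have "(\<lambda>k. \<sigma> k ?c) \<longlonglongrightarrow> \<xi> ?c" "(\<lambda>k. \<tau> k ?c) \<longlonglongrightarrow> \<eta> ?c"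
        using continuous_map_limit[OF ev[OF sG] lim(1)] continuous_map_limit[OF ev[OF sG] lim(2)] by (simp_all add: o_def)
      hence "(\<lambda>k. norm (\<sigma> k ?c - \<tau> k ?c)) \<longlonglongrightarrow> norm (\<xi> ?c - \<eta> ?c)" by (intro tendsto_intros)
      thus "norm (\<xi> ?c - \<eta> ?c) \<le> 1 / real (Suc n)"
        by (rule LIMSEQ_le_const2) (use Pk s in \<open>auto simp: P_def\<close>)
    qed
  next
    fix \<xi> \<eta> assume \<xi>: "\<xi> \<in> chars" and \<eta>: "\<eta> \<in> chars" and Pn: "\<And>n. P n \<xi> \<eta>"
    show "\<xi> = \<eta>"
    proof (rule char_eqI[OF \<xi> \<eta>])
      fix s assume "s \<in> carrier G"
      then obtain j where j: "from_nat_into (carrier G) j = s"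
        using from_nat_into_surj[OF countable_carrier] by blast
      let ?c = "cls (group_delta s)"
      have "norm (\<xi> ?c - \<eta> ?c) \<le> 1 / real (Suc n)" if "j \<le> n" for n
        using Pn[of n] j that unfolding P_def W_def by blast
      hence "norm (\<xi> ?c - \<eta> ?c) \<le> 0"
        by (intro LIMSEQ_le_const[OF LIMSEQ_inverse_real_of_nat]) (auto simp: inverse_eq_divide)
      thus "\<xi> ?c = \<eta> ?c" by simp
    qed
  qed
  then obtain n where n: "\<forall>\<xi>\<in>chars. \<forall>\<eta>\<in>chars. P n \<xi> \<eta> \<longrightarrow> \<rho> \<xi> \<eta> \<le> e" by (elim exE)
  show ?thesis
    by (rule exI[of _ "W n"], rule exI[of _ "1 / real (Suc n)"], intro conjI)
      (use WG n[unfolded P_def] in \<open>simp_all add: W_def\<close>)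
qed

lemma norm_cis_diff_le: "norm (cis a - cis b) \<le> \<bar>a - b\<bar>"
proof -
  have "cis a - cis b = cis b * (cis (a - b) - 1)" by (simp add: right_diff_distrib cis_mult)
  hence "norm (cis a - cis b) = norm (exp (\<i> * complex_of_real (a - b)) - 1)" by (simp add: norm_mult cis_conv_exp)
  also have "\<dots> = 2 * \<bar>sin ((a - b) / 2)\<bar>" by (rule dist_exp_i_1)
  also have "\<dots> \<le> \<bar>a - b\<bar>" using abs_sin_x_le_abs_x[of "(a - b) / 2"] by simp
  finally show ?thesis .
qed

text \<open>The integer functions \<open>conv_f (\<theta> i)\<close> of the given points are restricted to the
  disjoint sets \<open>{inv s \<otimes> v |s v. s \<in> E i \<and> v \<in> D}\<close> and added up; convolution by \<open>g\<close> turns the sum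
  into the angles of a character that follows all the given points, up to the tail of \<open>g\<close>. The sets are
  disjoint because the \<open>E i\<close> are kept apart by all quotients of two elements of \<open>D\<close>.\<close>

theorem has_specification: "specification_property G chars \<rho> (X_act G f)"
  unfolding specification_property_def
proof (intro allI impI)
  fix \<epsilon> :: real assume \<epsilon>: "0 < \<epsilon>"
  obtain S c where S: "finite S" "S \<subseteq> carrier G" and c: "0 < c" and det: "\<forall>\<xi>\<in>chars. \<forall>\<eta>\<in>chars.
    (\<forall>s\<in>S. norm (\<xi> (cls (group_delta s)) - \<eta> (cls (group_delta s))) \<le> c) \<longrightarrow> \<rho> \<xi> \<eta> \<le> \<epsilon>"
    using coordinates_determine_metric[OF \<epsilon>] by (elim exE conjE)
  define B where "B = f_norm * (1 / 2)"
  have B0: "0 \<le> B" using f_norm_nonneg by (simp add: B_def)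
  \<comment> \<open>The integer functions differ by at most \<open>2 B\<close>, so tails of mass \<open>\<kappa>\<close> change the angles by at most
    \<open>2 B \<kappa>\<close> turns, and the values of the characters by at most \<open>c\<close>.\<close>
  define \<kappa> where "\<kappa> = c / (2 * pi * (2 * B + 1))"
  have \<kappa>: "0 < \<kappa>" using c B0 by (simp add: \<kappa>_def)
  obtain V where V: "finite V" "V \<subseteq> carrier G" and tail: "(\<Sum>\<^sub>\<infinity>u\<in>carrier G - V. \<bar>g u\<bar>) \<le> \<kappa>"
    using l1_small_tail[OF g_l1 \<kappa>] by blast
  \<comment> \<open>The unit only makes \<open>F\<close> non-empty when \<open>S\<close> or \<open>V\<close> is empty.\<close>
  define D where "D = insert \<one> ((\<lambda>(v, w). v \<otimes> w) ` (S \<times> V))"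
  have D: "finite D" "D \<subseteq> carrier G" "\<one> \<in> D" using S V by (auto simp: D_def)
  define F where "F = (\<lambda>(a, b). a \<otimes> inv b) ` (D \<times> D)"
  show "\<exists>F. finite F \<and> F \<noteq> {} \<and> F \<subseteq> carrier G \<and>
        (\<forall>(m::nat) E x.
           (\<forall>i\<in>{1..m}. finite (E i) \<and> E i \<subseteq> carrier G \<and> x i \<in> chars) \<and>
           (\<forall>i\<in>{1..m}. \<forall>j\<in>{1..m}. i \<noteq> j \<longrightarrow> (F <#> E i) \<inter> E j = {}) \<longrightarrow>
           (\<exists>y\<in>chars. \<forall>i\<in>{1..m}. \<forall>s\<in>E i. \<rho> (X_act G f s (x i)) (X_act G f s y) \<le> \<epsilon>))"
  proof (rule exI[of _ F], intro conjI allI impI)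
    show "finite F" "F \<noteq> {}" "F \<subseteq> carrier G" using D by (auto simp: F_def)
    fix m :: nat and E x
    assume "(\<forall>i\<in>{1..m}. finite (E i) \<and> E i \<subseteq> carrier G \<and> x i \<in> chars) \<and>
           (\<forall>i\<in>{1..m}. \<forall>j\<in>{1..m}. i \<noteq> j \<longrightarrow> (F <#> E i) \<inter> E j = {})"
    hence E: "\<And>i. i \<in> {1..m} \<Longrightarrow> E i \<subseteq> carrier G" and x: "\<And>i. i \<in> {1..m} \<Longrightarrow> x i \<in> chars"
      and disj: "\<And>i j. i \<in> {1..m} \<Longrightarrow> j \<in> {1..m} \<Longrightarrow> i \<noteq> j \<Longrightarrow> (F <#> E i) \<inter> E j = {}" by auto
    have "\<forall>i\<in>{1..m}. \<exists>\<theta>. lifts \<theta> (x i) \<and> (\<forall>s. \<bar>\<theta> s\<bar> \<le> 1 / 2)" using lift_exists[OF x] by blast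
    then obtain \<theta> where l: "\<And>i. i \<in> {1..m} \<Longrightarrow> lifts (\<theta> i) (x i)"
      and \<theta>b: "\<And>i s. i \<in> {1..m} \<Longrightarrow> \<bar>\<theta> i s\<bar> \<le> 1 / 2" by metis
    define N where "N = (\<lambda>i. {inv s \<otimes> v |s v. s \<in> E i \<and> v \<in> D})"
    have N_unique: "i = j" if ij: "i \<in> {1..m}" "j \<in> {1..m}" and t: "t \<in> N i" "t \<in> N j" for i j t
    proof (rule ccontr)
      assume ne: "i \<noteq> j"
      obtain s v where sv: "s \<in> E i" "v \<in> D" "t = inv s \<otimes> v" using t(1) by (auto simp: N_def)
      obtain s' v' where sv': "s' \<in> E j" "v' \<in> D" "t = inv s' \<otimes> v'" using t(2) by (auto simp: N_def)
      have G: "s \<in> carrier G" "s' \<in> carrier G" "v \<in> carrier G" "v' \<in> carrier G"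
        using sv sv' E ij D by blast+
      have "s' = s' \<otimes> (inv s \<otimes> v) \<otimes> inv v \<otimes> s"
      proof -
        have "s' \<otimes> (inv s \<otimes> v) \<otimes> inv v \<otimes> s = s' \<otimes> (inv s \<otimes> ((v \<otimes> inv v) \<otimes> s))" using G by (simp only: m_assoc m_closed inv_closed)
        also have "\<dots> = s'" using G by simp
        finally show ?thesis ..
      qed
      also have "inv s \<otimes> v = inv s' \<otimes> v'" using sv sv' by simp
      also have "s' \<otimes> (inv s' \<otimes> v') \<otimes> inv v \<otimes> s = (s' \<otimes> inv s') \<otimes> v' \<otimes> inv v \<otimes> s"
        using G by (simp only: m_assoc m_closed inv_closed)
      also have "\<dots> = v' \<otimes> inv v \<otimes> s" using G by simp
      finally have "s' = v' \<otimes> inv v \<otimes> s" .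
      moreover have "v' \<otimes> inv v \<in> F" unfolding F_def using sv(2) sv'(2) by force
      ultimately have "s' \<in> F <#> E i" using sv(1) by (auto simp: set_mult_def)
      thus False using disj[OF ij ne] sv'(1) by blast
    qed
    define z where "z = (\<lambda>t. if \<exists>i\<in>{1..m}. t \<in> N i then conv_f (\<theta> (THE i. i \<in> {1..m} \<and> t \<in> N i)) t else 0)"
    have z_eq: "z t = conv_f (\<theta> i) t" if "i \<in> {1..m}" "t \<in> N i" for i t
    proof -
      have "(THE i. i \<in> {1..m} \<and> t \<in> N i) = i" by (rule the_equality) (use that N_unique in blast)+
      thus ?thesis unfolding z_def using that by auto
    qed
    have \<theta>conv: "\<bar>conv_f (\<theta> i) t\<bar> \<le> B" if "i \<in> {1..m}" "t \<in> carrier G" for i t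
      unfolding B_def by (rule conv_f_bound) (use that \<theta>b in auto)
    have zB: "\<bar>z t\<bar> \<le> B" and zI: "z t \<in> \<int>" if t: "t \<in> carrier G" for t
    proof -
      have "\<bar>z t\<bar> \<le> B \<and> z t \<in> \<int>"
      proof (cases "\<exists>i\<in>{1..m}. t \<in> N i")
        case True
        then obtain i where i: "i \<in> {1..m}" "t \<in> N i" by blast
        show ?thesis unfolding z_eq[OF i]
          using \<theta>conv[OF i(1) t] conv_f_lift_Ints[OF x[OF i(1)] l[OF i(1)] t] by blast
      next
        case False
        thus ?thesis using B0 by (simp add: z_def)
      qed
      thus "\<bar>z t\<bar> \<le> B" "z t \<in> \<int>" by auto
    qed
    have "conv_f (conv g z) t \<in> \<int>" if "t \<in> carrier G" for t
      using conv_f_conv_g[OF zB that] zI[OF that] by simp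
    then obtain y where y: "y \<in> chars" and ly: "lifts (conv g z) y" using char_of_function by blast
    show "\<exists>y\<in>chars. \<forall>i\<in>{1..m}. \<forall>s\<in>E i. \<rho> (X_act G f s (x i)) (X_act G f s y) \<le> \<epsilon>"
    proof (intro bexI[OF _ y] ballI)
      fix i s assume i: "i \<in> {1..m}" and s: "s \<in> E i"
      have sG: "s \<in> carrier G" using E[OF i] s by blast
      show "\<rho> (X_act G f s (x i)) (X_act G f s y) \<le> \<epsilon>"
      proof (rule det[rule_format])
        show "X_act G f s (x i) \<in> chars" "X_act G f s y \<in> chars" using X_act_chars[OF sG] x[OF i] y by auto
        fix v assume v: "v \<in> S"
        hence vG: "v \<in> carrier G" using S by blast
        let ?t = "inv s \<otimes> v"
        have tG: "?t \<in> carrier G" using sG vG by simp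
        have "\<theta> i ?t - conv g z ?t = conv g (conv_f (\<theta> i)) ?t - conv g z ?t"
          using conv_g_conv_f[of "\<theta> i" "1 / 2" ?t] \<theta>b[OF i] tG by simp
        also have "\<dots> = conv g (\<lambda>t. conv_f (\<theta> i) t - z t) ?t"
          by (rule conv_diff[OF g_l1 tG \<theta>conv[OF i] zB])
        also have "\<bar>\<dots>\<bar> \<le> 2 * B * (\<Sum>\<^sub>\<infinity>u\<in>carrier G - V. \<bar>g u\<bar>)"
        proof (rule conv_local[OF g_l1 tG V(2)])
          show "\<bar>conv_f (\<theta> i) t - z t\<bar> \<le> 2 * B" if "t \<in> carrier G" for t
            using \<theta>conv[OF i that] zB[OF that] by linarith
          fix w assume w: "w \<in> V"
          have "?t \<otimes> w = inv s \<otimes> (v \<otimes> w)" using sG vG w V by (auto simp: m_assoc)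
          moreover have "v \<otimes> w \<in> D" unfolding D_def using v w by force
          ultimately have "?t \<otimes> w \<in> N i" unfolding N_def using s by blast
          thus "conv_f (\<theta> i) (?t \<otimes> w) - z (?t \<otimes> w) = 0" using z_eq[OF i] by simp
        qed
        also have "\<dots> \<le> 2 * B * \<kappa>" using tail B0 by (simp add: mult_left_mono)
        finally have d: "\<bar>\<theta> i ?t - conv g z ?t\<bar> \<le> 2 * B * \<kappa>" .
        have "norm (X_act G f s (x i) (cls (group_delta v)) - X_act G f s y (cls (group_delta v)))
            = norm (cis (2 * pi * \<theta> i ?t) - cis (2 * pi * conv g z ?t))"
          using l[OF i] ly tG sG vG by (simp add: X_act_delta lifts_def)
        also have "\<dots> \<le> \<bar>2 * pi * \<theta> i ?t - 2 * pi * conv g z ?t\<bar>" by (rule norm_cis_diff_le)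
        also have "\<dots> = 2 * pi * \<bar>\<theta> i ?t - conv g z ?t\<bar>"
          by (simp add: right_diff_distrib[symmetric] abs_mult)
        also have "\<dots> \<le> 2 * pi * (2 * B * \<kappa>)" by (rule mult_left_mono[OF d]) simp
        also have "\<dots> = c * (2 * B / (2 * B + 1))" using B0 by (simp add: \<kappa>_def)
        also have "\<dots> \<le> c * 1" using B0 c by (intro mult_left_mono) auto
        finally show "norm (X_act G f s (x i) (cls (group_delta v)) - X_act G f s y (cls (group_delta v))) \<le> c" by simp
      qed
    qed
  qed
qed

end

theorem theorem3p5:
  fixes G :: "('g, 'b) monoid_scheme" and f :: "'g \<Rightarrow> int"
    and \<rho> :: "(('g \<Rightarrow> int) set \<Rightarrow> complex) \<Rightarrow> (('g \<Rightarrow> int) set \<Rightarrow> complex) \<Rightarrow> real"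
  assumes "group G" "countable (carrier G)" "infinite (carrier G)" "amenable G"
    and "f \<in> carrier (integral_group_ring G)"
    and "(\<lambda>s. real_of_int (f s)) \<in> Units (l1_algebra G)"
    and "Metric_space (topspace (X_top G f)) \<rho>"
    and "Metric_space.mtopology (topspace (X_top G f)) \<rho> = X_top G f"
  shows "specification_property G (topspace (X_top G f)) \<rho> (X_act G f)
       \<and> uniform_separation_property G (X_top G f) \<rho> (X_act G f)"
proof
  interpret group G by (rule assms)
  interpret group_ring_element G f by unfold_locales (rule assms)
  obtain g where fl: "(\<lambda>s. real_of_int (f s)) \<in> carrier (l1_algebra G)" and g: "g \<in> carrier (l1_algebra G)"
    "g \<otimes>\<^bsub>l1_algebra G\<^esub> (\<lambda>s. real_of_int (f s)) = \<one>\<^bsub>l1_algebra G\<^esub>"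
    "(\<lambda>s. real_of_int (f s)) \<otimes>\<^bsub>l1_algebra G\<^esub> g = \<one>\<^bsub>l1_algebra G\<^esub>"
    using assms(6) unfolding Units_def by blast
  interpret l1_invertible_element G f g \<rho>
    by (intro l1_invertible_element.intro l1_invertible_element_axioms.intro group_ring_element_axioms)
      (fact assms fl g)+
  show "specification_property G (topspace (X_top G f)) \<rho> (X_act G f)" by (rule has_specification)
  obtain e0 where e0: "0 < e0" and ex: "\<forall>e>0. \<exists>W. finite W \<and> W \<subseteq> carrier G \<and>
     (\<forall>\<xi>\<in>chars. \<forall>\<eta>\<in>chars. (\<forall>s\<in>W. \<rho> (X_act G f s \<xi>) (X_act G f s \<eta>) \<le> e0) \<longrightarrow> \<rho> \<xi> \<eta> \<le> e)"
    using action_expansive by (elim exE conjE)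
  interpret E: expansive_action G chars \<rho> "X_act G f" e0
    by unfold_locales (fact assms e0 ex[rule_format])+
  show "uniform_separation_property G (X_top G f) \<rho> (X_act G f)"
    using E.uniform_separation unfolding assms(8) .
qed

end
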